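(* Let $\mathbf{k}$ be a commutative ring, $\delta\in\mathbf{k}$, and $B=B^{\mathbf{k},\delta}$ the Brauer category, regarded as a stratified linear category over $\mathbb{S}$ via $B^+$ and $B^-$. Let $b'=(\varepsilon^+\otimes\varepsilon^-)\tau':B^-\otimes_{\mathbb{S}}B^+\to\mathbb{S}$ be the pairing associated to the twist $\tau'$, and let $d'$ be its copairing, $d'(1_p)=\sum_{r\preceq p}\sum_{f\in\mathbb{B}^{+,m}(r,p)}f\otimes\overline f$. Then $(B,b',d')$ is a quasi-cellular category over $\mathbb{S}$. Moreover, it is involutive with anti-involution $\overline{(\ )}$.
   Context: **Brauer diagrams.** For $p,q\ge0$, a $(p,q)$-Brauer diagram is a partition of $[p]^+\sqcup[q]^-=\{1^+,\dots,p^+\}\sqcup\{1^-,\dots,q^-\}$ into unordered pairs ($i^+$ top points, $i^-$ bottom points); $\mathbb{B}(p,q)$ is their set. Upward: no pair of two top points; downward: no pair of two bottom points; level: both; monotone: $(i-k)(j-l)>0$ for any two distinct pairs $\{i^+,j^-\},\{k^+,l^-\}$. $\mathbb{B}^+,\mathbb{B}^-,\mathbb{B}^0$: upward, downward, level diagrams; $\mathbb{B}^{\pm,m}$: monotone ones in $\mathbb{B}^\pm$. $p\preceq q$ iff $p\le q$ and $q-p$ even. **Brauer category.** Objects: non-negative integers; $B(p,q)$ free on $\mathbb{B}(p,q)$; for $f\in\mathbb{B}(q,r)$, $g\in\mathbb{B}(p,q)$, place $g$ above $f$, identify the $q$ middle points, $f\circ g=\delta^{l(f,g)}f\hat\circ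 g$ with $l(f,g)$ the number of closed loops and $f\hat\circ g$ the diagram after deleting loops. $B^\pm$: wide subcategories spanned by $\mathbb{B}^\pm$. $\mathbb{S}$: the wide subcategory spanned by level diagrams, $\mathbb{S}_p=\mathbb{S}(p,p)\cong\mathbf{k}[\mathfrak{S}_p]$, $\mathbb{S}(p,q)=0$ for $p\ne q$; objects ordered by $\preceq$. $\overline{(\ )}:B^{\mathrm{op}}\to B$ is the identity on objects and sends a diagram $f\in\mathbb{B}(p,q)$ to the diagram $\overline f\in\mathbb{B}(q,p)$ obtained by exchanging $i^\pm\leftrightarrow i^\mp$. Composition gives $B^+\otimes_{\mathbb{S}}B^-\cong B$, where $(M\otimes_{\mathbb{S}}N)(p,q)=\bigoplus_rM(r,q)\otimes_{\mathbb{S}_r}N(p,r)$. **The twist $\tau'$.** $\tau':B^-\otimes_{\mathbb{S}}B^+\to B^+\otimes_{\mathbb{S}}B^-\cong B$ is defined for $f\in\mathbb{B}^-(q,r)$, $g\in\mathbb{B}^+(p,q)$ by $\tau'(f\otimes g)=0$ if there are distinct $i,j,k\in[q]$ with $\{i^+,j^+\}\in f$ and $\{j^-,k^-\}\in g$, and $\tau'(f\otimes g)=f\hat\circ g$ otherwise. $\varepsilon^\pm:B^\pm\to\mathbb{S}$ is the identity on $B^\pm(p,p)=\mathbb{S}_p$ and $0$ on $B^{\pm}(p,q)$ for $p\ne q$. **General definitions** (for a base category $\mathcal{A}$, i.e. a linear category with $\mathrm{Ob}(\mathcal{A})$ a poset with descending chain condition and $\mathcal{A}(x,y)=0$ for $x\neq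 y$). A *stratified linear category* over $\mathcal{A}$: a linear category $\mathcal{C}$ with $\mathrm{Ob}(\mathcal{C})=\mathrm{Ob}(\mathcal{A})$, an identity-on-objects linear functor $i:\mathcal{A}\to\mathcal{C}$ and wide linear subcategories $\mathcal{C}^\pm$ with $\mathcal{C}^+(x,y)=0$ unless $x\le y$, $\mathcal{C}^-(x,y)=0$ unless $x\ge y$, $\mathcal{C}^+(x,x)=\mathcal{C}^-(x,x)$, $i:\mathcal{A}_x\to\mathcal{C}^\pm(x,x)$ an isomorphism, and composition $\bigoplus_y\mathcal{C}^+(y,z)\otimes_{\mathcal{A}_y}\mathcal{C}^-(x,y)\to\mathcal{C}(x,z)$ an isomorphism. A *quasi-cellular category* over $\mathcal{A}$: a stratified linear category with an $\mathcal{A}$-bimodule map $b':\mathcal{C}^-\otimes_{\mathcal{A}}\mathcal{C}^+\to\mathcal{A}$ and an $\mathcal{A}$-bimodule map $d':\mathcal{A}\to\mathcal{C}^+\otimes_{\mathcal{A}}\mathcal{C}^-$ satisfying the zigzag identities $(b'\otimes\mathrm{id}_{\mathcal{C}^-})(\mathrm{id}_{\mathcal{C}^-}\otimes d')=\mathrm{id}_{\mathcal{C}^-}$, $(\mathrm{id}_{\mathcal{C}^+}\otimes b')(d'\otimes\mathrm{id}_{\mathcal{C}^+})=\mathrm{id}_{\mathcal{C}^+}$ (so $b'$ is a perfect pairing with copairing $d'$), and $b'(1_x\otimes f)=\varepsilon^+(f)$, $b'(g\otimes1_x)=\varepsilon^-(g)$ for $f\in\mathcal{C}^+(z,x)$,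 $g\in\mathcal{C}^-(x,z)$. It is *involutive* with $\iota$ if $\iota:\mathcal{C}^{\mathrm{op}}\to\mathcal{C}$ is a linear functor with $\iota\circ\iota^{\mathrm{op}}=\mathrm{id}_{\mathcal{C}}$, order-preserving on objects, with $\iota(\mathcal{C}^\pm(x,y))=\mathcal{C}^\mp(\iota(y),\iota(x))$ and $\iota(b'(g\otimes f))=b'(\iota(f)\otimes\iota(g))$ for $f\in\mathcal{C}^+(x,y)$, $g\in\mathcal{C}^-(y,x)$. *)

theory Defs
  imports "HOL-Algebra.QuotRing" "HOL-Algebra.Module" "HOL-Library.Disjoint_Sets" "HOL.Hull"
begin

section \<open>Modules over a commutative ring\<close>

text \<open>
  HOL-Algebra has modules and submodules, but no linear maps, free modules, quotient modules or
  tensor products. Its \<^typ>\<open>('k, 'm) module\<close> records inherit unused \<open>mult\<close> and \<open>one\<close> fields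
  from rings; they are left \<^const>\<open>undefined\<close> below.
\<close>

definition linear_maps ::
    "('k, 'r) ring_scheme \<Rightarrow> ('k, 'm) module \<Rightarrow> ('k, 'n) module \<Rightarrow> ('m \<Rightarrow> 'n) set" where
  "linear_maps R M N = {h \<in> carrier M \<rightarrow> carrier N.
     (\<forall>x\<in>carrier M. \<forall>y\<in>carrier M. h (x \<oplus>\<^bsub>M\<^esub> y) = h x \<oplus>\<^bsub>N\<^esub> h y) \<and>
     (\<forall>a\<in>carrier R. \<forall>x\<in>carrier M. h (a \<odot>\<^bsub>M\<^esub> x) = a \<odot>\<^bsub>N\<^esub> h x)}"

definition bilinear_map ::
    "('k, 'r) ring_scheme \<Rightarrow> ('k, 'm) module \<Rightarrow> ('k, 'n) module \<Rightarrow> ('k, 'p) module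
      \<Rightarrow> ('m \<Rightarrow> 'n \<Rightarrow> 'p) \<Rightarrow> bool" where
  "bilinear_map R M N P \<beta> \<longleftrightarrow>
     (\<forall>m\<in>carrier M. \<beta> m \<in> linear_maps R N P) \<and>
     (\<forall>n\<in>carrier N. (\<lambda>m. \<beta> m n) \<in> linear_maps R M P)"

definition free_module :: "('k, 'r) ring_scheme \<Rightarrow> 'x set \<Rightarrow> ('k, 'x \<Rightarrow> 'k) module" where
  "free_module R X =
     \<lparr>carrier = {v. range v \<subseteq> carrier R \<and> finite {x. v x \<noteq> \<zero>\<^bsub>R\<^esub>} \<and> {x. v x \<noteq> \<zero>\<^bsub>R\<^esub>} \<subseteq> X},
      mult = undefined, one = undefined,
      zero = (\<lambda>x. \<zero>\<^bsub>R\<^esub>), add = (\<lambda>v w x. v x \<oplus>\<^bsub>R\<^esub> w x),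
      smult = (\<lambda>a v x. a \<otimes>\<^bsub>R\<^esub> v x)\<rparr>"

definition basis_vec :: "('k, 'r) ring_scheme \<Rightarrow> 'x \<Rightarrow> 'x \<Rightarrow> 'k" where
  "basis_vec R x = (\<lambda>y. if y = x then \<one>\<^bsub>R\<^esub> else \<zero>\<^bsub>R\<^esub>)"

text \<open>The linear map from a free module to \<open>P\<close> sending the basis vector of \<open>x\<close> to \<open>\<phi> x\<close>.\<close>

definition lin_ext ::
    "('k, 'r) ring_scheme \<Rightarrow> ('k, 'p) module \<Rightarrow> ('x \<Rightarrow> 'p) \<Rightarrow> ('x \<Rightarrow> 'k) \<Rightarrow> 'p" where
  "lin_ext R P \<phi> v = (\<Oplus>\<^bsub>P\<^esub>x\<in>{x. v x \<noteq> \<zero>\<^bsub>R\<^esub>}. v x \<odot>\<^bsub>P\<^esub> \<phi> x)"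

definition quot_module :: "('k, 'm) module \<Rightarrow> 'm set \<Rightarrow> ('k, 'm set) module" where
  "quot_module M N =
     \<lparr>carrier = a_rcosets\<^bsub>M\<^esub> N, mult = undefined, one = undefined,
      zero = N, add = set_add M,
      smult = (\<lambda>a X. \<Union>x\<in>X. N +>\<^bsub>M\<^esub> (a \<odot>\<^bsub>M\<^esub> x))\<rparr>"


section \<open>Linear categories\<close>

text \<open>
  \<open>Mor C x y\<close> is the module of morphisms \<open>x \<rightarrow> y\<close>, and \<open>Cmp C x y z f g\<close> is \<open>f \<circ> g\<close> for
  \<open>g : x \<rightarrow> y\<close> and \<open>f : y \<rightarrow> z\<close>.
\<close>

record ('o, 'k, 'm) lin_cat =
  Obj :: "'o set"
  Mor :: "'o \<Rightarrow> 'o \<Rightarrow> ('k, 'm) module"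
  Ident :: "'o \<Rightarrow> 'm"
  Cmp :: "'o \<Rightarrow> 'o \<Rightarrow> 'o \<Rightarrow> 'm \<Rightarrow> 'm \<Rightarrow> 'm"

locale linear_category = cring R
  for R :: "('k, 'r) ring_scheme" (structure) and C :: "('o, 'k, 'm) lin_cat" +
  assumes Mor_module: "\<lbrakk>x \<in> Obj C; y \<in> Obj C\<rbrakk> \<Longrightarrow> module R (Mor C x y)"
    and Ident_closed: "x \<in> Obj C \<Longrightarrow> Ident C x \<in> carrier (Mor C x x)"
    and Cmp_bilinear: "\<lbrakk>x \<in> Obj C; y \<in> Obj C; z \<in> Obj C\<rbrakk>
      \<Longrightarrow> bilinear_map R (Mor C y z) (Mor C x y) (Mor C x z) (Cmp C x y z)"
    and Cmp_assoc: "\<lbrakk>w \<in> Obj C; x \<in> Obj C; y \<in> Obj C; z \<in> Obj C;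
        f \<in> carrier (Mor C y z); g \<in> carrier (Mor C x y); h \<in> carrier (Mor C w x)\<rbrakk>
      \<Longrightarrow> Cmp C w x z (Cmp C x y z f g) h = Cmp C w y z f (Cmp C w x y g h)"
    and Cmp_Ident_left: "\<lbrakk>x \<in> Obj C; y \<in> Obj C; f \<in> carrier (Mor C x y)\<rbrakk>
      \<Longrightarrow> Cmp C x y y (Ident C y) f = f"
    and Cmp_Ident_right: "\<lbrakk>x \<in> Obj C; y \<in> Obj C; f \<in> carrier (Mor C x y)\<rbrakk>
      \<Longrightarrow> Cmp C x x y f (Ident C x) = f"

definition op_cat :: "('o, 'k, 'm) lin_cat \<Rightarrow> ('o, 'k, 'm) lin_cat" where
  "op_cat C = \<lparr>Obj = Obj C, Mor = (\<lambda>x y. Mor C y x), Ident = Ident C,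
     Cmp = (\<lambda>x y z f g. Cmp C z y x g f)\<rparr>"

definition linear_functor ::
    "('k, 'r) ring_scheme \<Rightarrow> ('o, 'k, 'm) lin_cat \<Rightarrow> ('p, 'k, 'n) lin_cat
      \<Rightarrow> ('o \<Rightarrow> 'p) \<Rightarrow> ('o \<Rightarrow> 'o \<Rightarrow> 'm \<Rightarrow> 'n) \<Rightarrow> bool" where
  "linear_functor R C D Fo F \<longleftrightarrow>
     Fo \<in> Obj C \<rightarrow> Obj D \<and>
     (\<forall>x\<in>Obj C. \<forall>y\<in>Obj C. F x y \<in> linear_maps R (Mor C x y) (Mor D (Fo x) (Fo y))) \<and>
     (\<forall>x\<in>Obj C. F x x (Ident C x) = Ident D (Fo x)) \<and>
     (\<forall>x\<in>Obj C. \<forall>y\<in>Obj C. \<forall>z\<in>Obj C.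
        \<forall>f\<in>carrier (Mor C y z). \<forall>g\<in>carrier (Mor C x y).
          F x z (Cmp C x y z f g) = Cmp D (Fo x) (Fo y) (Fo z) (F y z f) (F x y g))"

text \<open>A wide subcategory is given by its sets of morphisms \<open>H x y\<close>.\<close>

definition wide_linear_subcategory ::
    "('k, 'r) ring_scheme \<Rightarrow> ('o, 'k, 'm) lin_cat \<Rightarrow> ('o \<Rightarrow> 'o \<Rightarrow> 'm set) \<Rightarrow> bool" where
  "wide_linear_subcategory R C H \<longleftrightarrow>
     (\<forall>x\<in>Obj C. \<forall>y\<in>Obj C. submodule (H x y) R (Mor C x y)) \<and>
     (\<forall>x\<in>Obj C. Ident C x \<in> H x x) \<and>
     (\<forall>x\<in>Obj C. \<forall>y\<in>Obj C. \<forall>z\<in>Obj C. \<forall>f\<in>H y z. \<forall>g\<in>H x y. Cmp C x y z f g \<in> H x z)"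

definition wide_subcat ::
    "('o, 'k, 'm) lin_cat \<Rightarrow> ('o \<Rightarrow> 'o \<Rightarrow> 'm set) \<Rightarrow> ('o, 'k, 'm) lin_cat" where
  "wide_subcat C H = C\<lparr>Mor := \<lambda>x y. (Mor C x y)\<lparr>carrier := H x y\<rparr>\<rparr>"

locale base_category = linear_category R A
  for R :: "('k, 'r) ring_scheme" (structure) and A :: "('o, 'k, 'a) lin_cat" +
  fixes le :: "('o \<times> 'o) set"
  assumes partial_order: "partial_order_on (Obj A) le"
    and descending_chain_condition:
      "\<not> (\<exists>s :: nat \<Rightarrow> 'o. \<forall>n. s n \<in> Obj A \<and> (s (Suc n), s n) \<in> le \<and> s (Suc n) \<noteq> s n)"
    and off_diagonal: "\<lbrakk>x \<in> Obj A; y \<in> Obj A; x \<noteq> y\<rbrakk>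
      \<Longrightarrow> carrier (Mor A x y) = {\<zero>\<^bsub>Mor A x y\<^esub>}"


section \<open>Bimodules over a base category and their tensor products\<close>

text \<open>
  For \<open>a : y \<rightarrow> z\<close> in the base category and \<open>m \<in> BMod M x y\<close>, \<open>LAct M x y z a m \<in> BMod M x z\<close> is
  \<open>a m\<close>; for \<open>m \<in> BMod M y z\<close> and \<open>a : x \<rightarrow> y\<close>, \<open>RAct M x y z m a \<in> BMod M x z\<close> is \<open>m a\<close>.
\<close>

record ('o, 'k, 'a, 'm) bimod =
  BMod :: "'o \<Rightarrow> 'o \<Rightarrow> ('k, 'm) module"
  LAct :: "'o \<Rightarrow> 'o \<Rightarrow> 'o \<Rightarrow> 'a \<Rightarrow> 'm \<Rightarrow> 'm"
  RAct :: "'o \<Rightarrow> 'o \<Rightarrow> 'o \<Rightarrow> 'm \<Rightarrow> 'a \<Rightarrow> 'm"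

definition regular_bimod :: "('o, 'k, 'a) lin_cat \<Rightarrow> ('o, 'k, 'a, 'a) bimod" where
  "regular_bimod A = \<lparr>BMod = Mor A, LAct = Cmp A, RAct = Cmp A\<rparr>"

text \<open>A wide subcategory \<open>H\<close> of \<open>C\<close> as a bimodule over \<open>A\<close>, via \<open>i : A \<rightarrow> C\<close>.\<close>

definition subcat_bimod ::
    "('o, 'k, 'm) lin_cat \<Rightarrow> ('o \<Rightarrow> 'o \<Rightarrow> 'a \<Rightarrow> 'm) \<Rightarrow> ('o \<Rightarrow> 'o \<Rightarrow> 'm set)
      \<Rightarrow> ('o, 'k, 'a, 'm) bimod" where
  "subcat_bimod C i H =
     \<lparr>BMod = Mor (wide_subcat C H),
      LAct = (\<lambda>x y z a m. Cmp C x y z (i y z a) m),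
      RAct = (\<lambda>x y z m a. Cmp C x y z m (i x y a))\<rparr>"

context
  fixes R :: "('k, 'r) ring_scheme" (structure) and A :: "('o, 'k, 'a) lin_cat"
begin

definition bimod_map ::
    "('o, 'k, 'a, 'm) bimod \<Rightarrow> ('o, 'k, 'a, 'n) bimod \<Rightarrow> ('o \<Rightarrow> 'o \<Rightarrow> 'm \<Rightarrow> 'n) \<Rightarrow> bool" where
  "bimod_map M N \<phi> \<longleftrightarrow>
     (\<forall>x\<in>Obj A. \<forall>y\<in>Obj A. \<phi> x y \<in> linear_maps R (BMod M x y) (BMod N x y)) \<and>
     (\<forall>x\<in>Obj A. \<forall>y\<in>Obj A. \<forall>z\<in>Obj A. \<forall>a\<in>carrier (Mor A y z). \<forall>m\<in>carrier (BMod M x y).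
        \<phi> x z (LAct M x y z a m) = LAct N x y z a (\<phi> x y m)) \<and>
     (\<forall>x\<in>Obj A. \<forall>y\<in>Obj A. \<forall>z\<in>Obj A. \<forall>m\<in>carrier (BMod M y z). \<forall>a\<in>carrier (Mor A x y).
        \<phi> x z (RAct M x y z m a) = RAct N x y z (\<phi> y z m) a)"

text \<open>
  \<open>(M \<otimes> N)(x, z)\<close> is the direct sum over all objects \<open>y\<close> of the tensor products of \<open>M(y, z)\<close> and
  \<open>N(x, y)\<close> over the ring \<open>A(y, y)\<close>. Direct sum and tensor products are formed in one step: a triple
  \<open>(y, m, n)\<close> stands for \<open>m \<otimes> n\<close> in the summand of \<open>y\<close>, and the free module on these triples
  is divided by the bilinearity relations and by \<open>m a \<otimes> n = m \<otimes> a n\<close>.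
\<close>

definition tensor_free ::
    "('o, 'k, 'a, 'm) bimod \<Rightarrow> ('o, 'k, 'a, 'n) bimod \<Rightarrow> 'o \<Rightarrow> 'o
      \<Rightarrow> ('k, 'o \<times> 'm \<times> 'n \<Rightarrow> 'k) module" where
  "tensor_free M N x z = free_module R
     {(y, m, n). y \<in> Obj A \<and> m \<in> carrier (BMod M y z) \<and> n \<in> carrier (BMod N x y)}"

definition tensor_rels ::
    "('o, 'k, 'a, 'm) bimod \<Rightarrow> ('o, 'k, 'a, 'n) bimod \<Rightarrow> 'o \<Rightarrow> 'o
      \<Rightarrow> ('o \<times> 'm \<times> 'n \<Rightarrow> 'k) set" where
  "tensor_rels M N x z = (let F = tensor_free M N x z; e = (\<lambda>y m n. basis_vec R (y, m, n)) in
     {e y (m \<oplus>\<^bsub>BMod M y z\<^esub> m') n \<ominus>\<^bsub>F\<^esub> (e y m n \<oplus>\<^bsub>F\<^esub> e y m' n) | y m m' n.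
        y \<in> Obj A \<and> m \<in> carrier (BMod M y z) \<and> m' \<in> carrier (BMod M y z) \<and> n \<in> carrier (BMod N x y)}
   \<union> {e y m (n \<oplus>\<^bsub>BMod N x y\<^esub> n') \<ominus>\<^bsub>F\<^esub> (e y m n \<oplus>\<^bsub>F\<^esub> e y m n') | y m n n'.
        y \<in> Obj A \<and> m \<in> carrier (BMod M y z) \<and> n \<in> carrier (BMod N x y) \<and> n' \<in> carrier (BMod N x y)}
   \<union> {e y (c \<odot>\<^bsub>BMod M y z\<^esub> m) n \<ominus>\<^bsub>F\<^esub> c \<odot>\<^bsub>F\<^esub> e y m n | y c m n.
        y \<in> Obj A \<and> c \<in> carrier R \<and> m \<in> carrier (BMod M y z) \<and> n \<in> carrier (BMod N x y)}
   \<union> {e y m (c \<odot>\<^bsub>BMod N x y\<^esub> n) \<ominus>\<^bsub>F\<^esub> c \<odot>\<^bsub>F\<^esub> e y m n | y c m n.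
        y \<in> Obj A \<and> c \<in> carrier R \<and> m \<in> carrier (BMod M y z) \<and> n \<in> carrier (BMod N x y)}
   \<union> {e y (RAct M y y z m a) n \<ominus>\<^bsub>F\<^esub> e y m (LAct N x y y a n) | y a m n.
        y \<in> Obj A \<and> a \<in> carrier (Mor A y y) \<and>
        m \<in> carrier (BMod M y z) \<and> n \<in> carrier (BMod N x y)})"

definition tensor_null ::
    "('o, 'k, 'a, 'm) bimod \<Rightarrow> ('o, 'k, 'a, 'n) bimod \<Rightarrow> 'o \<Rightarrow> 'o
      \<Rightarrow> ('o \<times> 'm \<times> 'n \<Rightarrow> 'k) set" where
  "tensor_null M N x z = (\<lambda>H. submodule H R (tensor_free M N x z)) hull tensor_rels M N x z"

definition tensor_mod ::
    "('o, 'k, 'a, 'm) bimod \<Rightarrow> ('o, 'k, 'a, 'n) bimod \<Rightarrow> 'o \<Rightarrow> 'o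
      \<Rightarrow> ('k, ('o \<times> 'm \<times> 'n \<Rightarrow> 'k) set) module" where
  "tensor_mod M N x z = quot_module (tensor_free M N x z) (tensor_null M N x z)"

text \<open>The element \<open>m \<otimes> n\<close> of \<open>(M \<otimes> N)(x, z)\<close> for \<open>m \<in> M(y, z)\<close> and \<open>n \<in> N(x, y)\<close>.\<close>

definition pure_tensor ::
    "('o, 'k, 'a, 'm) bimod \<Rightarrow> ('o, 'k, 'a, 'n) bimod \<Rightarrow> 'o \<Rightarrow> 'o \<Rightarrow> 'o \<Rightarrow> 'm \<Rightarrow> 'n
      \<Rightarrow> ('o \<times> 'm \<times> 'n \<Rightarrow> 'k) set" where
  "pure_tensor M N x z y m n =
     tensor_null M N x z +>\<^bsub>tensor_free M N x z\<^esub> basis_vec R (y, m, n)"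

text \<open>
  The linear map from a tensor product to \<open>P\<close> with \<open>m \<otimes> n \<mapsto> \<phi> y m n\<close>. As usual this is
  meaningful only for balanced bilinear \<open>\<phi>\<close>, for which the choice of representative is immaterial.
\<close>

definition tensor_lift ::
    "('k, 'p) module \<Rightarrow> ('o \<Rightarrow> 'm \<Rightarrow> 'n \<Rightarrow> 'p) \<Rightarrow> ('o \<times> 'm \<times> 'n \<Rightarrow> 'k) set \<Rightarrow> 'p" where
  "tensor_lift P \<phi> t = lin_ext R P (\<lambda>(y, m, n). \<phi> y m n) (SOME w. w \<in> t)"

definition tensor_bimod ::
    "('o, 'k, 'a, 'm) bimod \<Rightarrow> ('o, 'k, 'a, 'n) bimod
      \<Rightarrow> ('o, 'k, 'a, ('o \<times> 'm \<times> 'n \<Rightarrow> 'k) set) bimod" where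
  "tensor_bimod M N =
     \<lparr>BMod = tensor_mod M N,
      LAct = (\<lambda>x y z a t. tensor_lift (tensor_mod M N x z)
        (\<lambda>w m n. pure_tensor M N x z w (LAct M w y z a m) n) t),
      RAct = (\<lambda>x y z t a. tensor_lift (tensor_mod M N x z)
        (\<lambda>w m n. pure_tensor M N x z w m (RAct N x y w n a)) t)\<rparr>"

definition tensor_map ::
    "('o, 'k, 'a, 'm) bimod \<Rightarrow> ('o, 'k, 'a, 'n) bimod
      \<Rightarrow> ('o \<Rightarrow> 'o \<Rightarrow> 'l \<Rightarrow> 'm) \<Rightarrow> ('o \<Rightarrow> 'o \<Rightarrow> 'j \<Rightarrow> 'n)
      \<Rightarrow> 'o \<Rightarrow> 'o \<Rightarrow> ('o \<times> 'l \<times> 'j \<Rightarrow> 'k) set \<Rightarrow> ('o \<times> 'm \<times> 'n \<Rightarrow> 'k) set" where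
  \<comment> \<open>\<open>\<phi> \<otimes> \<psi>\<close>; \<open>M\<close> and \<open>N\<close> are the targets of \<open>\<phi>\<close> and \<open>\<psi>\<close>\<close>
  "tensor_map M N \<phi> \<psi> x z =
     tensor_lift (tensor_mod M N x z) (\<lambda>y m n. pure_tensor M N x z y (\<phi> y z m) (\<psi> x y n))"

definition left_unitor ::
    "('o, 'k, 'a, 'm) bimod \<Rightarrow> 'o \<Rightarrow> 'o \<Rightarrow> ('o \<times> 'a \<times> 'm \<Rightarrow> 'k) set \<Rightarrow> 'm" where
  \<comment> \<open>\<open>A \<otimes> M \<rightarrow> M\<close>\<close>
  "left_unitor M x z = tensor_lift (BMod M x z) (\<lambda>y a m. LAct M x y z a m)"

definition right_unitor ::
    "('o, 'k, 'a, 'm) bimod \<Rightarrow> 'o \<Rightarrow> 'o \<Rightarrow> ('o \<times> 'm \<times> 'a \<Rightarrow> 'k) set \<Rightarrow> 'm" where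
  \<comment> \<open>\<open>M \<otimes> A \<rightarrow> M\<close>\<close>
  "right_unitor M x z = tensor_lift (BMod M x z) (\<lambda>y m a. RAct M x y z m a)"

definition assoc_left ::
    "('o, 'k, 'a, 'm) bimod \<Rightarrow> ('o, 'k, 'a, 'n) bimod \<Rightarrow> ('o, 'k, 'a, 'p) bimod \<Rightarrow> 'o \<Rightarrow> 'o
      \<Rightarrow> ('o \<times> 'm \<times> ('o \<times> 'n \<times> 'p \<Rightarrow> 'k) set \<Rightarrow> 'k) set
      \<Rightarrow> ('o \<times> ('o \<times> 'm \<times> 'n \<Rightarrow> 'k) set \<times> 'p \<Rightarrow> 'k) set" where
  \<comment> \<open>\<open>M \<otimes> (N \<otimes> P) \<rightarrow> (M \<otimes> N) \<otimes> P\<close>\<close>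
  "assoc_left M N P x z = (let T = tensor_mod (tensor_bimod M N) P x z in
     tensor_lift T (\<lambda>y m s. tensor_lift T
       (\<lambda>w n p. pure_tensor (tensor_bimod M N) P x z w (pure_tensor M N w z y m n) p) s))"

definition assoc_right ::
    "('o, 'k, 'a, 'm) bimod \<Rightarrow> ('o, 'k, 'a, 'n) bimod \<Rightarrow> ('o, 'k, 'a, 'p) bimod \<Rightarrow> 'o \<Rightarrow> 'o
      \<Rightarrow> ('o \<times> ('o \<times> 'm \<times> 'n \<Rightarrow> 'k) set \<times> 'p \<Rightarrow> 'k) set
      \<Rightarrow> ('o \<times> 'm \<times> ('o \<times> 'n \<times> 'p \<Rightarrow> 'k) set \<Rightarrow> 'k) set" where
  \<comment> \<open>\<open>(M \<otimes> N) \<otimes> P \<rightarrow> M \<otimes> (N \<otimes> P)\<close>\<close>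
  "assoc_right M N P x z = (let T = tensor_mod M (tensor_bimod N P) x z in
     tensor_lift T (\<lambda>y s p. tensor_lift T
       (\<lambda>w m n. pure_tensor M (tensor_bimod N P) x z w m (pure_tensor N P x w y n p)) s))"

end


section \<open>Stratified and quasi-cellular categories\<close>

definition composition_map ::
    "('k, 'r) ring_scheme \<Rightarrow> ('o, 'k, 'm) lin_cat
      \<Rightarrow> 'o \<Rightarrow> 'o \<Rightarrow> ('o \<times> 'm \<times> 'm \<Rightarrow> 'k) set \<Rightarrow> 'm" where
  \<comment> \<open>\<open>f \<otimes> g \<mapsto> f \<circ> g\<close>\<close>
  "composition_map R C x z = tensor_lift R (Mor C x z) (\<lambda>y f g. Cmp C x y z f g)"

locale stratified_linear_category = base_category R A le + cat: linear_category R C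
  for R :: "('k, 'r) ring_scheme" (structure) and A :: "('o, 'k, 'a) lin_cat"
    and le :: "('o \<times> 'o) set" and C :: "('o, 'k, 'm) lin_cat" +
  fixes i :: "'o \<Rightarrow> 'o \<Rightarrow> 'a \<Rightarrow> 'm" and Cp Cm :: "'o \<Rightarrow> 'o \<Rightarrow> 'm set"
  assumes same_objects: "Obj C = Obj A"
    and structure_functor: "linear_functor R A C (\<lambda>x. x) i"
    and Cp_subcategory: "wide_linear_subcategory R C Cp"
    and Cm_subcategory: "wide_linear_subcategory R C Cm"
    and Cp_upward: "\<lbrakk>x \<in> Obj C; y \<in> Obj C; (x, y) \<notin> le\<rbrakk> \<Longrightarrow> Cp x y = {\<zero>\<^bsub>Mor C x y\<^esub>}"
    and Cm_downward: "\<lbrakk>x \<in> Obj C; y \<in> Obj C; (y, x) \<notin> le\<rbrakk> \<Longrightarrow> Cm x y = {\<zero>\<^bsub>Mor C x y\<^esub>}"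
    and Cp_Cm_diagonal: "x \<in> Obj C \<Longrightarrow> Cp x x = Cm x x"
    and structure_iso: "x \<in> Obj C \<Longrightarrow> bij_betw (i x x) (carrier (Mor A x x)) (Cp x x)"
    and composition_linear: "\<lbrakk>x \<in> Obj C; z \<in> Obj C\<rbrakk> \<Longrightarrow>
      composition_map R C x z \<in> linear_maps R
        (tensor_mod R A (subcat_bimod C i Cp) (subcat_bimod C i Cm) x z) (Mor C x z)"
    and composition_iso: "\<lbrakk>x \<in> Obj C; z \<in> Obj C\<rbrakk> \<Longrightarrow>
      bij_betw (composition_map R C x z)
        (carrier (tensor_mod R A (subcat_bimod C i Cp) (subcat_bimod C i Cm) x z))
        (carrier (Mor C x z))"

text \<open>Both augmentations \<open>\<epsilon>\<^sup>+\<close> and \<open>\<epsilon>\<^sup>-\<close>: the inverse of \<open>i\<close> on the diagonal, and \<open>0\<close> off it.\<close>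

definition augmentation ::
    "('o, 'k, 'a) lin_cat \<Rightarrow> ('o \<Rightarrow> 'o \<Rightarrow> 'a \<Rightarrow> 'm) \<Rightarrow> 'o \<Rightarrow> 'o \<Rightarrow> 'm \<Rightarrow> 'a" where
  "augmentation A i x y f =
     (if x = y then inv_into (carrier (Mor A x x)) (i x x) f else \<zero>\<^bsub>Mor A x y\<^esub>)"

locale quasi_cellular_category = stratified_linear_category R A le C i Cp Cm
  for R :: "('k, 'r) ring_scheme" (structure) and A :: "('o, 'k, 'a) lin_cat"
    and le :: "('o \<times> 'o) set" and C :: "('o, 'k, 'm) lin_cat"
    and i :: "'o \<Rightarrow> 'o \<Rightarrow> 'a \<Rightarrow> 'm" and Cp Cm :: "'o \<Rightarrow> 'o \<Rightarrow> 'm set" +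
  fixes b' :: "'o \<Rightarrow> 'o \<Rightarrow> ('o \<times> 'm \<times> 'm \<Rightarrow> 'k) set \<Rightarrow> 'a"
    and d' :: "'o \<Rightarrow> 'o \<Rightarrow> 'a \<Rightarrow> ('o \<times> 'm \<times> 'm \<Rightarrow> 'k) set"
  assumes pairing:
      "bimod_map R A (tensor_bimod R A (subcat_bimod C i Cm) (subcat_bimod C i Cp))
         (regular_bimod A) b'"
    and copairing:
      "bimod_map R A (regular_bimod A)
         (tensor_bimod R A (subcat_bimod C i Cp) (subcat_bimod C i Cm)) d'"
    and zigzag_minus:
      "\<lbrakk>x \<in> Obj C; y \<in> Obj C; g \<in> Cm x y\<rbrakk> \<Longrightarrow>
       (let P = subcat_bimod C i Cp; M = subcat_bimod C i Cm; I = regular_bimod A in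
         left_unitor R M x y
           (tensor_map R A I M b' (\<lambda>_ _ n. n) x y
             (assoc_left R A M P M x y
               (tensor_map R A M (tensor_bimod R A P M) (\<lambda>_ _ m. m) d' x y
                 (pure_tensor R A M I x y x g (Ident A x)))))) = g"
    and zigzag_plus:
      "\<lbrakk>x \<in> Obj C; y \<in> Obj C; f \<in> Cp x y\<rbrakk> \<Longrightarrow>
       (let P = subcat_bimod C i Cp; M = subcat_bimod C i Cm; I = regular_bimod A in
         right_unitor R P x y
           (tensor_map R A P I (\<lambda>_ _ m. m) b' x y
             (assoc_right R A P M P x y
               (tensor_map R A (tensor_bimod R A P M) P d' (\<lambda>_ _ n. n) x y
                 (pure_tensor R A I P x y y (Ident A y) f))))) = f"
    and pairing_Ident_left:
      "\<lbrakk>x \<in> Obj C; z \<in> Obj C; f \<in> Cp z x\<rbrakk> \<Longrightarrow>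
       b' z x (pure_tensor R A (subcat_bimod C i Cm) (subcat_bimod C i Cp) z x x (Ident C x) f)
         = augmentation A i z x f"
    and pairing_Ident_right:
      "\<lbrakk>x \<in> Obj C; z \<in> Obj C; g \<in> Cm x z\<rbrakk> \<Longrightarrow>
       b' x z (pure_tensor R A (subcat_bimod C i Cm) (subcat_bimod C i Cp) x z x g (Ident C x))
         = augmentation A i x z g"

text \<open>
  \<open>\<iota>o\<close> and \<open>\<iota>\<close> are the object and morphism parts of \<open>\<iota> : C\<^sup>o\<^sup>p \<rightarrow> C\<close>, so that \<open>\<iota> x y\<close> is defined on
  \<open>Mor (op_cat C) x y = Mor C y x\<close>. Values of \<open>b'\<close> are regarded as morphisms of \<open>C\<close> via \<open>i\<close>.
\<close>

locale involutive_quasi_cellular_category = quasi_cellular_category R A le C i Cp Cm b' d'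
  for R :: "('k, 'r) ring_scheme" (structure) and A :: "('o, 'k, 'a) lin_cat"
    and le :: "('o \<times> 'o) set" and C :: "('o, 'k, 'm) lin_cat"
    and i :: "'o \<Rightarrow> 'o \<Rightarrow> 'a \<Rightarrow> 'm" and Cp Cm :: "'o \<Rightarrow> 'o \<Rightarrow> 'm set"
    and b' :: "'o \<Rightarrow> 'o \<Rightarrow> ('o \<times> 'm \<times> 'm \<Rightarrow> 'k) set \<Rightarrow> 'a"
    and d' :: "'o \<Rightarrow> 'o \<Rightarrow> 'a \<Rightarrow> ('o \<times> 'm \<times> 'm \<Rightarrow> 'k) set" +
  fixes \<iota>o :: "'o \<Rightarrow> 'o" and \<iota> :: "'o \<Rightarrow> 'o \<Rightarrow> 'm \<Rightarrow> 'm"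
  assumes anti_functor: "linear_functor R (op_cat C) C \<iota>o \<iota>"
    and involution_obj: "x \<in> Obj C \<Longrightarrow> \<iota>o (\<iota>o x) = x"
    and involution_mor: "\<lbrakk>x \<in> Obj C; y \<in> Obj C; f \<in> carrier (Mor C x y)\<rbrakk>
      \<Longrightarrow> \<iota> (\<iota>o x) (\<iota>o y) (\<iota> y x f) = f"
    and order_preserving: "\<lbrakk>x \<in> Obj C; y \<in> Obj C; (x, y) \<in> le\<rbrakk> \<Longrightarrow> (\<iota>o x, \<iota>o y) \<in> le"
    and swaps_Cp: "\<lbrakk>x \<in> Obj C; y \<in> Obj C\<rbrakk> \<Longrightarrow> \<iota> y x ` Cp x y = Cm (\<iota>o y) (\<iota>o x)"
    and swaps_Cm: "\<lbrakk>x \<in> Obj C; y \<in> Obj C\<rbrakk> \<Longrightarrow> \<iota> y x ` Cm x y = Cp (\<iota>o y) (\<iota>o x)"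
    and pairing_invariant:
      "\<lbrakk>x \<in> Obj C; y \<in> Obj C; f \<in> Cp x y; g \<in> Cm y x\<rbrakk> \<Longrightarrow>
       (let P = subcat_bimod C i Cp; M = subcat_bimod C i Cm in
         \<iota> x x (i x x (b' x x (pure_tensor R A M P x x y g f)))
         = i (\<iota>o x) (\<iota>o x) (b' (\<iota>o x) (\<iota>o x)
             (pure_tensor R A M P (\<iota>o x) (\<iota>o x) (\<iota>o y) (\<iota> y x f) (\<iota> x y g))))"


section \<open>Brauer diagrams\<close>

text \<open>\<open>Top i\<close> and \<open>Bot i\<close> are the points \<open>i\<^sup>+\<close> and \<open>i\<^sup>-\<close>; an unordered pair is a two-element set.\<close>

datatype point = Top nat | Bot nat

type_synonym diagram = "point set set"

definition brauer_diagrams :: "nat \<Rightarrow> nat \<Rightarrow> diagram set" where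
  "brauer_diagrams p q =
     {D. partition_on (Top ` {1..p} \<union> Bot ` {1..q}) D \<and> (\<forall>e\<in>D. card e = 2)}"

definition upward_diagrams :: "nat \<Rightarrow> nat \<Rightarrow> diagram set" where
  "upward_diagrams p q = {D \<in> brauer_diagrams p q. \<not> (\<exists>i j. {Top i, Top j} \<in> D)}"

definition downward_diagrams :: "nat \<Rightarrow> nat \<Rightarrow> diagram set" where
  "downward_diagrams p q = {D \<in> brauer_diagrams p q. \<not> (\<exists>i j. {Bot i, Bot j} \<in> D)}"

definition level_diagrams :: "nat \<Rightarrow> nat \<Rightarrow> diagram set" where
  "level_diagrams p q = upward_diagrams p q \<inter> downward_diagrams p q"

definition monotone_diagram :: "diagram \<Rightarrow> bool" where
  "monotone_diagram D \<longleftrightarrow>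
     (\<forall>i j k l. {Top i, Bot j} \<in> D \<and> {Top k, Bot l} \<in> D \<and> {Top i, Bot j} \<noteq> {Top k, Bot l}
        \<longrightarrow> (int i - int k) * (int j - int l) > 0)"

primrec flip_point :: "point \<Rightarrow> point" where
  "flip_point (Top i) = Bot i"
| "flip_point (Bot i) = Top i"

definition flip :: "diagram \<Rightarrow> diagram" where
  "flip D = (\<lambda>e. flip_point ` e) ` D"

definition identity_diagram :: "nat \<Rightarrow> diagram" where
  "identity_diagram p = (\<lambda>i. {Top i, Bot i}) ` {1..p}"

text \<open>
  Stacking \<open>g\<close> above \<open>f\<close>: bottom points of \<open>g\<close> and top points of \<open>f\<close> are identified to middle points.
  Every middle point lies on one edge of \<open>f\<close> and one of \<open>g\<close> (which may be the same pair of middle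
  points), so the connected components are paths with two outer end points and closed loops; the
  loops are the components that consist of middle points only.
\<close>

datatype stack_point = Upper nat | Middle nat | Lower nat

primrec upper_part :: "point \<Rightarrow> stack_point" where
  "upper_part (Top i) = Upper i"
| "upper_part (Bot i) = Middle i"

primrec lower_part :: "point \<Rightarrow> stack_point" where
  "lower_part (Top i) = Middle i"
| "lower_part (Bot i) = Lower i"

definition stack_edges :: "diagram \<Rightarrow> diagram \<Rightarrow> stack_point set set" where
  "stack_edges f g = (\<lambda>e. lower_part ` e) ` f \<union> (\<lambda>e. upper_part ` e) ` g"

definition stack_components :: "diagram \<Rightarrow> diagram \<Rightarrow> stack_point set set" where
  "stack_components f g =
     \<Union> (stack_edges f g) // {(u, v). \<exists>e\<in>stack_edges f g. u \<in> e \<and> v \<in> e}\<^sup>*"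

definition loop_count :: "diagram \<Rightarrow> diagram \<Rightarrow> nat" where
  "loop_count f g = card {c \<in> stack_components f g. c \<subseteq> range Middle}"

definition diagram_comp :: "diagram \<Rightarrow> diagram \<Rightarrow> diagram" where
  \<comment> \<open>the composite of \<open>f\<close> and \<open>g\<close> after deleting loops\<close>
  "diagram_comp f g =
     (\<lambda>c. {Top i | i. Upper i \<in> c} \<union> {Bot i | i. Lower i \<in> c}) `
       {c \<in> stack_components f g. \<not> c \<subseteq> range Middle}"


section \<open>The Brauer category\<close>

definition brauer_le :: "(nat \<times> nat) set" where
  "brauer_le = {(p, q). p \<le> q \<and> even (q - p)}"

context
  fixes R :: "('k, 'r) ring_scheme" (structure) and \<delta> :: 'k
begin

definition brauer_cat :: "(nat, 'k, diagram \<Rightarrow> 'k) lin_cat" where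
  "brauer_cat =
     \<lparr>Obj = UNIV,
      Mor = (\<lambda>p q. free_module R (brauer_diagrams p q)),
      Ident = (\<lambda>p. basis_vec R (identity_diagram p)),
      Cmp = (\<lambda>p q r f g. let P = free_module R (brauer_diagrams p r) in
        lin_ext R P (\<lambda>D. lin_ext R P
          (\<lambda>E. (\<delta> [^] loop_count D E) \<odot>\<^bsub>P\<^esub> basis_vec R (diagram_comp D E)) g) f)\<rparr>"

definition spanned :: "(nat \<Rightarrow> nat \<Rightarrow> diagram set) \<Rightarrow> nat \<Rightarrow> nat \<Rightarrow> (diagram \<Rightarrow> 'k) set" where
  "spanned X p q = carrier (free_module R (X p q))"

definition level_cat :: "(nat, 'k, diagram \<Rightarrow> 'k) lin_cat" where
  "level_cat = wide_subcat brauer_cat (spanned level_diagrams)"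

definition level_inclusion :: "nat \<Rightarrow> nat \<Rightarrow> (diagram \<Rightarrow> 'k) \<Rightarrow> (diagram \<Rightarrow> 'k)" where
  "level_inclusion p q v = v"

definition brauer_plus :: "(nat, 'k, diagram \<Rightarrow> 'k, diagram \<Rightarrow> 'k) bimod" where
  "brauer_plus = subcat_bimod brauer_cat level_inclusion (spanned upward_diagrams)"

definition brauer_minus :: "(nat, 'k, diagram \<Rightarrow> 'k, diagram \<Rightarrow> 'k) bimod" where
  "brauer_minus = subcat_bimod brauer_cat level_inclusion (spanned downward_diagrams)"

text \<open>
  The twist on the diagrams \<open>f \<in> downward_diagrams q r\<close> and \<open>g \<in> upward_diagrams p q\<close>. For its value in
  \<open>B\<^sup>+ \<otimes> B\<^sup>-\<close>, the isomorphism of \<open>B\<^sup>+ \<otimes> B\<^sup>-\<close> with \<open>B\<close> given by composition is inverted.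
\<close>

definition twist_conflict :: "nat \<Rightarrow> diagram \<Rightarrow> diagram \<Rightarrow> bool" where
  "twist_conflict q f g \<longleftrightarrow> (\<exists>i\<in>{1..q}. \<exists>j\<in>{1..q}. \<exists>k\<in>{1..q}. i \<noteq> j \<and> i \<noteq> k \<and> j \<noteq> k \<and>
     {Top i, Top j} \<in> f \<and> {Bot j, Bot k} \<in> g)"

definition twist_diagrams :: "nat \<Rightarrow> diagram \<Rightarrow> diagram \<Rightarrow> diagram \<Rightarrow> 'k" where
  "twist_diagrams q f g =
     (if twist_conflict q f g then (\<lambda>_. \<zero>) else basis_vec R (diagram_comp f g))"

definition twist_to_brauer ::
    "nat \<Rightarrow> nat \<Rightarrow> (nat \<times> (diagram \<Rightarrow> 'k) \<times> (diagram \<Rightarrow> 'k) \<Rightarrow> 'k) set \<Rightarrow> diagram \<Rightarrow> 'k" where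
  "twist_to_brauer p r = (let P = Mor brauer_cat p r in
     tensor_lift R P (\<lambda>q f g. lin_ext R P (\<lambda>D. lin_ext R P (\<lambda>E. twist_diagrams q D E) g) f))"

definition twist ::
    "nat \<Rightarrow> nat \<Rightarrow> (nat \<times> (diagram \<Rightarrow> 'k) \<times> (diagram \<Rightarrow> 'k) \<Rightarrow> 'k) set
      \<Rightarrow> (nat \<times> (diagram \<Rightarrow> 'k) \<times> (diagram \<Rightarrow> 'k) \<Rightarrow> 'k) set" where
  "twist p r t =
     inv_into (carrier (tensor_mod R level_cat brauer_plus brauer_minus p r))
       (composition_map R brauer_cat p r) (twist_to_brauer p r t)"

definition brauer_augmentation :: "nat \<Rightarrow> nat \<Rightarrow> (diagram \<Rightarrow> 'k) \<Rightarrow> (diagram \<Rightarrow> 'k)" where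
  "brauer_augmentation p q v = (if p = q then v else (\<lambda>_. \<zero>))"

definition brauer_pairing ::
    "nat \<Rightarrow> nat \<Rightarrow> (nat \<times> (diagram \<Rightarrow> 'k) \<times> (diagram \<Rightarrow> 'k) \<Rightarrow> 'k) set \<Rightarrow> diagram \<Rightarrow> 'k" where
  \<comment> \<open>\<open>(\<epsilon>\<^sup>+ \<otimes> \<epsilon>\<^sup>-) \<tau>'\<close>, followed by the identification of \<open>S \<otimes> S\<close> with \<open>S\<close>\<close>
  "brauer_pairing p r t =
     left_unitor R (regular_bimod level_cat) p r
       (tensor_map R level_cat (regular_bimod level_cat) (regular_bimod level_cat)
          brauer_augmentation brauer_augmentation p r (twist p r t))"

definition copairing_element ::
    "nat \<Rightarrow> (nat \<times> (diagram \<Rightarrow> 'k) \<times> (diagram \<Rightarrow> 'k) \<Rightarrow> 'k) set" where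
  "copairing_element p = (let T = tensor_mod R level_cat brauer_plus brauer_minus p p in
     \<Oplus>\<^bsub>T\<^esub>r\<in>{r. (r, p) \<in> brauer_le}. \<Oplus>\<^bsub>T\<^esub>f\<in>{f \<in> upward_diagrams r p. monotone_diagram f}.
       pure_tensor R level_cat brauer_plus brauer_minus p p r (basis_vec R f) (basis_vec R (flip f)))"

text \<open>The left-linear extension of \<open>1\<^sub>p \<mapsto> copairing_element p\<close>.\<close>

definition brauer_copairing ::
    "nat \<Rightarrow> nat \<Rightarrow> (diagram \<Rightarrow> 'k) \<Rightarrow> (nat \<times> (diagram \<Rightarrow> 'k) \<times> (diagram \<Rightarrow> 'k) \<Rightarrow> 'k) set" where
  "brauer_copairing p q a =
     LAct (tensor_bimod R level_cat brauer_plus brauer_minus) p p q a (copairing_element p)"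

definition brauer_bar :: "nat \<Rightarrow> nat \<Rightarrow> (diagram \<Rightarrow> 'k) \<Rightarrow> (diagram \<Rightarrow> 'k)" where
  \<comment> \<open>on \<open>Mor (op_cat brauer_cat) p q = Mor brauer_cat q p\<close>\<close>
  "brauer_bar p q v = lin_ext R (Mor brauer_cat p q) (\<lambda>D. basis_vec R (flip D)) v"

end

end

theory Submission
  imports Defs
begin

text \<open>
  Diagrams are handled through their top-top, top-bottom and bottom-bottom pairs. An upward diagram
  \<open>E\<close> can be cancelled on the left, and if a diagram \<open>D\<close> has the same bottom pairs as \<open>E\<close>, then
  \<open>D = E \<circ> (flip E \<circ> D)\<close> with \<open>flip E \<circ> D\<close> downward. For every \<open>D\<close> there is exactly one monotone
  such \<open>E\<close>, so \<open>D \<mapsto> E \<otimes> (flip E \<circ> D)\<close> inverts the composition \<open>B\<^sup>+ \<otimes> B\<^sup>- \<rightarrow> B\<close>.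

  For \<open>f\<close> downward and \<open>g\<close> upward, \<open>f \<circ> g\<close> is level without conflict precisely if the top pairs of
  \<open>f\<close> are the bottom pairs of \<open>g\<close>, and in that case \<open>(f \<circ> g) \<circ> flip g = f\<close>. Hence in the zigzag
  identities only the one monotone diagram with the matching pairs survives. The copairing commutes
  with permutations because left multiplication by a permutation permutes the sets of bottom pairs.

  Associativity of the composition of diagrams and the additivity of the loop count hold for
  arbitrary families of edges: both bracketings compute the components of the triple stack.
\<close>

section \<open>Linear maps and free modules\<close>

text \<open>Composition alone would not give the pairing, which is why the twist discards conflicts.
  In the snake, \<open>g\<close> joins bottom points 1 and 2 and \<open>f\<close> joins top points 2
  and 3; \<open>f \<diamondop> g\<close> is level although the two pairs differ. A path of this kind
  passes between two distinct pairs sharing one middle point, which is exactly a conflict. In a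
  level composite without conflicts, equal pairs close up to loops. The twist deletes these without
  a factor, so the pairing is perfect for every \<open>\<delta>\<close>.

  A loop needs a top pair of the lower diagram and a bottom pair of the upper one. Products with an
  upward lower factor or a downward upper factor therefore carry no power of
  \<open>\<delta>\<close>, and the factorisation of diagrams is purely combinatorial.

  A tensor is a coset, and a map on tensors evaluates a chosen representative. Nothing can be
  computed before the underlying family is known to be balanced, so each construction is accompanied
  by three facts: balance, linearity, and the value on pure tensors. All identities then become
  multilinear and are tested on diagrams.\<close>

lemma linear_mapsI:
  assumes "\<And>x. x \<in> carrier M \<Longrightarrow> h x \<in> carrier N"
    and "\<And>x y. \<lbrakk>x \<in> carrier M; y \<in> carrier M\<rbrakk> \<Longrightarrow> h (x \<oplus>\<^bsub>M\<^esub> y) = h x \<oplus>\<^bsub>N\<^esub> h y"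
    and "\<And>a x. \<lbrakk>a \<in> carrier R; x \<in> carrier M\<rbrakk> \<Longrightarrow> h (a \<odot>\<^bsub>M\<^esub> x) = a \<odot>\<^bsub>N\<^esub> h x"
  shows "h \<in> linear_maps R M N"
  using assms unfolding linear_maps_def by blast

lemma linear_map_closed: "\<lbrakk>h \<in> linear_maps R M N; x \<in> carrier M\<rbrakk> \<Longrightarrow> h x \<in> carrier N"
  unfolding linear_maps_def by blast

lemma linear_map_add:
  "\<lbrakk>h \<in> linear_maps R M N; x \<in> carrier M; y \<in> carrier M\<rbrakk> \<Longrightarrow> h (x \<oplus>\<^bsub>M\<^esub> y) = h x \<oplus>\<^bsub>N\<^esub> h y"
  unfolding linear_maps_def by blast

lemma linear_map_smult:
  "\<lbrakk>h \<in> linear_maps R M N; a \<in> carrier R; x \<in> carrier M\<rbrakk> \<Longrightarrow> h (a \<odot>\<^bsub>M\<^esub> x) = a \<odot>\<^bsub>N\<^esub> h x"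
  unfolding linear_maps_def by blast

lemma linear_maps_cong:
  assumes "h \<in> linear_maps R M N" and "\<And>x. x \<in> carrier M \<Longrightarrow> k x = h x"
    and "module R M"
  shows "k \<in> linear_maps R M N"
proof -
  interpret M: module R M by fact
  show ?thesis
    using assms by (intro linear_mapsI) (auto simp: linear_maps_def)
qed

lemma linear_maps_compose:
  "\<lbrakk>h \<in> linear_maps R M N; k \<in> linear_maps R N P\<rbrakk> \<Longrightarrow> (\<lambda>x. k (h x)) \<in> linear_maps R M P"
  by (intro linear_mapsI) (simp_all add: linear_map_closed linear_map_add linear_map_smult)

lemma linear_maps_id: "(\<lambda>x. x) \<in> linear_maps R M M"
  unfolding linear_maps_def by simp

lemma linear_map_zero:
  assumes "module R M" "module R N" "h \<in> linear_maps R M N"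
  shows "h \<zero>\<^bsub>M\<^esub> = \<zero>\<^bsub>N\<^esub>"
proof -
  interpret M: module R M by fact
  interpret N: module R N by fact
  have "h (\<zero>\<^bsub>R\<^esub> \<odot>\<^bsub>M\<^esub> \<zero>\<^bsub>M\<^esub>) = \<zero>\<^bsub>R\<^esub> \<odot>\<^bsub>N\<^esub> h \<zero>\<^bsub>M\<^esub>"
    using assms(3) by (intro linear_map_smult) auto
  then show ?thesis using linear_map_closed[OF assms(3)] by simp
qed

lemma linear_map_a_minus:
  assumes "module R M" "module R N" "h \<in> linear_maps R M N" "x \<in> carrier M" "y \<in> carrier M"
  shows "h (x \<ominus>\<^bsub>M\<^esub> y) = h x \<ominus>\<^bsub>N\<^esub> h y"
proof -
  interpret M: module R M by fact
  interpret N: module R N by fact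
  \<comment> \<open>Linear maps are only assumed to respect sums and scalars, so negation is written
    as multiplication by -1.\<close>
  have "h (\<ominus>\<^bsub>M\<^esub> y) = h ((\<ominus>\<^bsub>R\<^esub> \<one>\<^bsub>R\<^esub>) \<odot>\<^bsub>M\<^esub> y)"
    using assms by (simp add: M.smult_l_minus)
  also have "\<dots> = \<ominus>\<^bsub>N\<^esub> h y"
    using assms linear_map_closed[OF assms(3)]
    by (subst linear_map_smult[OF assms(3)]) (auto simp: N.smult_l_minus)
  finally show ?thesis
    using assms by (simp add: a_minus_def linear_map_add[OF assms(3)])
qed

lemma linear_map_finsum:
  assumes "module R M" "module R N" "h \<in> linear_maps R M N"
    and "finite I" "\<And>i. i \<in> I \<Longrightarrow> f i \<in> carrier M"
  shows "h (\<Oplus>\<^bsub>M\<^esub>i\<in>I. f i) = (\<Oplus>\<^bsub>N\<^esub>i\<in>I. h (f i))"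
proof -
  interpret M: module R M by fact
  interpret N: module R N by fact
  show ?thesis
    using assms(4,5)
  proof (induction I)
    case empty
    then show ?case using linear_map_zero[OF assms(1,2,3)] by simp
  next
    case (insert i I)
    have "h (\<Oplus>\<^bsub>M\<^esub>i\<in>insert i I. f i) = h (f i) \<oplus>\<^bsub>N\<^esub> h (\<Oplus>\<^bsub>M\<^esub>i\<in>I. f i)"
      using insert.hyps insert.prems
      by (subst M.finsum_insert) (auto intro!: linear_map_add[OF assms(3)])
    also have "\<dots> = (\<Oplus>\<^bsub>N\<^esub>i\<in>insert i I. h (f i))"
      using insert linear_map_closed[OF assms(3)]
      by (subst N.finsum_insert) auto
    finally show ?case .
  qed
qed

lemma bilinear_mapI:
  assumes "\<And>m. m \<in> carrier M \<Longrightarrow> \<beta> m \<in> linear_maps R N P"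
    and "\<And>n. n \<in> carrier N \<Longrightarrow> (\<lambda>m. \<beta> m n) \<in> linear_maps R M P"
  shows "bilinear_map R M N P \<beta>"
  using assms unfolding bilinear_map_def by blast

lemma bilinear_map_right: "\<lbrakk>bilinear_map R M N P \<beta>; m \<in> carrier M\<rbrakk> \<Longrightarrow> \<beta> m \<in> linear_maps R N P"
  unfolding bilinear_map_def by blast

lemma bilinear_map_left:
  "\<lbrakk>bilinear_map R M N P \<beta>; n \<in> carrier N\<rbrakk> \<Longrightarrow> (\<lambda>m. \<beta> m n) \<in> linear_maps R M P"
  unfolding bilinear_map_def by blast

lemma bilinear_map_closed:
  "\<lbrakk>bilinear_map R M N P \<beta>; m \<in> carrier M; n \<in> carrier N\<rbrakk> \<Longrightarrow> \<beta> m n \<in> carrier P"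
  by (rule linear_map_closed[OF bilinear_map_right])

lemma bilinear_map_compose:
  assumes "bilinear_map R M N P \<beta>" "h \<in> linear_maps R P Q"
  shows "bilinear_map R M N Q (\<lambda>m n. h (\<beta> m n))"
  by (intro bilinear_mapI linear_maps_compose[OF _ assms(2)])
     (rule bilinear_map_right[OF assms(1)] bilinear_map_left[OF assms(1)]; assumption)+

lemma bilinear_map_precompose:
  assumes "bilinear_map R M N P \<beta>" "h \<in> linear_maps R M' M" "k \<in> linear_maps R N' N"
  shows "bilinear_map R M' N' P (\<lambda>m n. \<beta> (h m) (k n))"
proof (rule bilinear_mapI)
  fix m assume "m \<in> carrier M'"
  then show "(\<lambda>n. \<beta> (h m) (k n)) \<in> linear_maps R N' P"
    by (rule linear_maps_compose[OF assms(3)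
          bilinear_map_right[OF assms(1) linear_map_closed[OF assms(2)]]])
next
  fix n assume "n \<in> carrier N'"
  then show "(\<lambda>m. \<beta> (h m) (k n)) \<in> linear_maps R M' P"
    by (rule linear_maps_compose[OF assms(2)
          bilinear_map_left[OF assms(1) linear_map_closed[OF assms(3)]]])
qed

section \<open>Free modules and the linear extension of maps on their bases\<close>

lemma free_module_sel [simp]:
  "\<zero>\<^bsub>free_module R X\<^esub> = (\<lambda>x. \<zero>\<^bsub>R\<^esub>)"
  "v \<oplus>\<^bsub>free_module R X\<^esub> w = (\<lambda>x. v x \<oplus>\<^bsub>R\<^esub> w x)"
  "a \<odot>\<^bsub>free_module R X\<^esub> v = (\<lambda>x. a \<otimes>\<^bsub>R\<^esub> v x)"
  by (simp_all add: free_module_def)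

lemma free_module_carrier_iff:
  "v \<in> carrier (free_module R X) \<longleftrightarrow>
     (\<forall>x. v x \<in> carrier R) \<and> finite {x. v x \<noteq> \<zero>\<^bsub>R\<^esub>} \<and> (\<forall>x. v x \<noteq> \<zero>\<^bsub>R\<^esub> \<longrightarrow> x \<in> X)"
  by (auto simp: free_module_def)

lemma free_module_empty: "ring R \<Longrightarrow> carrier (free_module R {}) = {\<lambda>x. \<zero>\<^bsub>R\<^esub>}"
  using abelian_monoid.zero_closed[OF abelian_group.axioms(1)[OF ring.is_abelian_group]]
  by (auto simp: free_module_carrier_iff)

context cring
begin

lemma free_module_is_module: "module R (free_module R X)"
proof (rule moduleI)
  let ?F = "free_module R X"
  have add_closed: "v \<oplus>\<^bsub>?F\<^esub> w \<in> carrier ?F" if "v \<in> carrier ?F" "w \<in> carrier ?F" for v w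
  proof -
    have sub: "{x. v x \<oplus> w x \<noteq> \<zero>} \<subseteq> {x. v x \<noteq> \<zero>} \<union> {x. w x \<noteq> \<zero>}" by auto
    have "finite {x. v x \<oplus> w x \<noteq> \<zero>}"
      using that by (intro finite_subset[OF sub]) (auto simp: free_module_carrier_iff)
    moreover have "x \<in> X" if "v x \<oplus> w x \<noteq> \<zero>" for x
      using that sub \<open>v \<in> carrier ?F\<close> \<open>w \<in> carrier ?F\<close> unfolding free_module_carrier_iff by blast
    ultimately show ?thesis using that by (simp add: free_module_carrier_iff)
  qed
  have minus_closed: "(\<lambda>x. \<ominus> v x) \<in> carrier ?F" if "v \<in> carrier ?F" for v
    using that by (auto simp: free_module_carrier_iff elim!: rev_finite_subset)
  show "abelian_group ?F"
  proof (rule abelian_groupI)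
    fix v assume v: "v \<in> carrier ?F"
    then have "(\<lambda>x. \<ominus> v x) \<oplus>\<^bsub>?F\<^esub> v = \<zero>\<^bsub>?F\<^esub>"
      by (auto simp: free_module_carrier_iff l_neg)
    then show "\<exists>w\<in>carrier ?F. w \<oplus>\<^bsub>?F\<^esub> v = \<zero>\<^bsub>?F\<^esub>" using minus_closed[OF v] by blast
  next
    fix v w assume "v \<in> carrier ?F" "w \<in> carrier ?F"
    then show "v \<oplus>\<^bsub>?F\<^esub> w \<in> carrier ?F" by (rule add_closed)
  qed (auto simp: free_module_carrier_iff a_ac)
  show "a \<odot>\<^bsub>?F\<^esub> v \<in> carrier ?F" if "a \<in> carrier R" "v \<in> carrier ?F" for a v
  proof -
    have sub: "{x. a \<otimes> v x \<noteq> \<zero>} \<subseteq> {x. v x \<noteq> \<zero>}" using that by auto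
    have "finite {x. a \<otimes> v x \<noteq> \<zero>}"
      using that by (intro finite_subset[OF sub]) (auto simp: free_module_carrier_iff)
    moreover have "x \<in> X" if "a \<otimes> v x \<noteq> \<zero>" for x
      using that sub \<open>v \<in> carrier ?F\<close> unfolding free_module_carrier_iff by blast
    ultimately show ?thesis using that by (simp add: free_module_carrier_iff)
  qed
qed (auto simp: free_module_carrier_iff is_cring l_distr r_distr m_assoc)

lemma basis_vec_closed [intro, simp]: "x \<in> X \<Longrightarrow> basis_vec R x \<in> carrier (free_module R X)"
  by (auto simp: free_module_carrier_iff basis_vec_def)

lemma free_module_mono:
  "X \<subseteq> Y \<Longrightarrow> carrier (free_module R X) \<subseteq> carrier (free_module R Y)"
  unfolding free_module_carrier_iff subset_iff by blast

text \<open>The induction is on the finite support: erasing one coordinate of \<open>v\<close>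
  splits off a multiple of a basis vector. The vector is quantified inside the induction because it
  changes at every step.\<close>

lemma free_module_induct [consumes 1, case_names zero add]:
  assumes v: "v \<in> carrier (free_module R X)"
    and zero: "P \<zero>\<^bsub>free_module R X\<^esub>"
    and add: "\<And>a x v. \<lbrakk>a \<in> carrier R; x \<in> X; v \<in> carrier (free_module R X); P v\<rbrakk>
      \<Longrightarrow> P (a \<odot>\<^bsub>free_module R X\<^esub> basis_vec R x \<oplus>\<^bsub>free_module R X\<^esub> v)"
  shows "P v"
proof -
  have "finite {x. v x \<noteq> \<zero>}" using v by (simp add: free_module_carrier_iff)
  moreover have "\<forall>v. {x. v x \<noteq> \<zero>} = S \<longrightarrow> v \<in> carrier (free_module R X) \<longrightarrow> P v"
    if "finite S" for S
    using that
  proof (induction S)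
    case empty
    have "v = (\<lambda>x. \<zero>)" if "{x. v x \<noteq> \<zero>} = {}" for v :: "_ \<Rightarrow> 'a" using that by auto
    then show ?case using zero by auto
  next
    case (insert x S)
    show ?case
    proof (intro allI impI)
      fix v assume supp: "{x. v x \<noteq> \<zero>} = insert x S" and v: "v \<in> carrier (free_module R X)"
      let ?w = "v(x := \<zero>)"
      have S: "{y. ?w y \<noteq> \<zero>} = S" using supp insert.hyps by auto
      then have w: "?w \<in> carrier (free_module R X)"
        using v insert.hyps supp by (auto simp: free_module_carrier_iff split: if_splits)
      have "v = v x \<odot>\<^bsub>free_module R X\<^esub> basis_vec R x \<oplus>\<^bsub>free_module R X\<^esub> ?w"
        using v by (auto simp: free_module_carrier_iff basis_vec_def fun_eq_iff)
      moreover have "v x \<in> carrier R" "x \<in> X"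
        using v supp by (auto simp: free_module_carrier_iff)
      ultimately show "P v"
        using add w insert.IH S by metis
    qed
  qed
  ultimately show ?thesis using v by blast
qed

lemma linear_maps_free_ext:
  assumes "module R P" "h \<in> linear_maps R (free_module R X) P" "k \<in> linear_maps R (free_module R X) P"
    and "\<And>x. x \<in> X \<Longrightarrow> h (basis_vec R x) = k (basis_vec R x)"
    and "v \<in> carrier (free_module R X)"
  shows "h v = k v"
proof -
  interpret F: module R "free_module R X" by (rule free_module_is_module)
  show ?thesis
    using assms(5)
  proof (induction rule: free_module_induct)
    case zero
    then show ?case
      using linear_map_zero[OF F.module_axioms assms(1)] assms(2,3) by metis
  next
    case (add a x v)
    then show ?case
      using assms(2-4) by (simp only: linear_map_add linear_map_smult F.smult_closed basis_vec_closed)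
  qed
qed

text \<open>\<open>lin_ext\<close> sums over the support, which differs between vectors and may
  shrink in their sum. Over a common finite set the sums become comparable, since the additional
  terms are zero.\<close>

lemma lin_ext_superset:
  assumes "module R P" "\<And>x. x \<in> S \<Longrightarrow> \<phi> x \<in> carrier P" "finite S" "{x. v x \<noteq> \<zero>} \<subseteq> S"
    and "\<And>x. v x \<in> carrier R"
  shows "lin_ext R P \<phi> v = (\<Oplus>\<^bsub>P\<^esub>x\<in>S. v x \<odot>\<^bsub>P\<^esub> \<phi> x)"
proof -
  interpret P: module R P by fact
  show ?thesis
    unfolding lin_ext_def
    using assms by (intro P.add.finprod_mono_neutral_cong_left) auto
qed

lemma lin_ext_linear:
  assumes "module R P" "\<And>x. x \<in> X \<Longrightarrow> \<phi> x \<in> carrier P"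
  shows "lin_ext R P \<phi> \<in> linear_maps R (free_module R X) P"
proof (rule linear_mapsI)
  interpret P: module R P by fact
  interpret F: module R "free_module R X" by (rule free_module_is_module)
  let ?F = "free_module R X"
  fix v assume v: "v \<in> carrier ?F"
  then have v': "\<And>x. v x \<in> carrier R" "finite {x. v x \<noteq> \<zero>}" "\<And>x. v x \<noteq> \<zero> \<Longrightarrow> x \<in> X"
    by (auto simp: free_module_carrier_iff)
  show "lin_ext R P \<phi> v \<in> carrier P"
    unfolding lin_ext_def using v' assms by (intro P.finsum_closed) auto
  {
    fix w assume w: "w \<in> carrier ?F"
    then have w': "\<And>x. w x \<in> carrier R" "finite {x. w x \<noteq> \<zero>}" "\<And>x. w x \<noteq> \<zero> \<Longrightarrow> x \<in> X"
      by (auto simp: free_module_carrier_iff)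
    let ?S = "{x. v x \<noteq> \<zero>} \<union> {x. w x \<noteq> \<zero>}"
    have sum_supp: "{x. v x \<oplus> w x \<noteq> \<zero>} \<subseteq> ?S" by auto
    have fin: "finite ?S" and S: "\<And>x. x \<in> ?S \<Longrightarrow> \<phi> x \<in> carrier P" using v' w' assms by auto
    have "lin_ext R P \<phi> (v \<oplus>\<^bsub>?F\<^esub> w) = (\<Oplus>\<^bsub>P\<^esub>x\<in>?S. (v x \<oplus> w x) \<odot>\<^bsub>P\<^esub> \<phi> x)"
      using v' w' fin S sum_supp by (subst lin_ext_superset[OF assms(1), where S = ?S]) auto
    also have "\<dots> = (\<Oplus>\<^bsub>P\<^esub>x\<in>?S. v x \<odot>\<^bsub>P\<^esub> \<phi> x \<oplus>\<^bsub>P\<^esub> w x \<odot>\<^bsub>P\<^esub> \<phi> x)"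
      using v' w' assms by (intro P.finsum_cong') (auto simp: P.smult_l_distr)
    also have "\<dots> = (\<Oplus>\<^bsub>P\<^esub>x\<in>?S. v x \<odot>\<^bsub>P\<^esub> \<phi> x) \<oplus>\<^bsub>P\<^esub> (\<Oplus>\<^bsub>P\<^esub>x\<in>?S. w x \<odot>\<^bsub>P\<^esub> \<phi> x)"
      using v' w' assms by (intro P.finsum_addf) auto
    also have "\<dots> = lin_ext R P \<phi> v \<oplus>\<^bsub>P\<^esub> lin_ext R P \<phi> w"
      using v' w' fin S
      by (subst (1 2) lin_ext_superset[OF assms(1), where S = ?S]) auto
    finally show "lin_ext R P \<phi> (v \<oplus>\<^bsub>?F\<^esub> w) = lin_ext R P \<phi> v \<oplus>\<^bsub>P\<^esub> lin_ext R P \<phi> w" .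
  next
    fix a assume a: "a \<in> carrier R"
    let ?S = "{x. v x \<noteq> \<zero>}"
    have S: "\<And>x. x \<in> ?S \<Longrightarrow> \<phi> x \<in> carrier P" using v' assms by auto
    have "lin_ext R P \<phi> (a \<odot>\<^bsub>?F\<^esub> v) = (\<Oplus>\<^bsub>P\<^esub>x\<in>?S. (a \<otimes> v x) \<odot>\<^bsub>P\<^esub> \<phi> x)"
      using v' a S by (subst lin_ext_superset[OF assms(1), where S = ?S]) auto
    also have "\<dots> = (\<Oplus>\<^bsub>P\<^esub>x\<in>?S. a \<odot>\<^bsub>P\<^esub> (v x \<odot>\<^bsub>P\<^esub> \<phi> x))"
      using v' a assms by (intro P.finsum_cong') (auto simp: P.smult_assoc1)
    also have "\<dots> = a \<odot>\<^bsub>P\<^esub> lin_ext R P \<phi> v"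
      unfolding lin_ext_def using v' assms a
      by (intro P.finsum_smult_ldistr[symmetric]) auto
    finally show "lin_ext R P \<phi> (a \<odot>\<^bsub>?F\<^esub> v) = a \<odot>\<^bsub>P\<^esub> lin_ext R P \<phi> v" .
  }
qed

lemma lin_ext_basis_vec:
  assumes "module R P" "\<phi> x \<in> carrier P"
  shows "lin_ext R P \<phi> (basis_vec R x) = \<phi> x"
proof -
  interpret P: module R P by fact
  have "lin_ext R P \<phi> (basis_vec R x) = (\<Oplus>\<^bsub>P\<^esub>y\<in>{x}. basis_vec R x y \<odot>\<^bsub>P\<^esub> \<phi> y)"
    using assms by (intro lin_ext_superset) (auto simp: basis_vec_def)
  then show ?thesis using assms by (simp add: basis_vec_def)
qed

text \<open>The nested extension is the shape in which composition and twist are defined. Linearity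
  in \<open>v\<close> is that of the outer extension; for \<open>w\<close> the inner value is
  expanded under the outer sum.\<close>

lemma lin_ext_lin_ext_bilinear:
  assumes P: "module R P" and \<phi>: "\<And>x y. \<lbrakk>x \<in> X; y \<in> Y\<rbrakk> \<Longrightarrow> \<phi> x y \<in> carrier P"
  shows "bilinear_map R (free_module R X) (free_module R Y) P
    (\<lambda>v w. lin_ext R P (\<lambda>x. lin_ext R P (\<phi> x) w) v)"
proof (rule bilinear_mapI)
  interpret P: module R P by fact
  have inner: "lin_ext R P (\<phi> x) \<in> linear_maps R (free_module R Y) P" if "x \<in> X" for x
    using that \<phi> by (intro lin_ext_linear[OF P])
  {
    fix w assume w: "w \<in> carrier (free_module R Y)"
    then show "(\<lambda>v. lin_ext R P (\<lambda>x. lin_ext R P (\<phi> x) w) v) \<in> linear_maps R (free_module R X) P"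
      by (intro lin_ext_linear[OF P] linear_map_closed[OF inner])
  }
  fix v assume v: "v \<in> carrier (free_module R X)"
  then have v': "\<And>x. v x \<in> carrier R" "finite {x. v x \<noteq> \<zero>}" "\<And>x. v x \<noteq> \<zero> \<Longrightarrow> x \<in> X"
    by (auto simp: free_module_carrier_iff)
  note cl = linear_map_closed[OF inner]
  show "(\<lambda>w. lin_ext R P (\<lambda>x. lin_ext R P (\<phi> x) w) v) \<in> linear_maps R (free_module R Y) P"
  proof (rule linear_mapsI)
    fix w assume w: "w \<in> carrier (free_module R Y)"
    show "lin_ext R P (\<lambda>x. lin_ext R P (\<phi> x) w) v \<in> carrier P"
      unfolding lin_ext_def[of R P "\<lambda>x. lin_ext R P (\<phi> x) w"] using v' cl w by (intro P.finsum_closed) auto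
    {
      fix w' assume w': "w' \<in> carrier (free_module R Y)"
      show "lin_ext R P (\<lambda>x. lin_ext R P (\<phi> x) (w \<oplus>\<^bsub>free_module R Y\<^esub> w')) v =
        lin_ext R P (\<lambda>x. lin_ext R P (\<phi> x) w) v \<oplus>\<^bsub>P\<^esub> lin_ext R P (\<lambda>x. lin_ext R P (\<phi> x) w') v"
        unfolding lin_ext_def[of R P "\<lambda>x. lin_ext R P (\<phi> x) _"]
        using v' cl w w'
        by (subst P.finsum_addf[symmetric], blast, blast, intro P.finsum_cong')
           (auto simp: linear_map_add[OF inner] P.smult_r_distr simp del: free_module_sel)
    next
      fix a assume a: "a \<in> carrier R"
      show "lin_ext R P (\<lambda>x. lin_ext R P (\<phi> x) (a \<odot>\<^bsub>free_module R Y\<^esub> w)) v =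
        a \<odot>\<^bsub>P\<^esub> lin_ext R P (\<lambda>x. lin_ext R P (\<phi> x) w) v"
        unfolding lin_ext_def[of R P "\<lambda>x. lin_ext R P (\<phi> x) _"]
        using v' cl w a
        by (subst P.finsum_smult_ldistr, blast, blast, blast, intro P.finsum_cong')
           (auto simp: linear_map_smult[OF inner] P.smult_assoc1[symmetric] m_comm
             simp del: free_module_sel)
    }
  qed
qed

lemma lin_ext_lin_ext_basis_vec:
  assumes "module R P" "\<phi> x y \<in> carrier P"
  shows "lin_ext R P (\<lambda>x. lin_ext R P (\<phi> x) (basis_vec R y)) (basis_vec R x) = \<phi> x y"
  using assms by (simp add: lin_ext_basis_vec)

lemma bilinear_map_free_ext:
  assumes "module R P" "bilinear_map R (free_module R X) (free_module R Y) P \<beta>"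
    "bilinear_map R (free_module R X) (free_module R Y) P \<gamma>"
    and "\<And>x y. \<lbrakk>x \<in> X; y \<in> Y\<rbrakk> \<Longrightarrow> \<beta> (basis_vec R x) (basis_vec R y) = \<gamma> (basis_vec R x) (basis_vec R y)"
    and "v \<in> carrier (free_module R X)" "w \<in> carrier (free_module R Y)"
  shows "\<beta> v w = \<gamma> v w"
proof -
  have "\<beta> (basis_vec R x) w = \<gamma> (basis_vec R x) w" if "x \<in> X" for x
    using basis_vec_closed[OF that] that
    by (intro linear_maps_free_ext[OF assms(1) bilinear_map_right[OF assms(2)]
          bilinear_map_right[OF assms(3)] _ assms(6)]) (simp_all add: assms(4))
  then show ?thesis
    by (intro linear_maps_free_ext[OF assms(1) bilinear_map_left[OF assms(2) assms(6)]
          bilinear_map_left[OF assms(3) assms(6)] _ assms(5)])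
qed

end

lemma linear_maps_add:
  assumes "module R P" "h \<in> linear_maps R M P" "k \<in> linear_maps R M P"
  shows "(\<lambda>x. h x \<oplus>\<^bsub>P\<^esub> k x) \<in> linear_maps R M P"
proof -
  interpret P: module R P by fact
  show ?thesis
    by (intro linear_mapsI)
       (simp_all add: linear_map_closed[OF assms(2)] linear_map_closed[OF assms(3)]
         linear_map_add[OF assms(2)] linear_map_add[OF assms(3)]
         linear_map_smult[OF assms(2)] linear_map_smult[OF assms(3)] P.smult_r_distr P.a_ac)
qed

lemma linear_maps_zero: "module R P \<Longrightarrow> (\<lambda>x. \<zero>\<^bsub>P\<^esub>) \<in> linear_maps R M P"
proof -
  assume "module R P"
  then interpret P: module R P .
  show ?thesis by (rule linear_mapsI) auto
qed

section \<open>Quotient modules\<close>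

lemma quot_module_sel [simp]:
  "carrier (quot_module M N) = a_rcosets\<^bsub>M\<^esub> N"
  "\<zero>\<^bsub>quot_module M N\<^esub> = N"
  "X \<oplus>\<^bsub>quot_module M N\<^esub> Y = X <+>\<^bsub>M\<^esub> Y"
  "a \<odot>\<^bsub>quot_module M N\<^esub> X = (\<Union>x\<in>X. N +>\<^bsub>M\<^esub> (a \<odot>\<^bsub>M\<^esub> x))"
  by (simp_all add: quot_module_def)

locale quotient = module R M
  for R :: "('k, 'r) ring_scheme" (structure) and M :: "('k, 'm) module" (structure) +
  fixes N :: "'m set"
  assumes submodule: "submodule N R M"
begin

sublocale sub: abelian_subgroup N M
  by (intro abelian_subgroupI3 additive_subgroupI submodule.axioms(1)[OF submodule]) unfold_locales

abbreviation "Q \<equiv> quot_module M N"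

lemma coset_carrierE:
  assumes "X \<in> carrier Q"
  obtains x where "x \<in> carrier M" "X = N +>\<^bsub>M\<^esub> x"
  using assms by (auto simp: A_RCOSETS_def')

lemma coset_closed: "x \<in> carrier M \<Longrightarrow> N +>\<^bsub>M\<^esub> x \<in> carrier Q"
  by (simp add: M.a_rcosetsI sub.a_subset)

lemma coset_zero: "N +>\<^bsub>M\<^esub> \<zero>\<^bsub>M\<^esub> = N"
  by (simp add: sub.a_subset)

lemma coset_eq: "\<lbrakk>x \<in> carrier M; y \<in> carrier M; x \<ominus>\<^bsub>M\<^esub> y \<in> N\<rbrakk> \<Longrightarrow> N +>\<^bsub>M\<^esub> x = N +>\<^bsub>M\<^esub> y"
  using sub.a_rcos_module_rev sub.a_repr_independence' by (metis a_minus_def)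

lemma coset_add:
  "\<lbrakk>x \<in> carrier M; y \<in> carrier M\<rbrakk> \<Longrightarrow> (N +>\<^bsub>M\<^esub> x) \<oplus>\<^bsub>Q\<^esub> (N +>\<^bsub>M\<^esub> y) = N +>\<^bsub>M\<^esub> (x \<oplus>\<^bsub>M\<^esub> y)"
  by (simp add: sub.a_rcos_sum)

text \<open>The action in \<open>quot_module\<close> is a union over all representatives. Its
  members coincide, because representatives differ by elements of \<open>N\<close> and
  \<open>N\<close> is closed under scalars.\<close>

lemma coset_smult:
  assumes "a \<in> carrier R" "x \<in> carrier M"
  shows "a \<odot>\<^bsub>Q\<^esub> (N +>\<^bsub>M\<^esub> x) = N +>\<^bsub>M\<^esub> (a \<odot>\<^bsub>M\<^esub> x)"
proof -
  have "N +>\<^bsub>M\<^esub> (a \<odot>\<^bsub>M\<^esub> w) = N +>\<^bsub>M\<^esub> (a \<odot>\<^bsub>M\<^esub> x)" if "w \<in> N +>\<^bsub>M\<^esub> x" for w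
  proof -
    obtain n where n: "n \<in> N" "w = n \<oplus>\<^bsub>M\<^esub> x" using \<open>w \<in> _\<close> by (auto simp: a_r_coset_def')
    then have "a \<odot>\<^bsub>M\<^esub> w = a \<odot>\<^bsub>M\<^esub> n \<oplus>\<^bsub>M\<^esub> a \<odot>\<^bsub>M\<^esub> x"
      using assms sub.a_Hcarr by (simp add: smult_r_distr)
    moreover have "a \<odot>\<^bsub>M\<^esub> n \<in> N" using submodule.smult_closed[OF submodule] assms n by blast
    ultimately have "a \<odot>\<^bsub>M\<^esub> w \<in> N +>\<^bsub>M\<^esub> (a \<odot>\<^bsub>M\<^esub> x)" by (auto simp: a_r_coset_def')
    then show ?thesis using sub.a_repr_independence' assms by (metis smult_closed)
  qed
  moreover have "x \<in> N +>\<^bsub>M\<^esub> x" using sub.a_rcos_self[OF assms(2)] .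
  ultimately show ?thesis unfolding quot_module_sel by (intro SUP_eq_const) blast+
qed

lemma module_quot: "module R Q"
proof (rule moduleI)
  show "abelian_group Q"
  proof (rule abelian_groupI)
    fix X Y Z assume "X \<in> carrier Q" "Y \<in> carrier Q" "Z \<in> carrier Q"
    then show "(X \<oplus>\<^bsub>Q\<^esub> Y) \<oplus>\<^bsub>Q\<^esub> Z = X \<oplus>\<^bsub>Q\<^esub> (Y \<oplus>\<^bsub>Q\<^esub> Z)"
      by (elim coset_carrierE) (simp del: quot_module_sel add: coset_add M.a_assoc)
  next
    fix X Y assume "X \<in> carrier Q" "Y \<in> carrier Q"
    then show "X \<oplus>\<^bsub>Q\<^esub> Y = Y \<oplus>\<^bsub>Q\<^esub> X"
      by (elim coset_carrierE) (simp del: quot_module_sel add: coset_add M.a_comm)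
  next
    fix X Y assume "X \<in> carrier Q" "Y \<in> carrier Q"
    then show "X \<oplus>\<^bsub>Q\<^esub> Y \<in> carrier Q"
      by (elim coset_carrierE) (simp del: quot_module_sel add: coset_add coset_closed)
  next
    show "\<zero>\<^bsub>Q\<^esub> \<in> carrier Q" using coset_closed[OF M.zero_closed] coset_zero by simp
  next
    fix X assume "X \<in> carrier Q"
    then obtain x where x: "x \<in> carrier M" "X = N +>\<^bsub>M\<^esub> x" by (rule coset_carrierE)
    then show "\<zero>\<^bsub>Q\<^esub> \<oplus>\<^bsub>Q\<^esub> X = X"
      using coset_add[of "\<zero>\<^bsub>M\<^esub>" x] coset_zero by simp
    have "(N +>\<^bsub>M\<^esub> (\<ominus>\<^bsub>M\<^esub> x)) \<oplus>\<^bsub>Q\<^esub> X = \<zero>\<^bsub>Q\<^esub>"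
      using x coset_add[of "\<ominus>\<^bsub>M\<^esub> x" x] coset_zero by (simp add: M.l_neg)
    then show "\<exists>Y\<in>carrier Q. Y \<oplus>\<^bsub>Q\<^esub> X = \<zero>\<^bsub>Q\<^esub>"
      using coset_closed x by blast
  qed
next
  fix a X assume "a \<in> carrier R" "X \<in> carrier Q"
  then show "a \<odot>\<^bsub>Q\<^esub> X \<in> carrier Q"
    by (elim coset_carrierE) (simp del: quot_module_sel add: coset_smult coset_closed)
next
  fix a b X assume "a \<in> carrier R" "b \<in> carrier R" "X \<in> carrier Q"
  then show "(a \<oplus>\<^bsub>R\<^esub> b) \<odot>\<^bsub>Q\<^esub> X = a \<odot>\<^bsub>Q\<^esub> X \<oplus>\<^bsub>Q\<^esub> b \<odot>\<^bsub>Q\<^esub> X"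
    by (elim coset_carrierE) (simp del: quot_module_sel add: coset_smult coset_add smult_l_distr)
next
  fix a X Y assume "a \<in> carrier R" "X \<in> carrier Q" "Y \<in> carrier Q"
  then show "a \<odot>\<^bsub>Q\<^esub> (X \<oplus>\<^bsub>Q\<^esub> Y) = a \<odot>\<^bsub>Q\<^esub> X \<oplus>\<^bsub>Q\<^esub> a \<odot>\<^bsub>Q\<^esub> Y"
    by (elim coset_carrierE) (simp del: quot_module_sel add: coset_smult coset_add smult_r_distr)
next
  fix a b X assume "a \<in> carrier R" "b \<in> carrier R" "X \<in> carrier Q"
  then show "(a \<otimes>\<^bsub>R\<^esub> b) \<odot>\<^bsub>Q\<^esub> X = a \<odot>\<^bsub>Q\<^esub> (b \<odot>\<^bsub>Q\<^esub> X)"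
    by (elim coset_carrierE) (simp del: quot_module_sel add: coset_smult smult_assoc1)
next
  fix X assume "X \<in> carrier Q"
  then show "\<one>\<^bsub>R\<^esub> \<odot>\<^bsub>Q\<^esub> X = X"
    by (elim coset_carrierE) (simp del: quot_module_sel add: coset_smult)
qed (rule R.is_cring)

text \<open>Makes the choice of a representative in \<open>tensor_lift\<close> harmless: every
  element of the coset gives the same value.\<close>

lemma linear_map_const_on_coset:
  assumes "module R P" "h \<in> linear_maps R M P" "\<And>n. n \<in> N \<Longrightarrow> h n = \<zero>\<^bsub>P\<^esub>"
    and "x \<in> carrier M" "w \<in> N +>\<^bsub>M\<^esub> x"
  shows "h w = h x"
proof -
  interpret P: module R P by fact
  obtain n where n: "n \<in> N" "w = n \<oplus>\<^bsub>M\<^esub> x" using assms(5) by (auto simp: a_r_coset_def')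
  then have "h w = h n \<oplus>\<^bsub>P\<^esub> h x"
    using linear_map_add[OF assms(2) sub.a_Hcarr assms(4)] by blast
  then show ?thesis using assms(3)[OF n(1)] linear_map_closed[OF assms(2,4)] by simp
qed

end

text \<open>A \<open>hull\<close> is an intersection, so this is what makes
  \<open>tensor_null\<close> a submodule. The empty family is excluded because its intersection is
  the whole type.\<close>

lemma (in module) submodule_Inter:
  assumes "\<S> \<noteq> {}" "\<And>H. H \<in> \<S> \<Longrightarrow> submodule H R M"
  shows "submodule (\<Inter>\<S>) R M"
proof (rule submoduleI)
  note E = submoduleE[OF assms(2)]
  show "\<Inter>\<S> \<subseteq> carrier M" using assms(1) E(1) by blast
  show "\<zero>\<^bsub>M\<^esub> \<in> \<Inter>\<S>"
    using E(2,3,5,6) subgroup.one_closed[OF submodule.axioms(1)[OF assms(2)]] by auto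
  show "\<ominus>\<^bsub>M\<^esub> a \<in> \<Inter>\<S>" if "a \<in> \<Inter>\<S>" for a using that E(3) by blast
  show "a \<oplus>\<^bsub>M\<^esub> b \<in> \<Inter>\<S>" if "a \<in> \<Inter>\<S>" "b \<in> \<Inter>\<S>" for a b using that E(5) by blast
  show "a \<odot>\<^bsub>M\<^esub> b \<in> \<Inter>\<S>" if "a \<in> carrier R" "b \<in> \<Inter>\<S>" for a b using that E(4) by blast
qed

lemma linear_map_kernel_submodule:
  assumes "module R M" "module R P" "h \<in> linear_maps R M P"
  shows "submodule {x \<in> carrier M. h x = \<zero>\<^bsub>P\<^esub>} R M"
proof -
  interpret M: module R M by fact
  interpret P: module R P by fact
  note z = linear_map_zero[OF assms]
  show ?thesis
  proof (rule M.submoduleI)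
    fix x assume "x \<in> {x \<in> carrier M. h x = \<zero>\<^bsub>P\<^esub>}"
    then show "\<ominus>\<^bsub>M\<^esub> x \<in> {x \<in> carrier M. h x = \<zero>\<^bsub>P\<^esub>}"
      using linear_map_a_minus[OF assms M.zero_closed, of x] z by (simp add: a_minus_def)
  qed (auto simp: z linear_map_add[OF assms(3)] linear_map_smult[OF assms(3)])
qed

section \<open>Bimodules and tensor products\<close>

lemma module_a_closed:
  "\<lbrakk>module R M; x \<in> carrier M; y \<in> carrier M\<rbrakk> \<Longrightarrow> x \<oplus>\<^bsub>M\<^esub> y \<in> carrier M"
  by (intro abelian_monoid.a_closed abelian_group.axioms(1) module.axioms(2))

locale bimodule = linear_category R A
  for R :: "('k, 'r) ring_scheme" (structure) and A :: "('o, 'k, 'a) lin_cat" +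
  fixes M :: "('o, 'k, 'a, 'm) bimod"
  assumes BMod_module: "\<lbrakk>x \<in> Obj A; y \<in> Obj A\<rbrakk> \<Longrightarrow> module R (BMod M x y)"
    and LAct_bilinear: "\<lbrakk>x \<in> Obj A; y \<in> Obj A; z \<in> Obj A\<rbrakk>
      \<Longrightarrow> bilinear_map R (Mor A y z) (BMod M x y) (BMod M x z) (LAct M x y z)"
    and RAct_bilinear: "\<lbrakk>x \<in> Obj A; y \<in> Obj A; z \<in> Obj A\<rbrakk>
      \<Longrightarrow> bilinear_map R (BMod M y z) (Mor A x y) (BMod M x z) (RAct M x y z)"
    and LAct_assoc: "\<lbrakk>w \<in> Obj A; x \<in> Obj A; y \<in> Obj A; z \<in> Obj A;
        a \<in> carrier (Mor A y z); b \<in> carrier (Mor A x y); m \<in> carrier (BMod M w x)\<rbrakk>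
      \<Longrightarrow> LAct M w x z (Cmp A x y z a b) m = LAct M w y z a (LAct M w x y b m)"
    and RAct_assoc: "\<lbrakk>w \<in> Obj A; x \<in> Obj A; y \<in> Obj A; z \<in> Obj A;
        m \<in> carrier (BMod M y z); a \<in> carrier (Mor A x y); b \<in> carrier (Mor A w x)\<rbrakk>
      \<Longrightarrow> RAct M w x z (RAct M x y z m a) b = RAct M w y z m (Cmp A w x y a b)"
    and LAct_RAct: "\<lbrakk>w \<in> Obj A; x \<in> Obj A; y \<in> Obj A; z \<in> Obj A;
        a \<in> carrier (Mor A y z); m \<in> carrier (BMod M x y); b \<in> carrier (Mor A w x)\<rbrakk>
      \<Longrightarrow> RAct M w x z (LAct M x y z a m) b = LAct M w y z a (RAct M w x y m b)"
    and LAct_Ident: "\<lbrakk>x \<in> Obj A; y \<in> Obj A; m \<in> carrier (BMod M x y)\<rbrakk>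
      \<Longrightarrow> LAct M x y y (Ident A y) m = m"
    and RAct_Ident: "\<lbrakk>x \<in> Obj A; y \<in> Obj A; m \<in> carrier (BMod M x y)\<rbrakk>
      \<Longrightarrow> RAct M x x y m (Ident A x) = m"
begin

lemma LAct_linear:
  "\<lbrakk>x \<in> Obj A; y \<in> Obj A; z \<in> Obj A; a \<in> carrier (Mor A y z)\<rbrakk>
    \<Longrightarrow> LAct M x y z a \<in> linear_maps R (BMod M x y) (BMod M x z)"
  by (rule bilinear_map_right[OF LAct_bilinear])

lemma RAct_linear:
  "\<lbrakk>x \<in> Obj A; y \<in> Obj A; z \<in> Obj A; a \<in> carrier (Mor A x y)\<rbrakk>
    \<Longrightarrow> (\<lambda>m. RAct M x y z m a) \<in> linear_maps R (BMod M y z) (BMod M x z)"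
  by (rule bilinear_map_left[OF RAct_bilinear])

lemma LAct_closed:
  "\<lbrakk>x \<in> Obj A; y \<in> Obj A; z \<in> Obj A; a \<in> carrier (Mor A y z); m \<in> carrier (BMod M x y)\<rbrakk>
    \<Longrightarrow> LAct M x y z a m \<in> carrier (BMod M x z)"
  by (rule linear_map_closed[OF LAct_linear])

lemma RAct_closed:
  "\<lbrakk>x \<in> Obj A; y \<in> Obj A; z \<in> Obj A; m \<in> carrier (BMod M y z); a \<in> carrier (Mor A x y)\<rbrakk>
    \<Longrightarrow> RAct M x y z m a \<in> carrier (BMod M x z)"
  by (rule linear_map_closed[OF RAct_linear])

end

lemma (in linear_category) regular_bimodule: "bimodule R C (regular_bimod C)"
proof (intro bimodule.intro bimodule_axioms.intro)
qed (simp_all add: regular_bimod_def linear_category_axioms Mor_module Cmp_bilinear Cmp_assoc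
      Cmp_Ident_left Cmp_Ident_right)

text \<open>The input of the universal property of the tensor product. Balance concerns
  endomorphisms of the middle object, matching the last family in
  \<open>tensor_rels\<close>.\<close>

definition balanced ::
    "('k, 'r) ring_scheme \<Rightarrow> ('o, 'k, 'a) lin_cat \<Rightarrow> ('o, 'k, 'a, 'm) bimod \<Rightarrow> ('o, 'k, 'a, 'n) bimod
      \<Rightarrow> 'o \<Rightarrow> 'o \<Rightarrow> ('k, 'p) module \<Rightarrow> ('o \<Rightarrow> 'm \<Rightarrow> 'n \<Rightarrow> 'p) \<Rightarrow> bool" where
  "balanced R A M N x z P \<phi> \<longleftrightarrow>
     (\<forall>y\<in>Obj A. bilinear_map R (BMod M y z) (BMod N x y) P (\<phi> y)) \<and>
     (\<forall>y\<in>Obj A. \<forall>a\<in>carrier (Mor A y y). \<forall>m\<in>carrier (BMod M y z). \<forall>n\<in>carrier (BMod N x y).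
        \<phi> y (RAct M y y z m a) n = \<phi> y m (LAct N x y y a n))"

lemma balancedI:
  assumes "\<And>y. y \<in> Obj A \<Longrightarrow> bilinear_map R (BMod M y z) (BMod N x y) P (\<phi> y)"
    and "\<And>y a m n. \<lbrakk>y \<in> Obj A; a \<in> carrier (Mor A y y); m \<in> carrier (BMod M y z);
      n \<in> carrier (BMod N x y)\<rbrakk> \<Longrightarrow> \<phi> y (RAct M y y z m a) n = \<phi> y m (LAct N x y y a n)"
  shows "balanced R A M N x z P \<phi>"
  using assms unfolding balanced_def by blast

lemma balanced_bilinear:
  "\<lbrakk>balanced R A M N x z P \<phi>; y \<in> Obj A\<rbrakk> \<Longrightarrow> bilinear_map R (BMod M y z) (BMod N x y) P (\<phi> y)"
  unfolding balanced_def by blast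

lemma balanced_balance:
  "\<lbrakk>balanced R A M N x z P \<phi>; y \<in> Obj A; a \<in> carrier (Mor A y y); m \<in> carrier (BMod M y z);
      n \<in> carrier (BMod N x y)\<rbrakk> \<Longrightarrow> \<phi> y (RAct M y y z m a) n = \<phi> y m (LAct N x y y a n)"
  unfolding balanced_def by blast

locale bimodule_pair = M: bimodule R A M + N: bimodule R A N
  for R :: "('k, 'r) ring_scheme" (structure) and A :: "('o, 'k, 'a) lin_cat"
    and M :: "('o, 'k, 'a, 'm) bimod" and N :: "('o, 'k, 'a, 'n) bimod"
begin

abbreviation "T \<equiv> tensor_mod R A M N"
abbreviation "pure \<equiv> pure_tensor R A M N"

lemma tensor_free_module: "module R (tensor_free R A M N x z)"
  unfolding tensor_free_def by (rule M.free_module_is_module)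

lemma tensor_free_basis [simp]:
  "\<lbrakk>y \<in> Obj A; m \<in> carrier (BMod M y z); n \<in> carrier (BMod N x y)\<rbrakk>
    \<Longrightarrow> basis_vec R (y, m, n) \<in> carrier (tensor_free R A M N x z)"
  unfolding tensor_free_def by (rule M.basis_vec_closed) simp

lemma tensor_null_submodule:
  assumes "x \<in> Obj A" "z \<in> Obj A"
  shows "submodule (tensor_null R A M N x z) R (tensor_free R A M N x z)"
    and "tensor_rels R A M N x z \<subseteq> tensor_null R A M N x z"
proof -
  interpret F: module R "tensor_free R A M N x z" by (rule tensor_free_module)
  have "tensor_rels R A M N x z \<subseteq> carrier (tensor_free R A M N x z)"
  proof -
    note [simp] = assms module_a_closed[OF M.BMod_module] module_a_closed[OF N.BMod_module]
      module.smult_closed[OF M.BMod_module] module.smult_closed[OF N.BMod_module]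
      M.RAct_closed N.LAct_closed
    show ?thesis
      unfolding tensor_rels_def Let_def by (intro Un_least subsetI; clarsimp)
  qed
  \<comment> \<open>The whole free module contains the relations, so the hull intersects a non-empty
    family.\<close>
  then have ne: "{H. submodule H R (tensor_free R A M N x z) \<and> tensor_rels R A M N x z \<subseteq> H} \<noteq> {}"
    using F.carrier_is_submodule by blast
  show "submodule (tensor_null R A M N x z) R (tensor_free R A M N x z)"
    unfolding tensor_null_def hull_def by (rule F.submodule_Inter[OF ne]) blast
  show "tensor_rels R A M N x z \<subseteq> tensor_null R A M N x z"
    unfolding tensor_null_def by (rule hull_subset)
qed

lemma tensor_quotient:
  "\<lbrakk>x \<in> Obj A; z \<in> Obj A\<rbrakk> \<Longrightarrow> quotient R (tensor_free R A M N x z) (tensor_null R A M N x z)"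
  by (intro quotient.intro quotient_axioms.intro tensor_free_module tensor_null_submodule)

lemma tensor_module: "\<lbrakk>x \<in> Obj A; z \<in> Obj A\<rbrakk> \<Longrightarrow> module R (T x z)"
  unfolding tensor_mod_def by (rule quotient.module_quot[OF tensor_quotient])

context
  fixes x z assumes xz: "x \<in> Obj A" "z \<in> Obj A"
begin

interpretation F: quotient R "tensor_free R A M N x z" "tensor_null R A M N x z"
  by (rule tensor_quotient[OF xz])

lemma pure_closed:
  "\<lbrakk>y \<in> Obj A; m \<in> carrier (BMod M y z); n \<in> carrier (BMod N x y)\<rbrakk> \<Longrightarrow> pure x z y m n \<in> carrier (T x z)"
  unfolding tensor_mod_def pure_tensor_def by (rule F.coset_closed) simp

lemma pure_add_left:
  assumes "y \<in> Obj A" "m \<in> carrier (BMod M y z)" "m' \<in> carrier (BMod M y z)" "n \<in> carrier (BMod N x y)"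
  shows "pure x z y (m \<oplus>\<^bsub>BMod M y z\<^esub> m') n = pure x z y m n \<oplus>\<^bsub>T x z\<^esub> pure x z y m' n"
proof -
  interpret My: module R "BMod M y z" using assms xz by (intro M.BMod_module)
  have "basis_vec R (y, m \<oplus>\<^bsub>BMod M y z\<^esub> m', n) \<ominus>\<^bsub>tensor_free R A M N x z\<^esub>
      (basis_vec R (y, m, n) \<oplus>\<^bsub>tensor_free R A M N x z\<^esub> basis_vec R (y, m', n)) \<in> tensor_rels R A M N x z"
    unfolding tensor_rels_def Let_def using assms by blast
  then show ?thesis
    unfolding tensor_mod_def pure_tensor_def
    using assms tensor_null_submodule(2)[OF xz]
    by (subst F.coset_add, simp, simp, intro F.coset_eq)
       (auto simp: module_a_closed[OF tensor_free_module])
qed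

lemma pure_add_right:
  assumes "y \<in> Obj A" "m \<in> carrier (BMod M y z)" "n \<in> carrier (BMod N x y)" "n' \<in> carrier (BMod N x y)"
  shows "pure x z y m (n \<oplus>\<^bsub>BMod N x y\<^esub> n') = pure x z y m n \<oplus>\<^bsub>T x z\<^esub> pure x z y m n'"
proof -
  interpret Ny: module R "BMod N x y" using assms xz by (intro N.BMod_module)
  have "basis_vec R (y, m, n \<oplus>\<^bsub>BMod N x y\<^esub> n') \<ominus>\<^bsub>tensor_free R A M N x z\<^esub>
      (basis_vec R (y, m, n) \<oplus>\<^bsub>tensor_free R A M N x z\<^esub> basis_vec R (y, m, n')) \<in> tensor_rels R A M N x z"
    unfolding tensor_rels_def Let_def using assms by blast
  then show ?thesis
    unfolding tensor_mod_def pure_tensor_def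
    using assms tensor_null_submodule(2)[OF xz]
    by (subst F.coset_add, simp, simp, intro F.coset_eq)
       (auto simp: module_a_closed[OF tensor_free_module])
qed

lemma pure_smult_left:
  assumes "y \<in> Obj A" "c \<in> carrier R" "m \<in> carrier (BMod M y z)" "n \<in> carrier (BMod N x y)"
  shows "pure x z y (c \<odot>\<^bsub>BMod M y z\<^esub> m) n = c \<odot>\<^bsub>T x z\<^esub> pure x z y m n"
proof -
  interpret My: module R "BMod M y z" using assms xz by (intro M.BMod_module)
  have "basis_vec R (y, c \<odot>\<^bsub>BMod M y z\<^esub> m, n) \<ominus>\<^bsub>tensor_free R A M N x z\<^esub>
      (c \<odot>\<^bsub>tensor_free R A M N x z\<^esub> basis_vec R (y, m, n)) \<in> tensor_rels R A M N x z"
    unfolding tensor_rels_def Let_def using assms by blast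
  then show ?thesis
    unfolding tensor_mod_def pure_tensor_def
    using assms tensor_null_submodule(2)[OF xz]
    by (subst F.coset_smult, simp, simp, intro F.coset_eq) auto
qed

lemma pure_smult_right:
  assumes "y \<in> Obj A" "c \<in> carrier R" "m \<in> carrier (BMod M y z)" "n \<in> carrier (BMod N x y)"
  shows "pure x z y m (c \<odot>\<^bsub>BMod N x y\<^esub> n) = c \<odot>\<^bsub>T x z\<^esub> pure x z y m n"
proof -
  interpret Ny: module R "BMod N x y" using assms xz by (intro N.BMod_module)
  have "basis_vec R (y, m, c \<odot>\<^bsub>BMod N x y\<^esub> n) \<ominus>\<^bsub>tensor_free R A M N x z\<^esub>
      (c \<odot>\<^bsub>tensor_free R A M N x z\<^esub> basis_vec R (y, m, n)) \<in> tensor_rels R A M N x z"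
    unfolding tensor_rels_def Let_def using assms by blast
  then show ?thesis
    unfolding tensor_mod_def pure_tensor_def
    using assms tensor_null_submodule(2)[OF xz]
    by (subst F.coset_smult, simp, simp, intro F.coset_eq) auto
qed

lemma pure_balance:
  assumes "y \<in> Obj A" "a \<in> carrier (Mor A y y)" "m \<in> carrier (BMod M y z)" "n \<in> carrier (BMod N x y)"
  shows "pure x z y (RAct M y y z m a) n = pure x z y m (LAct N x y y a n)"
proof -
  have "basis_vec R (y, RAct M y y z m a, n) \<ominus>\<^bsub>tensor_free R A M N x z\<^esub>
      basis_vec R (y, m, LAct N x y y a n) \<in> tensor_rels R A M N x z"
    unfolding tensor_rels_def Let_def using assms by blast
  then show ?thesis
    unfolding tensor_mod_def pure_tensor_def
    using assms tensor_null_submodule(2)[OF xz] M.RAct_closed N.LAct_closed xz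
    by (intro F.coset_eq) auto
qed

lemma pure_balanced: "balanced R A M N x z (T x z) (pure x z)"
  by (intro balancedI bilinear_mapI linear_mapsI)
     (simp_all add: pure_closed pure_add_left pure_add_right pure_smult_left pure_smult_right pure_balance)

text \<open>The universal property. The free extension of \<open>\<phi>\<close> kills every
  relation; its kernel is a submodule and therefore contains the hull, so the extension is constant
  on cosets.\<close>

lemma tensor_lift_balanced:
  assumes P: "module R P" and \<phi>: "balanced R A M N x z P \<phi>"
  shows tensor_lift_linear: "tensor_lift R P \<phi> \<in> linear_maps R (T x z) P"
    and tensor_lift_pure: "\<lbrakk>y \<in> Obj A; m \<in> carrier (BMod M y z); n \<in> carrier (BMod N x y)\<rbrakk>
      \<Longrightarrow> tensor_lift R P \<phi> (pure x z y m n) = \<phi> y m n"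
proof -
  interpret P: module R P by fact
  let ?F = "tensor_free R A M N x z"
  let ?h = "lin_ext R P (\<lambda>(y, m, n). \<phi> y m n)"
  have h: "?h \<in> linear_maps R ?F P"
    unfolding tensor_free_def
    by (rule M.lin_ext_linear[OF P]) (auto intro: bilinear_map_closed[OF balanced_bilinear[OF \<phi>]])
  have hb: "?h (basis_vec R (y, m, n)) = \<phi> y m n"
    if "y \<in> Obj A" "m \<in> carrier (BMod M y z)" "n \<in> carrier (BMod N x y)" for y m n
    using bilinear_map_closed[OF balanced_bilinear[OF \<phi>]] that
    by (subst M.lin_ext_basis_vec[OF P]) auto
  note cl = bilinear_map_closed[OF balanced_bilinear[OF \<phi>]]
  have null: "?h w = \<zero>\<^bsub>P\<^esub>" if "w \<in> tensor_null R A M N x z" for w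
  proof -
    \<comment> \<open>Every relation is a difference, so it suffices that the extension agrees on
      the two sides.\<close>
    have eq: "u \<ominus>\<^bsub>?F\<^esub> v \<in> {w \<in> carrier ?F. ?h w = \<zero>\<^bsub>P\<^esub>}"
      if "u \<in> carrier ?F" "v \<in> carrier ?F" "?h u = ?h v" for u v
      using that linear_map_a_minus[OF tensor_free_module P h, of u v] linear_map_closed[OF h]
      by (simp add: P.r_neg a_minus_def)
    have "tensor_rels R A M N x z \<subseteq> {w \<in> carrier ?F. ?h w = \<zero>\<^bsub>P\<^esub>}"
    proof -
      note closed = module_a_closed[OF M.BMod_module] module_a_closed[OF N.BMod_module]
        module.smult_closed[OF M.BMod_module] module.smult_closed[OF N.BMod_module]
        M.RAct_closed N.LAct_closed
      note add = linear_map_add[OF bilinear_map_left[OF balanced_bilinear[OF \<phi>]]]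
        linear_map_add[OF bilinear_map_right[OF balanced_bilinear[OF \<phi>]]]
        linear_map_smult[OF bilinear_map_left[OF balanced_bilinear[OF \<phi>]]]
        linear_map_smult[OF bilinear_map_right[OF balanced_bilinear[OF \<phi>]]]
        balanced_balance[OF \<phi>]
      show ?thesis
        unfolding tensor_rels_def Let_def
        by (intro Un_least subsetI; elim CollectE exE conjE; hypsubst; intro eq)
           (simp_all add: xz closed hb add linear_map_add[OF h] linear_map_smult[OF h])
    qed
    then have "tensor_null R A M N x z \<subseteq> {w \<in> carrier ?F. ?h w = \<zero>\<^bsub>P\<^esub>}"
      unfolding tensor_null_def
      by (intro hull_minimal linear_map_kernel_submodule[OF tensor_free_module P h])
    then show ?thesis using that by blast
  qed
  have lift: "tensor_lift R P \<phi> (tensor_null R A M N x z +>\<^bsub>?F\<^esub> v) = ?h v" if v: "v \<in> carrier ?F" for v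
    unfolding tensor_lift_def
    by (rule F.linear_map_const_on_coset[OF P h null v someI[where P = "\<lambda>w. w \<in> _"]])
       (use F.sub.a_rcos_self v in blast)+
  show "tensor_lift R P \<phi> (pure x z y m n) = \<phi> y m n"
    if "y \<in> Obj A" "m \<in> carrier (BMod M y z)" "n \<in> carrier (BMod N x y)"
    unfolding pure_tensor_def using that by (simp add: lift hb)
  show "tensor_lift R P \<phi> \<in> linear_maps R (T x z) P"
    unfolding tensor_mod_def
  proof (rule linear_mapsI)
    fix s assume "s \<in> carrier F.Q"
    then obtain v where v: "v \<in> carrier ?F" "s = tensor_null R A M N x z +>\<^bsub>?F\<^esub> v" by (rule F.coset_carrierE)
    show "tensor_lift R P \<phi> s \<in> carrier P" using v linear_map_closed[OF h] by (simp add: lift)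
    show "tensor_lift R P \<phi> (a \<odot>\<^bsub>F.Q\<^esub> s) = a \<odot>\<^bsub>P\<^esub> tensor_lift R P \<phi> s" if "a \<in> carrier R" for a
      using v that by (simp add: F.coset_smult lift linear_map_smult[OF h] del: quot_module_sel)
    fix t assume "t \<in> carrier F.Q"
    then obtain w where w: "w \<in> carrier ?F" "t = tensor_null R A M N x z +>\<^bsub>?F\<^esub> w" by (rule F.coset_carrierE)
    show "tensor_lift R P \<phi> (s \<oplus>\<^bsub>F.Q\<^esub> t) = tensor_lift R P \<phi> s \<oplus>\<^bsub>P\<^esub> tensor_lift R P \<phi> t"
      using v w by (simp add: F.coset_add lift linear_map_add[OF h] del: quot_module_sel)
  qed
qed

text \<open>A scalar is absorbed into the left factor of a pure tensor, so sums of pure tensors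
  exhaust the module.\<close>

lemma tensor_induct [consumes 1, case_names zero add]:
  assumes t: "t \<in> carrier (T x z)"
    and zero: "Q \<zero>\<^bsub>T x z\<^esub>"
    and add: "\<And>y m n t. \<lbrakk>y \<in> Obj A; m \<in> carrier (BMod M y z); n \<in> carrier (BMod N x y);
      t \<in> carrier (T x z); Q t\<rbrakk> \<Longrightarrow> Q (pure x z y m n \<oplus>\<^bsub>T x z\<^esub> t)"
  shows "Q t"
proof -
  let ?F = "tensor_free R A M N x z"
  obtain v where v: "v \<in> carrier ?F" "t = tensor_null R A M N x z +>\<^bsub>?F\<^esub> v"
    using t unfolding tensor_mod_def by (rule F.coset_carrierE)
  have "Q (tensor_null R A M N x z +>\<^bsub>?F\<^esub> v)"
    using v(1) unfolding tensor_free_def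
  proof (induction rule: M.free_module_induct)
    case zero
    then show ?case
      using assms(2) F.coset_zero unfolding tensor_mod_def tensor_free_def by simp
  next
    case (add a i v)
    obtain y m n where i: "i = (y, m, n)" by (cases i)
    then have ymn: "y \<in> Obj A" "m \<in> carrier (BMod M y z)" "n \<in> carrier (BMod N x y)"
      using add(2) by auto
    have am: "a \<odot>\<^bsub>BMod M y z\<^esub> m \<in> carrier (BMod M y z)"
      using add(1) ymn xz by (intro module.smult_closed[OF M.BMod_module])
    have v: "v \<in> carrier ?F" using add(3) unfolding tensor_free_def .
    have "tensor_null R A M N x z +>\<^bsub>?F\<^esub> (a \<odot>\<^bsub>?F\<^esub> basis_vec R i \<oplus>\<^bsub>?F\<^esub> v) =
        a \<odot>\<^bsub>T x z\<^esub> pure x z y m n \<oplus>\<^bsub>T x z\<^esub> (tensor_null R A M N x z +>\<^bsub>?F\<^esub> v)"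
      unfolding tensor_mod_def pure_tensor_def i
      using ymn add(1) v by (simp add: F.coset_add F.coset_smult del: quot_module_sel)
    also have "\<dots> = pure x z y (a \<odot>\<^bsub>BMod M y z\<^esub> m) n \<oplus>\<^bsub>T x z\<^esub> (tensor_null R A M N x z +>\<^bsub>?F\<^esub> v)"
      using ymn add(1) by (simp add: pure_smult_left)
    finally show ?case
      using assms(3)[OF ymn(1) am ymn(3) _ add(4)[folded tensor_free_def]] F.coset_closed[OF v]
      unfolding tensor_free_def[symmetric] tensor_mod_def by simp
  qed
  then show ?thesis using v by simp
qed

lemma tensor_ext:
  assumes "module R P" "h \<in> linear_maps R (T x z) P" "k \<in> linear_maps R (T x z) P"
    and "\<And>y m n. \<lbrakk>y \<in> Obj A; m \<in> carrier (BMod M y z); n \<in> carrier (BMod N x y)\<rbrakk>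
      \<Longrightarrow> h (pure x z y m n) = k (pure x z y m n)"
    and "t \<in> carrier (T x z)"
  shows "h t = k t"
  using assms(5)
proof (induction rule: tensor_induct)
  case zero
  then show ?case
    using linear_map_zero[OF tensor_module[OF xz] assms(1)] assms(2,3) by metis
next
  case (add y m n t)
  then show ?case
    using assms(4) pure_closed by (simp add: linear_map_add[OF assms(2)] linear_map_add[OF assms(3)])
qed

end

end

text \<open>Linearity in a parameter spreads from pure tensors to all tensors, since sums of linear
  maps are linear. It provides one half of bilinearity for actions and associators, where the other
  argument is an arbitrary tensor.\<close>

lemma (in bimodule_pair) linear_family:
  assumes "module R P" "x \<in> Obj A" "z \<in> Obj A"
    and "module R U" "\<And>u. u \<in> carrier U \<Longrightarrow> h u \<in> linear_maps R (T x z) P"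
    and "\<And>y m n. \<lbrakk>y \<in> Obj A; m \<in> carrier (BMod M y z); n \<in> carrier (BMod N x y)\<rbrakk>
      \<Longrightarrow> (\<lambda>u. h u (pure x z y m n)) \<in> linear_maps R U P"
    and "t \<in> carrier (T x z)"
  shows "(\<lambda>u. h u t) \<in> linear_maps R U P"
  using assms(7)
proof (induction rule: tensor_induct[OF assms(2,3), consumes 1, case_names zero add])
  case zero
  show ?case
    using linear_map_zero[OF tensor_module[OF assms(2,3)] assms(1) assms(5)]
    by (intro linear_maps_cong[OF linear_maps_zero[OF assms(1)] _ assms(4)]) simp
next
  case (add y m n t)
  then show ?case
    using pure_closed[OF assms(2,3)]
    by (intro linear_maps_cong[OF linear_maps_add[OF assms(1) assms(6) add(5)] _ assms(4)])
       (simp_all add: linear_map_add[OF assms(5)])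
qed

context bimodule_pair
begin

abbreviation "MN \<equiv> tensor_bimod R A M N"

lemma BMod_tensor [simp]: "BMod MN = T"
  by (simp add: tensor_bimod_def)

lemma tensor_LAct_lift:
  "LAct MN x y z a = tensor_lift R (T x z) (\<lambda>w m n. pure x z w (LAct M w y z a m) n)"
  by (simp add: tensor_bimod_def)

lemma tensor_RAct_lift:
  "RAct MN x y z t a = tensor_lift R (T x z) (\<lambda>w m n. pure x z w m (RAct N x y w n a)) t"
  by (simp add: tensor_bimod_def)

lemma tensor_LAct_balanced:
  assumes "x \<in> Obj A" "y \<in> Obj A" "z \<in> Obj A" "a \<in> carrier (Mor A y z)"
  shows "balanced R A M N x y (T x z) (\<lambda>w m n. pure x z w (LAct M w y z a m) n)"
proof (rule balancedI)
  fix w assume w: "w \<in> Obj A"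
  show "bilinear_map R (BMod M w y) (BMod N x w) (T x z) (\<lambda>m n. pure x z w (LAct M w y z a m) n)"
    using w assms
    by (intro bilinear_map_precompose[OF balanced_bilinear[OF pure_balanced] M.LAct_linear linear_maps_id])
  fix b m n assume "b \<in> carrier (Mor A w w)" "m \<in> carrier (BMod M w y)" "n \<in> carrier (BMod N x w)"
  then show "pure x z w (LAct M w y z a (RAct M w w y m b)) n =
      pure x z w (LAct M w y z a m) (LAct N x w w b n)"
    using w assms by (simp add: M.LAct_RAct[symmetric] pure_balance M.LAct_closed)
qed

lemma tensor_RAct_balanced:
  assumes "x \<in> Obj A" "y \<in> Obj A" "z \<in> Obj A" "a \<in> carrier (Mor A x y)"
  shows "balanced R A M N y z (T x z) (\<lambda>w m n. pure x z w m (RAct N x y w n a))"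
proof (rule balancedI)
  fix w assume w: "w \<in> Obj A"
  show "bilinear_map R (BMod M w z) (BMod N y w) (T x z) (\<lambda>m n. pure x z w m (RAct N x y w n a))"
    using w assms
    by (intro bilinear_map_precompose[OF balanced_bilinear[OF pure_balanced] linear_maps_id N.RAct_linear])
  fix b m n assume "b \<in> carrier (Mor A w w)" "m \<in> carrier (BMod M w z)" "n \<in> carrier (BMod N y w)"
  then show "pure x z w (RAct M w w z m b) (RAct N x y w n a) =
      pure x z w m (RAct N x y w (LAct N y w w b n) a)"
    using w assms by (simp add: N.LAct_RAct pure_balance N.RAct_closed)
qed

lemma tensor_LAct_linear:
  "\<lbrakk>x \<in> Obj A; y \<in> Obj A; z \<in> Obj A; a \<in> carrier (Mor A y z)\<rbrakk>
    \<Longrightarrow> LAct MN x y z a \<in> linear_maps R (T x y) (T x z)"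
  unfolding tensor_LAct_lift
  by (rule tensor_lift_linear[OF _ _ tensor_module tensor_LAct_balanced])

lemma tensor_LAct_pure:
  "\<lbrakk>x \<in> Obj A; y \<in> Obj A; z \<in> Obj A; a \<in> carrier (Mor A y z); w \<in> Obj A; m \<in> carrier (BMod M w y);
      n \<in> carrier (BMod N x w)\<rbrakk>
    \<Longrightarrow> LAct MN x y z a (pure x y w m n) = pure x z w (LAct M w y z a m) n"
  unfolding tensor_LAct_lift
  by (rule tensor_lift_pure[OF _ _ tensor_module tensor_LAct_balanced])

lemma tensor_RAct_linear:
  "\<lbrakk>x \<in> Obj A; y \<in> Obj A; z \<in> Obj A; a \<in> carrier (Mor A x y)\<rbrakk>
    \<Longrightarrow> (\<lambda>t. RAct MN x y z t a) \<in> linear_maps R (T y z) (T x z)"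
  unfolding tensor_RAct_lift
  by (rule tensor_lift_linear[OF _ _ tensor_module tensor_RAct_balanced])

lemma tensor_RAct_pure:
  "\<lbrakk>x \<in> Obj A; y \<in> Obj A; z \<in> Obj A; a \<in> carrier (Mor A x y); w \<in> Obj A; m \<in> carrier (BMod M w z);
      n \<in> carrier (BMod N y w)\<rbrakk>
    \<Longrightarrow> RAct MN x y z (pure y z w m n) a = pure x z w m (RAct N x y w n a)"
  unfolding tensor_RAct_lift
  by (rule tensor_lift_pure[OF _ _ tensor_module tensor_RAct_balanced])

lemma pure_linear_left:
  "\<lbrakk>x \<in> Obj A; z \<in> Obj A; y \<in> Obj A; n \<in> carrier (BMod N x y)\<rbrakk>
    \<Longrightarrow> (\<lambda>m. pure x z y m n) \<in> linear_maps R (BMod M y z) (T x z)"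
  by (rule bilinear_map_left[OF balanced_bilinear[OF pure_balanced]])

lemma pure_linear_right:
  "\<lbrakk>x \<in> Obj A; z \<in> Obj A; y \<in> Obj A; m \<in> carrier (BMod M y z)\<rbrakk>
    \<Longrightarrow> pure x z y m \<in> linear_maps R (BMod N x y) (T x z)"
  by (rule bilinear_map_right[OF balanced_bilinear[OF pure_balanced]])

text \<open>Each action touches one outer factor only. On pure tensors every axiom therefore reduces
  to one of \<open>M\<close> or \<open>N\<close>, and the two actions commute because they touch
  different factors.\<close>

lemma tensor_bimodule: "bimodule R A MN"
proof (intro bimodule.intro bimodule_axioms.intro)
  show "linear_category R A" by (rule M.linear_category_axioms)
  show "module R (BMod MN x y)" if "x \<in> Obj A" "y \<in> Obj A" for x y
    using that by (simp add: tensor_module)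
next
  fix x y z assume xyz: "x \<in> Obj A" "y \<in> Obj A" "z \<in> Obj A"
  show "bilinear_map R (Mor A y z) (BMod MN x y) (BMod MN x z) (LAct MN x y z)"
  proof (rule bilinear_mapI)
    fix t assume "t \<in> carrier (BMod MN x y)"
    then have t: "t \<in> carrier (T x y)" by simp
    have *: "(\<lambda>a. LAct MN x y z a (pure x y w m n)) \<in> linear_maps R (Mor A y z) (T x z)"
      if "w \<in> Obj A" "m \<in> carrier (BMod M w y)" "n \<in> carrier (BMod N x w)" for w m n
      by (rule linear_maps_cong[OF linear_maps_compose[OF
            bilinear_map_left[OF M.LAct_bilinear] pure_linear_left] _ M.Mor_module])
         (use that xyz in \<open>simp_all add: tensor_LAct_pure\<close>)
    show "(\<lambda>a. LAct MN x y z a t) \<in> linear_maps R (Mor A y z) (BMod MN x z)"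
      unfolding BMod_tensor
      by (rule linear_family[OF tensor_module[OF xyz(1,3)] xyz(1,2) M.Mor_module[OF xyz(2,3)]
            tensor_LAct_linear[OF xyz] * t])
  qed (use xyz in \<open>simp add: tensor_LAct_linear\<close>)
  show "bilinear_map R (BMod MN y z) (Mor A x y) (BMod MN x z) (RAct MN x y z)"
  proof (rule bilinear_mapI)
    fix t assume "t \<in> carrier (BMod MN y z)"
    then have t: "t \<in> carrier (T y z)" by simp
    have *: "(\<lambda>a. RAct MN x y z (pure y z w m n) a) \<in> linear_maps R (Mor A x y) (T x z)"
      if "w \<in> Obj A" "m \<in> carrier (BMod M w z)" "n \<in> carrier (BMod N y w)" for w m n
      by (rule linear_maps_cong[OF linear_maps_compose[OF
            bilinear_map_right[OF N.RAct_bilinear] pure_linear_right] _ M.Mor_module])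
         (use that xyz in \<open>simp_all add: tensor_RAct_pure\<close>)
    show "RAct MN x y z t \<in> linear_maps R (Mor A x y) (BMod MN x z)"
      unfolding BMod_tensor
      by (rule linear_family[where h = "\<lambda>a t. RAct MN x y z t a", OF tensor_module[OF xyz(1,3)]
            xyz(2,3) M.Mor_module[OF xyz(1,2)] tensor_RAct_linear[OF xyz] * t])
  qed (use xyz in \<open>simp add: tensor_RAct_linear\<close>)
next
  fix w x y z a b m
  assume o: "w \<in> Obj A" "x \<in> Obj A" "y \<in> Obj A" "z \<in> Obj A"
    and ab: "a \<in> carrier (Mor A y z)" "b \<in> carrier (Mor A x y)" and "m \<in> carrier (BMod MN w x)"
  then have m: "m \<in> carrier (T w x)" by simp
  have ab': "Cmp A x y z a b \<in> carrier (Mor A x z)"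
    using o ab by (intro bilinear_map_closed[OF M.Cmp_bilinear])
  show "LAct MN w x z (Cmp A x y z a b) m = LAct MN w y z a (LAct MN w x y b m)"
    by (rule tensor_ext[OF o(1,2) tensor_module tensor_LAct_linear
          linear_maps_compose[OF tensor_LAct_linear tensor_LAct_linear] _ m])
       (use o ab ab' in \<open>simp_all add: tensor_LAct_pure M.LAct_assoc M.LAct_closed\<close>)
next
  fix w x y z m a b
  assume o: "w \<in> Obj A" "x \<in> Obj A" "y \<in> Obj A" "z \<in> Obj A"
    and "m \<in> carrier (BMod MN y z)" and ab: "a \<in> carrier (Mor A x y)" "b \<in> carrier (Mor A w x)"
  then have m: "m \<in> carrier (T y z)" by simp
  have ab': "Cmp A w x y a b \<in> carrier (Mor A w y)"
    using o ab by (intro bilinear_map_closed[OF M.Cmp_bilinear])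
  show "RAct MN w x z (RAct MN x y z m a) b = RAct MN w y z m (Cmp A w x y a b)"
    by (rule tensor_ext[OF o(3,4) tensor_module linear_maps_compose[OF tensor_RAct_linear tensor_RAct_linear]
          tensor_RAct_linear _ m])
       (use o ab ab' in \<open>simp_all add: tensor_RAct_pure N.RAct_assoc N.RAct_closed\<close>)
next
  fix w x y z a m b
  assume o: "w \<in> Obj A" "x \<in> Obj A" "y \<in> Obj A" "z \<in> Obj A"
    and ab: "a \<in> carrier (Mor A y z)" and "m \<in> carrier (BMod MN x y)" and b: "b \<in> carrier (Mor A w x)"
  then have m: "m \<in> carrier (T x y)" by simp
  show "RAct MN w x z (LAct MN x y z a m) b = LAct MN w y z a (RAct MN w x y m b)"
    by (rule tensor_ext[OF o(2,3) tensor_module linear_maps_compose[OF tensor_LAct_linear tensor_RAct_linear]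
          linear_maps_compose[OF tensor_RAct_linear tensor_LAct_linear] _ m])
       (use o ab b in \<open>simp_all add: tensor_RAct_pure tensor_LAct_pure M.LAct_closed N.RAct_closed\<close>)
next
  fix x y m
  assume o: "x \<in> Obj A" "y \<in> Obj A" and "m \<in> carrier (BMod MN x y)"
  then have m: "m \<in> carrier (T x y)" by simp
  show "LAct MN x y y (Ident A y) m = m"
    by (rule tensor_ext[OF o tensor_module tensor_LAct_linear linear_maps_id _ m])
       (use o in \<open>simp_all add: tensor_LAct_pure M.LAct_Ident M.Ident_closed\<close>)
  show "RAct MN x x y m (Ident A x) = m"
    by (rule tensor_ext[OF o tensor_module tensor_RAct_linear linear_maps_id _ m])
       (use o in \<open>simp_all add: tensor_RAct_pure N.RAct_Ident M.Ident_closed\<close>)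
qed

end

section \<open>Bimodule maps, their tensor products, and the unitors\<close>

lemma bimod_mapI:
  assumes "\<And>x y. \<lbrakk>x \<in> Obj A; y \<in> Obj A\<rbrakk> \<Longrightarrow> \<phi> x y \<in> linear_maps R (BMod M x y) (BMod N x y)"
    and "\<And>x y z a m. \<lbrakk>x \<in> Obj A; y \<in> Obj A; z \<in> Obj A; a \<in> carrier (Mor A y z); m \<in> carrier (BMod M x y)\<rbrakk>
      \<Longrightarrow> \<phi> x z (LAct M x y z a m) = LAct N x y z a (\<phi> x y m)"
    and "\<And>x y z m a. \<lbrakk>x \<in> Obj A; y \<in> Obj A; z \<in> Obj A; m \<in> carrier (BMod M y z); a \<in> carrier (Mor A x y)\<rbrakk>
      \<Longrightarrow> \<phi> x z (RAct M x y z m a) = RAct N x y z (\<phi> y z m) a"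
  shows "bimod_map R A M N \<phi>"
  using assms unfolding bimod_map_def by blast

lemma bimod_map_linear:
  "\<lbrakk>bimod_map R A M N \<phi>; x \<in> Obj A; y \<in> Obj A\<rbrakk> \<Longrightarrow> \<phi> x y \<in> linear_maps R (BMod M x y) (BMod N x y)"
  unfolding bimod_map_def by blast

lemma bimod_map_LAct:
  "\<lbrakk>bimod_map R A M N \<phi>; x \<in> Obj A; y \<in> Obj A; z \<in> Obj A; a \<in> carrier (Mor A y z);
    m \<in> carrier (BMod M x y)\<rbrakk> \<Longrightarrow> \<phi> x z (LAct M x y z a m) = LAct N x y z a (\<phi> x y m)"
  unfolding bimod_map_def by blast

lemma bimod_map_RAct:
  "\<lbrakk>bimod_map R A M N \<phi>; x \<in> Obj A; y \<in> Obj A; z \<in> Obj A; m \<in> carrier (BMod M y z);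
    a \<in> carrier (Mor A x y)\<rbrakk> \<Longrightarrow> \<phi> x z (RAct M x y z m a) = RAct N x y z (\<phi> y z m) a"
  unfolding bimod_map_def by blast

lemma bimod_map_id: "bimod_map R A M M (\<lambda>_ _ m. m)"
  by (rule bimod_mapI) (simp_all add: linear_maps_id)

lemma tensor_map_bimod_maps:
  assumes "bimodule_pair R A M N" "bimodule_pair R A L J"
    and \<phi>: "bimod_map R A L M \<phi>" and \<psi>: "bimod_map R A J N \<psi>"
    and xz: "x \<in> Obj A" "z \<in> Obj A"
  shows tensor_map_linear: "tensor_map R A M N \<phi> \<psi> x z \<in> linear_maps R (tensor_mod R A L J x z) (tensor_mod R A M N x z)"
    and tensor_map_pure: "\<lbrakk>y \<in> Obj A; l \<in> carrier (BMod L y z); j \<in> carrier (BMod J x y)\<rbrakk>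
      \<Longrightarrow> tensor_map R A M N \<phi> \<psi> x z (pure_tensor R A L J x z y l j) = pure_tensor R A M N x z y (\<phi> y z l) (\<psi> x y j)"
proof -
  interpret MN: bimodule_pair R A M N by fact
  interpret LJ: bimodule_pair R A L J by fact
  have bal: "balanced R A L J x z (MN.T x z) (\<lambda>y m n. MN.pure x z y (\<phi> y z m) (\<psi> x y n))"
  proof (rule balancedI)
    fix y assume y: "y \<in> Obj A"
    show "bilinear_map R (BMod L y z) (BMod J x y) (MN.T x z) (\<lambda>m n. MN.pure x z y (\<phi> y z m) (\<psi> x y n))"
      by (rule bilinear_map_precompose[OF balanced_bilinear[OF MN.pure_balanced[OF xz] y]
            bimod_map_linear[OF \<phi> y xz(2)] bimod_map_linear[OF \<psi> xz(1) y]])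
    fix a m n assume "a \<in> carrier (Mor A y y)" "m \<in> carrier (BMod L y z)" "n \<in> carrier (BMod J x y)"
    then show "MN.pure x z y (\<phi> y z (RAct L y y z m a)) (\<psi> x y n) = MN.pure x z y (\<phi> y z m) (\<psi> x y (LAct J x y y a n))"
      using y xz linear_map_closed[OF bimod_map_linear[OF \<phi>]] linear_map_closed[OF bimod_map_linear[OF \<psi>]]
      by (simp add: bimod_map_LAct[OF \<psi>] bimod_map_RAct[OF \<phi>] MN.pure_balance)
  qed
  show "tensor_map R A M N \<phi> \<psi> x z \<in> linear_maps R (LJ.T x z) (MN.T x z)"
    unfolding tensor_map_def by (rule LJ.tensor_lift_linear[OF xz MN.tensor_module[OF xz] bal])
  show "tensor_map R A M N \<phi> \<psi> x z (LJ.pure x z y l j) = MN.pure x z y (\<phi> y z l) (\<psi> x y j)"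
    if "y \<in> Obj A" "l \<in> carrier (BMod L y z)" "j \<in> carrier (BMod J x y)"
    unfolding tensor_map_def by (rule LJ.tensor_lift_pure[OF xz MN.tensor_module[OF xz] bal that])
qed

context bimodule
begin

lemma regular_pair_left: "bimodule_pair R A (regular_bimod A) M"
  by (intro bimodule_pair.intro regular_bimodule bimodule_axioms)

lemma regular_pair_right: "bimodule_pair R A M (regular_bimod A)"
  by (intro bimodule_pair.intro regular_bimodule bimodule_axioms)

lemma left_unitor_balanced:
  "\<lbrakk>x \<in> Obj A; z \<in> Obj A\<rbrakk> \<Longrightarrow> balanced R A (regular_bimod A) M x z (BMod M x z) (\<lambda>y a m. LAct M x y z a m)"
  by (intro balancedI) (simp_all add: regular_bimod_def LAct_bilinear LAct_assoc)

lemma right_unitor_balanced: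
  "\<lbrakk>x \<in> Obj A; z \<in> Obj A\<rbrakk> \<Longrightarrow> balanced R A M (regular_bimod A) x z (BMod M x z) (\<lambda>y m a. RAct M x y z m a)"
  by (intro balancedI) (simp_all add: regular_bimod_def RAct_bilinear RAct_assoc)

lemma left_unitor_linear:
  "\<lbrakk>x \<in> Obj A; z \<in> Obj A\<rbrakk>
    \<Longrightarrow> left_unitor R M x z \<in> linear_maps R (tensor_mod R A (regular_bimod A) M x z) (BMod M x z)"
  unfolding left_unitor_def
  by (rule bimodule_pair.tensor_lift_linear[OF regular_pair_left _ _ BMod_module left_unitor_balanced])

lemma left_unitor_pure:
  "\<lbrakk>x \<in> Obj A; z \<in> Obj A; y \<in> Obj A; a \<in> carrier (Mor A y z); m \<in> carrier (BMod M x y)\<rbrakk>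
    \<Longrightarrow> left_unitor R M x z (pure_tensor R A (regular_bimod A) M x z y a m) = LAct M x y z a m"
  unfolding left_unitor_def
  by (subst bimodule_pair.tensor_lift_pure[OF regular_pair_left _ _ BMod_module left_unitor_balanced])
     (simp_all add: regular_bimod_def)

lemma right_unitor_linear:
  "\<lbrakk>x \<in> Obj A; z \<in> Obj A\<rbrakk>
    \<Longrightarrow> right_unitor R M x z \<in> linear_maps R (tensor_mod R A M (regular_bimod A) x z) (BMod M x z)"
  unfolding right_unitor_def
  by (rule bimodule_pair.tensor_lift_linear[OF regular_pair_right _ _ BMod_module right_unitor_balanced])

lemma right_unitor_pure:
  "\<lbrakk>x \<in> Obj A; z \<in> Obj A; y \<in> Obj A; m \<in> carrier (BMod M y z); a \<in> carrier (Mor A x y)\<rbrakk>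
    \<Longrightarrow> right_unitor R M x z (pure_tensor R A M (regular_bimod A) x z y m a) = RAct M x y z m a"
  unfolding right_unitor_def
  by (subst bimodule_pair.tensor_lift_pure[OF regular_pair_right _ _ BMod_module right_unitor_balanced])
     (simp_all add: regular_bimod_def)

end

section \<open>The associators of tensor products\<close>

locale bimodule_triple = M: bimodule R A M + N: bimodule R A N + P: bimodule R A P
  for R :: "('k, 'r) ring_scheme" (structure) and A :: "('o, 'k, 'a) lin_cat"
    and M :: "('o, 'k, 'a, 'm) bimod" and N :: "('o, 'k, 'a, 'n) bimod" and P :: "('o, 'k, 'a, 'p) bimod"
begin

sublocale MN: bimodule_pair R A M N ..
sublocale NP: bimodule_pair R A N P ..
sublocale MN_P: bimodule_pair R A "tensor_bimod R A M N" P
  by (intro bimodule_pair.intro MN.tensor_bimodule P.bimodule_axioms)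
sublocale M_NP: bimodule_pair R A M "tensor_bimod R A N P"
  by (intro bimodule_pair.intro NP.tensor_bimodule M.bimodule_axioms)

context
  fixes x z assumes xz: "x \<in> Obj A" "z \<in> Obj A"
begin

abbreviation "inner_left y m w n p \<equiv> MN_P.pure x z w (MN.pure w z y m n) p"
abbreviation "inner_right y p w m n \<equiv> M_NP.pure x z w m (NP.pure x w y n p)"

text \<open>The associators are iterated lifts; this is the inner one, with the outer factor
  \<open>m\<close> fixed. An element of the base category passes from \<open>n\<close> to
  \<open>p\<close> through the right action on the tensor product of \<open>M\<close> and
  \<open>N\<close>.\<close>

lemma inner_left_balanced:
  assumes "y \<in> Obj A" "m \<in> carrier (BMod M y z)"
  shows "balanced R A N P x y (MN_P.T x z) (inner_left y m)"
proof (rule balancedI)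
  fix w assume w: "w \<in> Obj A"
  show "bilinear_map R (BMod N w y) (BMod P x w) (MN_P.T x z) (inner_left y m w)"
    by (rule bilinear_map_precompose[OF balanced_bilinear[OF MN_P.pure_balanced[OF xz] w, unfolded MN.BMod_tensor]
          MN.pure_linear_right linear_maps_id]) (use w assms xz in auto)
  fix a n p assume a: "a \<in> carrier (Mor A w w)" "n \<in> carrier (BMod N w y)" "p \<in> carrier (BMod P x w)"
  have "MN.pure w z y m (RAct N w w y n a) = RAct MN.MN w w z (MN.pure w z y m n) a"
    using w xz assms a by (simp add: MN.tensor_RAct_pure)
  then show "inner_left y m w (RAct N w w y n a) p = inner_left y m w n (LAct P x w w a p)"
    using w xz assms a by (simp add: MN_P.pure_balance MN.pure_closed)
qed

lemma inner_right_balanced: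
  assumes "y \<in> Obj A" "p \<in> carrier (BMod P x y)"
  shows "balanced R A M N y z (M_NP.T x z) (inner_right y p)"
proof (rule balancedI)
  fix w assume w: "w \<in> Obj A"
  show "bilinear_map R (BMod M w z) (BMod N y w) (M_NP.T x z) (inner_right y p w)"
    by (rule bilinear_map_precompose[OF balanced_bilinear[OF M_NP.pure_balanced[OF xz] w, unfolded NP.BMod_tensor]
          linear_maps_id NP.pure_linear_left]) (use w assms xz in auto)
  fix a m n assume a: "a \<in> carrier (Mor A w w)" "m \<in> carrier (BMod M w z)" "n \<in> carrier (BMod N y w)"
  have "NP.pure x w y (LAct N y w w a n) p = LAct NP.MN x w w a (NP.pure x w y n p)"
    using w xz assms a by (simp add: NP.tensor_LAct_pure)
  then show "inner_right y p w (RAct M w w z m a) n = inner_right y p w m (LAct N y w w a n)"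
    using w xz assms a by (simp add: M_NP.pure_balance NP.pure_closed)
qed

text \<open>The outer lift. Its second argument \<open>s\<close> is an arbitrary tensor, so
  linearity in \<open>m\<close> comes from \<open>linear_family\<close> and balance from
  \<open>tensor_ext\<close>.\<close>

lemma assoc_left_balanced:
  "balanced R A M (tensor_bimod R A N P) x z (MN_P.T x z)
     (\<lambda>y m. tensor_lift R (MN_P.T x z) (inner_left y m))"
proof (rule balancedI)
  note T = MN_P.tensor_module[OF xz]
  note lin = NP.tensor_lift_linear[OF xz(1) _ T inner_left_balanced]
  note pur = NP.tensor_lift_pure[OF xz(1) _ T inner_left_balanced]
  fix y assume y: "y \<in> Obj A"
  show "bilinear_map R (BMod M y z) (BMod NP.MN x y) (MN_P.T x z)
      (\<lambda>m. tensor_lift R (MN_P.T x z) (inner_left y m))"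
  proof (rule bilinear_mapI)
    fix m assume "m \<in> carrier (BMod M y z)"
    then show "tensor_lift R (MN_P.T x z) (inner_left y m) \<in> linear_maps R (BMod NP.MN x y) (MN_P.T x z)"
      using lin y by simp
  next
    fix s assume "s \<in> carrier (BMod NP.MN x y)"
    then have s: "s \<in> carrier (NP.T x y)" by simp
    have *: "(\<lambda>m. tensor_lift R (MN_P.T x z) (inner_left y m) (NP.pure x y w n p)) \<in>
        linear_maps R (BMod M y z) (MN_P.T x z)"
      if wnp: "w \<in> Obj A" "n \<in> carrier (BMod N w y)" "p \<in> carrier (BMod P x w)" for w n p
      by (rule linear_maps_cong[OF linear_maps_compose[OF MN.pure_linear_left
              MN_P.pure_linear_left[unfolded MN.BMod_tensor]] _ M.BMod_module])
         (use y xz wnp in \<open>simp_all add: pur\<close>)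
    show "(\<lambda>m. tensor_lift R (MN_P.T x z) (inner_left y m) s) \<in> linear_maps R (BMod M y z) (MN_P.T x z)"
      by (rule NP.linear_family[OF T xz(1) y M.BMod_module[OF y xz(2)] lin[OF y y] * s])
  qed
  fix a m s assume a: "a \<in> carrier (Mor A y y)" and m: "m \<in> carrier (BMod M y z)"
    and "s \<in> carrier (BMod NP.MN x y)"
  then have s: "s \<in> carrier (NP.T x y)" by simp
  have ma: "RAct M y y z m a \<in> carrier (BMod M y z)" using a m y xz M.RAct_closed by blast
  show "tensor_lift R (MN_P.T x z) (inner_left y (RAct M y y z m a)) s =
      tensor_lift R (MN_P.T x z) (inner_left y m) (LAct NP.MN x y y a s)"
    by (rule NP.tensor_ext[OF xz(1) y T lin[OF y y ma]
          linear_maps_compose[OF NP.tensor_LAct_linear[OF xz(1) y y a] lin[OF y y m]] _ s])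
       (use y xz a m ma in \<open>simp_all add: pur NP.tensor_LAct_pure N.LAct_closed MN.pure_balance\<close>)
qed

lemma assoc_right_balanced:
  "balanced R A (tensor_bimod R A M N) P x z (M_NP.T x z)
     (\<lambda>y s p. tensor_lift R (M_NP.T x z) (inner_right y p) s)"
proof (rule balancedI)
  note T = M_NP.tensor_module[OF xz]
  note lin = MN.tensor_lift_linear[OF _ xz(2) T inner_right_balanced]
  note pur = MN.tensor_lift_pure[OF _ xz(2) T inner_right_balanced]
  fix y assume y: "y \<in> Obj A"
  show "bilinear_map R (BMod MN.MN y z) (BMod P x y) (M_NP.T x z)
      (\<lambda>s p. tensor_lift R (M_NP.T x z) (inner_right y p) s)"
  proof (rule bilinear_mapI)
    fix p assume "p \<in> carrier (BMod P x y)"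
    then show "(\<lambda>s. tensor_lift R (M_NP.T x z) (inner_right y p) s) \<in> linear_maps R (BMod MN.MN y z) (M_NP.T x z)"
      using lin y by simp
  next
    fix s assume "s \<in> carrier (BMod MN.MN y z)"
    then have s: "s \<in> carrier (MN.T y z)" by simp
    have *: "(\<lambda>p. tensor_lift R (M_NP.T x z) (inner_right y p) (MN.pure y z w m n)) \<in>
        linear_maps R (BMod P x y) (M_NP.T x z)"
      if wnp: "w \<in> Obj A" "m \<in> carrier (BMod M w z)" "n \<in> carrier (BMod N y w)" for w m n
      by (rule linear_maps_cong[OF linear_maps_compose[OF NP.pure_linear_right
              M_NP.pure_linear_right[unfolded NP.BMod_tensor]] _ P.BMod_module])
         (use y xz wnp in \<open>simp_all add: pur\<close>)
    show "(\<lambda>p. tensor_lift R (M_NP.T x z) (inner_right y p) s) \<in> linear_maps R (BMod P x y) (M_NP.T x z)"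
      by (rule MN.linear_family[OF T y xz(2) P.BMod_module[OF xz(1) y] lin[OF y y] * s])
  qed
  fix a s p assume a: "a \<in> carrier (Mor A y y)" and p: "p \<in> carrier (BMod P x y)"
    and "s \<in> carrier (BMod MN.MN y z)"
  then have s: "s \<in> carrier (MN.T y z)" by simp
  have ap: "LAct P x y y a p \<in> carrier (BMod P x y)" using a p y xz P.LAct_closed by blast
  show "tensor_lift R (M_NP.T x z) (inner_right y p) (RAct MN.MN y y z s a) =
      tensor_lift R (M_NP.T x z) (inner_right y (LAct P x y y a p)) s"
    by (rule MN.tensor_ext[OF y xz(2) T
          linear_maps_compose[OF MN.tensor_RAct_linear[OF y y xz(2) a] lin[OF y y p]] lin[OF y y ap] _ s])
       (use y xz a p ap in \<open>simp_all add: pur MN.tensor_RAct_pure N.RAct_closed NP.pure_balance\<close>)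
qed

lemma assoc_left_linear: "assoc_left R A M N P x z \<in> linear_maps R (M_NP.T x z) (MN_P.T x z)"
  unfolding assoc_left_def Let_def
  by (rule M_NP.tensor_lift_linear[OF xz MN_P.tensor_module[OF xz] assoc_left_balanced])

lemma assoc_right_linear: "assoc_right R A M N P x z \<in> linear_maps R (MN_P.T x z) (M_NP.T x z)"
  unfolding assoc_right_def Let_def
  by (rule MN_P.tensor_lift_linear[OF xz M_NP.tensor_module[OF xz] assoc_right_balanced])

lemma assoc_left_pure:
  assumes "y \<in> Obj A" "m \<in> carrier (BMod M y z)" "w \<in> Obj A" "n \<in> carrier (BMod N w y)" "p \<in> carrier (BMod P x w)"
  shows "assoc_left R A M N P x z (M_NP.pure x z y m (NP.pure x y w n p)) = MN_P.pure x z w (MN.pure w z y m n) p"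
  unfolding assoc_left_def Let_def
  using assms xz
  by (simp add: M_NP.tensor_lift_pure[OF xz MN_P.tensor_module[OF xz] assoc_left_balanced] NP.pure_closed
      NP.tensor_lift_pure[OF xz(1) _ MN_P.tensor_module[OF xz] inner_left_balanced])

lemma assoc_right_pure:
  assumes "y \<in> Obj A" "p \<in> carrier (BMod P x y)" "w \<in> Obj A" "m \<in> carrier (BMod M w z)" "n \<in> carrier (BMod N y w)"
  shows "assoc_right R A M N P x z (MN_P.pure x z y (MN.pure y z w m n) p) = M_NP.pure x z w m (NP.pure x w y n p)"
  unfolding assoc_right_def Let_def
  using assms xz
  by (simp add: MN_P.tensor_lift_pure[OF xz M_NP.tensor_module[OF xz] assoc_right_balanced] MN.pure_closed
      MN.tensor_lift_pure[OF _ xz(2) M_NP.tensor_module[OF xz] inner_right_balanced])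

end

end

section \<open>Connected components\<close>

text \<open>The formula of \<open>stack_components\<close> for an arbitrary family of edges, so that
  stacks of three diagrams are covered as well.\<close>

definition comps :: "'v set set \<Rightarrow> 'v set set" where
  "comps E = \<Union> E // {(u, v). \<exists>e\<in>E. u \<in> e \<and> v \<in> e}\<^sup>*"

text \<open>Up to points outside the graph, these are the unions of connected components.\<close>

definition saturated :: "'v set set \<Rightarrow> 'v set \<Rightarrow> bool" where
  "saturated E S \<longleftrightarrow> (\<forall>e\<in>E. e \<inter> S \<noteq> {} \<longrightarrow> e \<subseteq> S)"

lemma saturatedD: "\<lbrakk>saturated E S; e \<in> E; x \<in> e; x \<in> S\<rbrakk> \<Longrightarrow> e \<subseteq> S"
  unfolding saturated_def by blast

lemma saturated_rtrancl:
  assumes "saturated E S" "(u, v) \<in> {(u, v). \<exists>e\<in>E. u \<in> e \<and> v \<in> e}\<^sup>*" "u \<in> S"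
  shows "v \<in> S"
  using assms(2,3) by induction (use assms(1) in \<open>auto dest: saturatedD\<close>)

text \<open>The components are the atoms of the Boolean algebra of saturated sets.\<close>

lemma comps_iff:
  "c \<in> comps E \<longleftrightarrow> c \<noteq> {} \<and> c \<subseteq> \<Union>E \<and> saturated E c \<and>
     (\<forall>S. saturated E S \<and> S \<inter> c \<noteq> {} \<longrightarrow> c \<subseteq> S)"
proof -
  let ?L = "{(u, v). \<exists>e\<in>E. u \<in> e \<and> v \<in> e}"
  have sat: "saturated E (?L\<^sup>* `` {x})" for x
    unfolding saturated_def by (auto intro: rtrancl_into_rtrancl)
  have "sym ?L" by (auto simp: sym_def)
  then have sym: "sym (?L\<^sup>*)" by (rule sym_rtrancl)
  have sub: "?L\<^sup>* `` {x} \<subseteq> \<Union>E" if "x \<in> \<Union>E" for x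
    using saturated_rtrancl[of E "\<Union>E" x] that by (auto simp: saturated_def)
  have min: "?L\<^sup>* `` {x} \<subseteq> S" if S: "saturated E S" "S \<inter> ?L\<^sup>* `` {x} \<noteq> {}" for x S
  proof -
    obtain y where y: "y \<in> S" "(x, y) \<in> ?L\<^sup>*" using S(2) by blast
    then have "x \<in> S" using saturated_rtrancl[OF S(1)] sym by (meson symD)
    then show ?thesis using saturated_rtrancl[OF S(1)] by blast
  qed
  show ?thesis
  proof
    assume "c \<in> comps E"
    then obtain x where x: "x \<in> \<Union>E" "c = ?L\<^sup>* `` {x}" unfolding comps_def by (rule quotientE)
    then show "c \<noteq> {} \<and> c \<subseteq> \<Union>E \<and> saturated E c \<and> (\<forall>S. saturated E S \<and> S \<inter> c \<noteq> {} \<longrightarrow> c \<subseteq> S)"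
      using sat[of x] sub[of x] min[of _ x] by blast
  next
    assume c: "c \<noteq> {} \<and> c \<subseteq> \<Union>E \<and> saturated E c \<and> (\<forall>S. saturated E S \<and> S \<inter> c \<noteq> {} \<longrightarrow> c \<subseteq> S)"
    then obtain x where x: "x \<in> c" by blast
    then have "c \<subseteq> ?L\<^sup>* `` {x}" using sat[of x] c by blast
    moreover have "?L\<^sup>* `` {x} \<subseteq> c" using saturated_rtrancl[of E c x] c x by blast
    ultimately have "c = ?L\<^sup>* `` {x}" by blast
    then show "c \<in> comps E" unfolding comps_def using x c by (blast intro: quotientI)
  qed
qed

lemma comps_sub: "c \<in> comps E \<Longrightarrow> c \<subseteq> \<Union>E"
  and comps_ne: "c \<in> comps E \<Longrightarrow> c \<noteq> {}"
  and comps_sat: "c \<in> comps E \<Longrightarrow> saturated E c"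
  and comps_min: "\<lbrakk>c \<in> comps E; saturated E S; S \<inter> c \<noteq> {}\<rbrakk> \<Longrightarrow> c \<subseteq> S"
  by (simp_all add: comps_iff)

lemma comps_cover: "x \<in> \<Union>E \<Longrightarrow> \<exists>c\<in>comps E. x \<in> c"
  unfolding comps_def by (blast intro: quotientI)

lemma comps_disjoint: "\<lbrakk>c \<in> comps E; d \<in> comps E; x \<in> c; x \<in> d\<rbrakk> \<Longrightarrow> c = d"
  using comps_min[of c E d] comps_min[of d E c] comps_sat by blast

lemma Union_comps: "\<Union>(comps E) = \<Union>E"
proof
  show "\<Union>(comps E) \<subseteq> \<Union>E" by (rule Union_least) (rule comps_sub)
  show "\<Union>E \<subseteq> \<Union>(comps E)" by (rule subsetI, drule comps_cover) blast
qed

lemma saturated_mono: "saturated E S \<Longrightarrow> E' \<subseteq> E \<Longrightarrow> saturated E' S"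
  unfolding saturated_def by blast

text \<open>
  In a stack of three diagrams this contracts two neighbours to their composite: \<open>E1\<close> consists of
  their edges, and \<open>K\<close> of the middle points between them.
\<close>

lemma comps_contract:
  assumes K: "K \<inter> \<Union>E2 = {}"
  shows "comps ({c - K | c. c \<in> comps E1 \<and> \<not> c \<subseteq> K} \<union> E2)
    = {c - K | c. c \<in> comps (E1 \<union> E2) \<and> \<not> c \<subseteq> K}" (is "comps (?D \<union> E2) = ?R")
proof -
  let ?E = "E1 \<union> E2"
  have sat1: "saturated (?D \<union> E2) (S - K)" if S: "saturated ?E S" for S
    unfolding saturated_def
  proof (intro ballI impI)
    fix e assume e: "e \<in> ?D \<union> E2" "e \<inter> (S - K) \<noteq> {}"
    have S1: "saturated E1 S" using S by (rule saturated_mono) blast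
    from e(1) show "e \<subseteq> S - K"
    proof
      assume "e \<in> ?D"
      then obtain c where "c \<in> comps E1" "e = c - K" by blast
      then show ?thesis using comps_min[OF _ S1, of c] e(2) by blast
    next
      assume "e \<in> E2"
      then show ?thesis using S e(2) K unfolding saturated_def by blast
    qed
  qed
  \<comment> \<open>A set that is saturated after the contraction is lifted by adjoining every
    component of \<open>E1\<close> that it meets outside \<open>K\<close>; this adds only points of
    \<open>K\<close>.\<close>
  have sat2: "\<exists>S. saturated ?E S \<and> S - K = S'" if S': "saturated (?D \<union> E2) S'" "S' \<inter> K = {}" for S'
  proof -
    let ?C = "{c \<in> comps E1. (c - K) \<inter> S' \<noteq> {}}"
    let ?S = "S' \<union> \<Union>?C"
    have C: "c - K \<subseteq> S'" if c: "c \<in> ?C" for c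
    proof -
      obtain x where x: "x \<in> c - K" "x \<in> S'" using c by blast
      have "c - K \<in> ?D \<union> E2" using c by blast
      then show ?thesis using saturatedD[OF S'(1)] x by blast
    qed
    have "saturated ?E ?S"
      unfolding saturated_def
    proof (intro ballI impI)
      fix e assume e: "e \<in> ?E" "e \<inter> ?S \<noteq> {}"
      then obtain x where x: "x \<in> e" "x \<in> ?S" by blast
      from e(1) show "e \<subseteq> ?S"
      proof
        assume "e \<in> E1"
        obtain c where c: "c \<in> comps E1" "x \<in> c" using comps_cover[of x E1] x \<open>e \<in> E1\<close> by blast
        have "e \<subseteq> c" using saturatedD[OF comps_sat[OF c(1)] \<open>e \<in> E1\<close> x(1) c(2)] .
        moreover have "c \<in> ?C"
        proof (cases "x \<in> S'")
          case True
          then show ?thesis using c S'(2) by blast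
        next
          case False
          then obtain d where "d \<in> ?C" "x \<in> d" using x by blast
          then show ?thesis using comps_disjoint[of c E1 d x] c by blast
        qed
        ultimately show ?thesis by blast
      next
        assume "e \<in> E2"
        then have "x \<notin> K" using x K by blast
        then have "x \<in> S'" using x C by blast
        then show ?thesis using S'(1) \<open>e \<in> E2\<close> x unfolding saturated_def by blast
      qed
    qed
    moreover have "?S - K = S'" using S'(2) C by blast
    ultimately show ?thesis by blast
  qed
  have U: "\<Union>(?D \<union> E2) = \<Union>?E - K"
  proof -
    have "\<Union>?D = \<Union>(comps E1) - K" by blast
    then show ?thesis using K by (auto simp: Union_comps)
  qed
  have R: "c - K \<in> comps (?D \<union> E2)" if c: "c \<in> comps ?E" "\<not> c \<subseteq> K" for c
  proof (rule comps_iff[THEN iffD2], intro conjI allI impI)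
    show "c - K \<noteq> {}" using c by blast
    show "c - K \<subseteq> \<Union>(?D \<union> E2)" unfolding U using comps_sub[OF c(1)] by blast
    show "saturated (?D \<union> E2) (c - K)" using sat1 comps_sat c by blast
    fix S assume S: "saturated (?D \<union> E2) S \<and> S \<inter> (c - K) \<noteq> {}"
    \<comment> \<open>\<open>S\<close> may contain points of \<open>K\<close>, which are no vertices
      of the contracted graph. They are removed so that \<open>sat2\<close> applies.\<close>
    have "saturated (?D \<union> E2) (S - K)"
      unfolding saturated_def
    proof (intro ballI impI)
      fix e assume e: "e \<in> ?D \<union> E2" "e \<inter> (S - K) \<noteq> {}"
      then obtain x where "x \<in> e" "x \<in> S" by blast
      then have "e \<subseteq> S" using saturatedD[OF conjunct1[OF S] e(1)] by blast
      moreover have "e \<inter> K = {}" using e(1)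
      proof
        assume "e \<in> E2"
        then show ?thesis using K by blast
      qed blast
      ultimately show "e \<subseteq> S - K" by blast
    qed
    moreover have "(S - K) \<inter> K = {}" by blast
    ultimately have "\<exists>S'. saturated ?E S' \<and> S' - K = S - K" by (rule sat2)
    then obtain S' where S': "saturated ?E S'" "S' - K = S - K" by (elim exE conjE)
    have "S' \<inter> c \<noteq> {}" using S S'(2) by blast
    then have "c \<subseteq> S'" by (rule comps_min[OF c(1) S'(1)])
    then show "c - K \<subseteq> S" using S'(2) by blast
  qed
  show ?thesis
  proof
    show "?R \<subseteq> comps (?D \<union> E2)" using R by blast
    show "comps (?D \<union> E2) \<subseteq> ?R"
    proof
      fix d assume d: "d \<in> comps (?D \<union> E2)"
      then obtain x where x: "x \<in> d" "x \<in> \<Union>?E" "x \<notin> K" using comps_ne comps_sub[OF d] U by blast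
      obtain c where c: "c \<in> comps ?E" "x \<in> c" using comps_cover[OF x(2)] by blast
      have nK: "\<not> c \<subseteq> K" using c x by blast
      have "d = c - K" using c x by (intro comps_disjoint[OF d R[OF c(1) nK] x(1)]) blast
      then show "d \<in> ?R" using c(1) nK by blast
    qed
  qed
qed

text \<open>\<open>E2\<close> avoids \<open>K\<close>, so a component inside \<open>K\<close> is
  built from edges of \<open>E1\<close> alone. Hence the loops of two neighbours persist unchanged
  in the triple stack.\<close>

lemma comps_contract_inside:
  assumes K: "K \<inter> \<Union>E2 = {}"
  shows "{c \<in> comps (E1 \<union> E2). c \<subseteq> K} = {c \<in> comps E1. c \<subseteq> K}"
proof (intro equalityI subsetI)
  fix c assume "c \<in> {c \<in> comps (E1 \<union> E2). c \<subseteq> K}"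
  then have c: "c \<in> comps (E1 \<union> E2)" "c \<subseteq> K" by auto
  have "c \<in> comps E1"
    unfolding comps_iff
  proof (intro conjI allI impI)
    show "c \<noteq> {}" "c \<subseteq> \<Union>E1" using comps_ne[OF c(1)] comps_sub[OF c(1)] c(2) K by blast+
    show sat: "saturated E1 c" using comps_sat[OF c(1)] by (rule saturated_mono) blast
    fix S assume S: "saturated E1 S \<and> S \<inter> c \<noteq> {}"
    have "saturated (E1 \<union> E2) (S \<inter> c)"
      unfolding saturated_def
    proof (intro ballI impI)
      fix e assume e: "e \<in> E1 \<union> E2" "e \<inter> (S \<inter> c) \<noteq> {}"
      then obtain x where x: "x \<in> e" "x \<in> S" "x \<in> c" by blast
      then have "e \<in> E1" using e(1) c(2) K by blast
      then show "e \<subseteq> S \<inter> c"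
        using saturatedD[OF conjunct1[OF S] _ x(1,2)] saturatedD[OF sat _ x(1,3)] by blast
    qed
    moreover have "S \<inter> c \<inter> c \<noteq> {}" using S by blast
    ultimately show "c \<subseteq> S" using comps_min[OF c(1)] by blast
  qed
  then show "c \<in> {c \<in> comps E1. c \<subseteq> K}" using c by blast
next
  fix c assume "c \<in> {c \<in> comps E1. c \<subseteq> K}"
  then have c: "c \<in> comps E1" "c \<subseteq> K" by auto
  have "c \<in> comps (E1 \<union> E2)"
    unfolding comps_iff
  proof (intro conjI allI impI)
    show "c \<noteq> {}" "c \<subseteq> \<Union>(E1 \<union> E2)" using comps_ne[OF c(1)] comps_sub[OF c(1)] by blast+
    show "saturated (E1 \<union> E2) c"
      unfolding saturated_def
    proof (intro ballI impI)
      fix e assume e: "e \<in> E1 \<union> E2" "e \<inter> c \<noteq> {}"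
      then obtain x where x: "x \<in> e" "x \<in> c" by blast
      then have "e \<in> E1" using e(1) c(2) K by blast
      then show "e \<subseteq> c" by (rule saturatedD[OF comps_sat[OF c(1)] _ x])
    qed
    fix S assume S: "saturated (E1 \<union> E2) S \<and> S \<inter> c \<noteq> {}"
    then have "saturated E1 S" by (auto intro: saturated_mono)
    then show "c \<subseteq> S" using comps_min[OF c(1)] S by blast
  qed
  then show "c \<in> {c \<in> comps (E1 \<union> E2). c \<subseteq> K}" using c by blast
qed

text \<open>A set is saturated for the renamed edges exactly if its preimage is saturated for the
  original ones.\<close>

lemma comps_image:
  assumes "inj \<phi>"
  shows "comps ((`) \<phi> ` E) = (`) \<phi> ` comps E"
proof -
  have sat: "saturated ((`) \<phi> ` E) S \<longleftrightarrow> saturated E (\<phi> -` S)" for S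
    unfolding saturated_def by fastforce
  have im: "\<phi> ` c \<in> comps ((`) \<phi> ` E)" if c: "c \<in> comps E" for c
    unfolding comps_iff sat
    using comps_ne[OF c] comps_sub[OF c] comps_sat[OF c] comps_min[OF c] assms
    by (auto simp: inj_vimage_image_eq) blast+
  show ?thesis
  proof
    show "(`) \<phi> ` comps E \<subseteq> comps ((`) \<phi> ` E)" using im by blast
    show "comps ((`) \<phi> ` E) \<subseteq> (`) \<phi> ` comps E"
    proof
      fix d assume d: "d \<in> comps ((`) \<phi> ` E)"
      then obtain x where x: "\<phi> x \<in> d" "x \<in> \<Union>E" using comps_ne[OF d] comps_sub[OF d] by blast
      obtain c where c: "c \<in> comps E" "x \<in> c" using comps_cover[OF x(2)] by blast
      then have "d = \<phi> ` c" using comps_disjoint[OF d im[OF c(1)] x(1)] by blast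
      then show "d \<in> (`) \<phi> ` comps E" using c by blast
    qed
  qed
qed

text \<open>A subset of \<open>c\<close> is grown vertex by vertex. As long as it is not all of
  \<open>c\<close> it is not saturated, so some edge leaves it; the outer end of that edge brings
  one vertex and at least one new inner edge.\<close>

lemma card_comp_le:
  assumes E: "finite E" "\<And>e. e \<in> E \<Longrightarrow> card e = 2" and c: "c \<in> comps E" "finite c"
  shows "card c \<le> card {e \<in> E. e \<subseteq> c} + 1"
proof -
  have "\<exists>S\<subseteq>c. card S = n \<and> n \<le> card {e \<in> E. e \<subseteq> S} + 1" if "1 \<le> n" "n \<le> card c" for n
    using that
  proof (induction n rule: dec_induct)
    case base
    obtain x where "x \<in> c" using comps_ne[OF c(1)] by blast
    then show ?case by (intro exI[of _ "{x}"]) simp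
  next
    case (step n)
    then obtain S where S: "S \<subseteq> c" "card S = n" "n \<le> card {e \<in> E. e \<subseteq> S} + 1" by auto
    then have ne: "S \<noteq> {}" "\<not> c \<subseteq> S" using step by (auto dest: card_mono[OF finite_subset[OF S(1) c(2)]])
    then have "\<not> saturated E S" using comps_min[OF c(1)] S(1) by blast
    then obtain e where e: "e \<in> E" "e \<inter> S \<noteq> {}" "\<not> e \<subseteq> S" unfolding saturated_def by blast
    then obtain u v where uv: "e = {u, v}" "u \<in> S" "v \<notin> S"
      using E(2)[OF e(1)] by (auto simp: card_2_iff)
    have v: "v \<in> c" using saturatedD[OF comps_sat[OF c(1)] e(1), of u] uv S(1) by blast
    have "{e \<in> E. e \<subseteq> S} \<subset> {e \<in> E. e \<subseteq> insert v S}" using e uv by blast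
    then have "card {e \<in> E. e \<subseteq> S} < card {e \<in> E. e \<subseteq> insert v S}"
      using E(1) by (intro psubset_card_mono) auto
    moreover have "card (insert v S) = Suc n" using S uv finite_subset[OF S(1) c(2)] by simp
    ultimately show ?case using S v by (intro exI[of _ "insert v S"]) auto
  qed
  from this[of "card c"] obtain S where "S \<subseteq> c" "card S = card c" "card c \<le> card {e \<in> E. e \<subseteq> S} + 1"
    using comps_ne[OF c(1)] c(2) by (auto simp: card_gt_0_iff Suc_le_eq)
  moreover then have "S = c" using c(2) by (metis card_subset_eq)
  ultimately show ?thesis by simp
qed

text \<open>A saturated set contains every pair that it meets, so the pairs inside \<open>c\<close>
  cover \<open>c \<inter> A\<close> exactly.\<close>

lemma card_pairs_in:
  assumes "finite A" "partition_on A E" "\<And>e. e \<in> E \<Longrightarrow> card e = 2" "saturated E c"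
  shows "card (c \<inter> A) = 2 * card {e \<in> E. e \<subseteq> c}"
proof -
  have "c \<inter> A = \<Union>{e \<in> E. e \<subseteq> c}"
  proof (intro equalityI subsetI)
    fix x assume x: "x \<in> c \<inter> A"
    then obtain e where "e \<in> E" "x \<in> e" using assms(2) unfolding partition_on_def by blast
    then show "x \<in> \<Union>{e \<in> E. e \<subseteq> c}" using saturatedD[OF assms(4)] x by blast
  qed (use assms(2) in \<open>auto simp: partition_on_def\<close>)
  also have "card \<dots> = (\<Sum>e\<in>{e \<in> E. e \<subseteq> c}. card e)"
  proof (rule card_Union_disjoint)
    show "pairwise disjnt {e \<in> E. e \<subseteq> c}"
      using assms(2) unfolding partition_on_def disjoint_def pairwise_def disjnt_def by blast
    show "finite e" if "e \<in> {e \<in> E. e \<subseteq> c}" for e using that assms(3)[of e] card_ge_0_finite by force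
  qed
  also have "\<dots> = 2 * card {e \<in> E. e \<subseteq> c}" using assms(3) by simp
  finally show ?thesis .
qed

text \<open>
  Counting edges: a connected graph with \<open>n\<close> vertices has at least \<open>n - 1\<close> edges, while the degrees
  in the union of two perfect matchings are at most two.
\<close>

lemma card_ends_of_comp:
  assumes "finite A" "partition_on A E" "\<And>e. e \<in> E \<Longrightarrow> card e = 2"
    and "finite B" "partition_on B F" "\<And>e. e \<in> F \<Longrightarrow> card e = 2"
    and c: "c \<in> comps (E \<union> F)" "\<not> c \<subseteq> A \<inter> B"
  shows "card (c - A \<inter> B) = 2"
proof -
  have sub: "c \<subseteq> A \<union> B" using comps_sub[OF c(1)] assms(2,5) unfolding partition_on_def by blast
  have fin: "finite c" using sub assms(1,4) finite_subset by blast
  have finE: "finite E" "finite F" using assms(1,2,4,5) by (auto intro: finite_elements)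
  have "card c \<le> card {e \<in> E \<union> F. e \<subseteq> c} + 1"
    using finE assms(3,6) c(1) fin by (intro card_comp_le) auto
  also have "{e \<in> E \<union> F. e \<subseteq> c} = {e \<in> E. e \<subseteq> c} \<union> {e \<in> F. e \<subseteq> c}" by blast
  finally have le: "card c \<le> card {e \<in> E. e \<subseteq> c} + card {e \<in> F. e \<subseteq> c} + 1"
    using card_Un_le[of "{e \<in> E. e \<subseteq> c}" "{e \<in> F. e \<subseteq> c}"] by linarith
  have "saturated E c" "saturated F c" using saturated_mono[OF comps_sat[OF c(1)]] by blast+
  then have "card (c \<inter> A) = 2 * card {e \<in> E. e \<subseteq> c}" "card (c \<inter> B) = 2 * card {e \<in> F. e \<subseteq> c}"
    using card_pairs_in assms by blast+
  moreover have "card (c \<inter> A) + card (c \<inter> B) = card c + card (c \<inter> (A \<inter> B))"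
  proof -
    have "(c \<inter> A) \<union> (c \<inter> B) = c" "(c \<inter> A) \<inter> (c \<inter> B) = c \<inter> (A \<inter> B)" using sub by blast+
    then show ?thesis using card_Un_Int[of "c \<inter> A" "c \<inter> B"] fin by simp
  qed
  moreover have "card (c - A \<inter> B) + card (c \<inter> (A \<inter> B)) = card c"
    using card_Int_Diff[OF fin, of "A \<inter> B"] by simp
  moreover have "card (c - A \<inter> B) > 0" using c(2) fin by (auto simp: card_gt_0_iff)
  \<comment> \<open>Let \<open>c\<close> have n ends and m points in \<open>A \<inter> B\<close>,
    and contain a pairs of \<open>E\<close> and b pairs of \<open>F\<close>. Then 2(a + b) = n + 2m,
    so n is even, and n + m \<le> a + b + 1 gives n \<le> 2. Since n is positive, it is 2.\<close>
  ultimately show ?thesis using le by presburger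
qed

section \<open>Composition of Brauer diagrams\<close>

text \<open>
  To stack several diagrams, the points are placed on numbered levels: \<open>emb a b D\<close> is \<open>D\<close> drawn
  between the levels \<open>a\<close> and \<open>b\<close>.
\<close>

primrec lay :: "nat \<Rightarrow> nat \<Rightarrow> point \<Rightarrow> nat \<times> nat" where
  "lay a b (Top i) = (a, i)"
| "lay a b (Bot i) = (b, i)"

primrec lay3 :: "nat \<Rightarrow> nat \<Rightarrow> nat \<Rightarrow> stack_point \<Rightarrow> nat \<times> nat" where
  "lay3 a b c (Upper i) = (a, i)"
| "lay3 a b c (Middle i) = (b, i)"
| "lay3 a b c (Lower i) = (c, i)"

definition emb :: "nat \<Rightarrow> nat \<Rightarrow> diagram \<Rightarrow> (nat \<times> nat) set set" where
  "emb a b D = (`) (lay a b) ` D"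

abbreviation level :: "nat \<Rightarrow> (nat \<times> nat) set" where
  "level b \<equiv> {b} \<times> UNIV"

lemma inj_lay: "a \<noteq> b \<Longrightarrow> inj (lay a b)"
  unfolding inj_def by (intro allI, case_tac x; case_tac y) auto

lemma inj_lay3: "\<lbrakk>a \<noteq> b; a \<noteq> c; b \<noteq> c\<rbrakk> \<Longrightarrow> inj (lay3 a b c)"
  unfolding inj_def by (intro allI, case_tac x; case_tac y) auto

lemma inj_image: "inj f \<Longrightarrow> inj ((`) f)"
  by (rule injI) (simp only: inj_image_eq_iff)

lemma inj_emb: "a \<noteq> b \<Longrightarrow> inj (emb a b)"
  using inj_image[OF inj_image[OF inj_lay]] unfolding emb_def .

lemma Union_emb: "\<Union>(emb a b D) \<subseteq> level a \<union> level b"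
proof -
  have "lay a b x \<in> level a \<union> level b" for x by (cases x) auto
  then show ?thesis unfolding emb_def by blast
qed

lemma lay3_lower: "lay3 a b c (lower_part x) = lay b c x"
  and lay3_upper: "lay3 a b c (upper_part x) = lay a b x"
  by (cases x; simp)+

lemma stack_components_eq: "stack_components f g = comps (stack_edges f g)"
  unfolding stack_components_def comps_def ..

lemma stack_components_emb:
  assumes "a \<noteq> b" "a \<noteq> c" "b \<noteq> c"
  shows "comps (emb b c f \<union> emb a b g) = (`) (lay3 a b c) ` stack_components f g"
proof -
  have "(`) (lay3 a b c) ` stack_edges f g = emb b c f \<union> emb a b g"
    unfolding stack_edges_def emb_def image_Un image_image lay3_lower lay3_upper ..
  then show ?thesis
    using comps_image[OF inj_lay3[OF assms], of "stack_edges f g"] by (simp add: stack_components_eq)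
qed

lemma lay3_middle:
  assumes "a \<noteq> b" "a \<noteq> c" "b \<noteq> c"
  shows "lay3 a b c ` x \<subseteq> level b \<longleftrightarrow> x \<subseteq> range Middle"
proof -
  have "lay3 a b c p \<in> level b \<longleftrightarrow> p \<in> range Middle" for p
    using assms by (cases p) auto
  then show ?thesis by blast
qed

text \<open>The levels only have to be distinct. With levels 0, 1, 2 the stack is read downwards,
  with 2, 1, 0 upwards; comparing the two readings is how reflected composites are treated
  below.\<close>

lemma emb_diagram_comp:
  assumes "a \<noteq> b" "a \<noteq> c" "b \<noteq> c"
  shows "emb a c (diagram_comp f g) =
    {x - level b | x. x \<in> comps (emb b c f \<union> emb a b g) \<and> \<not> x \<subseteq> level b}"
proof -
  have trace: "lay a c ` ({Top i | i. Upper i \<in> x} \<union> {Bot i | i. Lower i \<in> x}) = lay3 a b c ` x - level b"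
    (is "?l = ?r") for x
  proof
    have "(a, i) \<in> ?r" if "Upper i \<in> x" for i
      using imageI[OF that, of "lay3 a b c"] assms by simp
    moreover have "(c, i) \<in> ?r" if "Lower i \<in> x" for i
      using imageI[OF that, of "lay3 a b c"] assms by simp
    ultimately show "?l \<subseteq> ?r" by auto
    show "?r \<subseteq> ?l"
    proof
      fix u assume "u \<in> ?r"
      then obtain p where p: "p \<in> x" "u = lay3 a b c p" "u \<notin> level b" by blast
      then have "(\<exists>i. p = Upper i) \<or> (\<exists>i. p = Lower i)" by (cases p) auto
      then have "\<exists>q. q \<in> {Top i | i. Upper i \<in> x} \<union> {Bot i | i. Lower i \<in> x} \<and> u = lay a c q"
        using p by auto
      then show "u \<in> ?l" by blast
    qed
  qed
  have "emb a c (diagram_comp f g) =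
      (\<lambda>x. lay3 a b c ` x - level b) ` {x \<in> stack_components f g. \<not> lay3 a b c ` x \<subseteq> level b}"
    unfolding emb_def diagram_comp_def image_image trace lay3_middle[OF assms] ..
  also have "\<dots> = {y - level b | y. y \<in> (`) (lay3 a b c) ` stack_components f g \<and> \<not> y \<subseteq> level b}"
    by blast
  finally show ?thesis unfolding stack_components_emb[OF assms] .
qed

lemma loop_count_emb:
  assumes "a \<noteq> b" "a \<noteq> c" "b \<noteq> c"
  shows "loop_count f g = card {x \<in> comps (emb b c f \<union> emb a b g). x \<subseteq> level b}"
proof -
  have "{x \<in> comps (emb b c f \<union> emb a b g). x \<subseteq> level b}
      = (`) (lay3 a b c) ` {x \<in> stack_components f g. x \<subseteq> range Middle}"
    unfolding stack_components_emb[OF assms] lay3_middle[OF assms, symmetric] by blast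
  moreover have "inj ((`) (lay3 a b c))"
    by (rule inj_image[OF inj_lay3[OF assms]])
  ultimately show ?thesis
    unfolding loop_count_def by (simp add: card_image inj_on_subset)
qed

lemma emb_disjoint_level: "\<lbrakk>c \<noteq> a; c \<noteq> b\<rbrakk> \<Longrightarrow> level c \<inter> \<Union>(emb a b D) = {}"
  using Union_emb[of a b D] by auto

lemma level_neq:
  "(0::nat) \<noteq> 1" "(0::nat) \<noteq> 2" "(0::nat) \<noteq> 3" "(1::nat) \<noteq> 2" "(1::nat) \<noteq> 3" "(2::nat) \<noteq> 3"
  "(2::nat) \<noteq> 1" "(2::nat) \<noteq> 0" "(1::nat) \<noteq> 0"
  by simp_all

text \<open>A trace is a component without its middle points, which is how a composite gets its
  blocks. Composing twice deletes two levels, and the result is the same as deleting them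
  together.\<close>

lemma traces_of_traces:
  "{y - K | y. y \<in> {c - L | c. c \<in> S \<and> \<not> c \<subseteq> L} \<and> \<not> y \<subseteq> K} = {c - (K \<union> L) | c. c \<in> S \<and> \<not> c \<subseteq> K \<union> L}"
  (is "?l = ?r")
proof (intro equalityI subsetI)
  fix z assume "z \<in> ?l"
  then obtain c where "c \<in> S" "z = c - L - K" "\<not> c - L \<subseteq> K" by blast
  moreover have "c - L - K = c - (K \<union> L)" by blast
  ultimately show "z \<in> ?r" by blast
next
  fix z assume "z \<in> ?r"
  then obtain c where "c \<in> S" "z = c - (K \<union> L)" "\<not> c \<subseteq> K \<union> L" by blast
  moreover have "c - (K \<union> L) = c - L - K" by blast
  ultimately show "z \<in> ?l" by blast
qed

text \<open>These are the loops that arise only at the second composition: components that leave the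
  level contracted first but stay on the inner levels.\<close>

lemma traces_inside:
  "{y. y \<in> {c - L | c. c \<in> S \<and> \<not> c \<subseteq> L} \<and> y \<subseteq> K} = (\<lambda>c. c - L) ` {c \<in> S. c \<subseteq> K \<union> L \<and> \<not> c \<subseteq> L}"
  by blast

text \<open>Contracting level 2 composes \<open>f\<close> with \<open>g\<close>, and contracting
  level 1 composes \<open>g\<close> with \<open>h\<close>. In both cases the third diagram avoids
  the contracted level, as \<open>comps_contract\<close> demands.\<close>

lemma stack_three:
  fixes f g h :: diagram
  defines "E \<equiv> emb 2 3 f \<union> emb 1 2 g \<union> emb 0 1 h"
  shows stack_left: "comps (emb 1 3 (diagram_comp f g) \<union> emb 0 1 h) = {c - level 2 | c. c \<in> comps E \<and> \<not> c \<subseteq> level 2}"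
    and stack_right: "comps (emb 2 3 f \<union> emb 0 2 (diagram_comp g h)) = {c - level 1 | c. c \<in> comps E \<and> \<not> c \<subseteq> level 1}"
proof -
  show "comps (emb 1 3 (diagram_comp f g) \<union> emb 0 1 h) = {c - level 2 | c. c \<in> comps E \<and> \<not> c \<subseteq> level 2}"
    unfolding emb_diagram_comp[OF level_neq(4,5,6)] E_def
    by (rule comps_contract, rule emb_disjoint_level) auto
  have E: "E = (emb 1 2 g \<union> emb 0 1 h) \<union> emb 2 3 f" unfolding E_def by blast
  show "comps (emb 2 3 f \<union> emb 0 2 (diagram_comp g h)) = {c - level 1 | c. c \<in> comps E \<and> \<not> c \<subseteq> level 1}"
    unfolding emb_diagram_comp[OF level_neq(1,2,4)] E Un_commute[of "emb 2 3 f"]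
    by (rule comps_contract, rule emb_disjoint_level) auto
qed

lemma diagram_comp_assoc: "diagram_comp (diagram_comp f g) h = diagram_comp f (diagram_comp g h)"
proof -
  have "emb 0 3 (diagram_comp (diagram_comp f g) h) = emb 0 3 (diagram_comp f (diagram_comp g h))"
    unfolding emb_diagram_comp[OF level_neq(1,3,5), of "diagram_comp f g" h]
      emb_diagram_comp[OF level_neq(2,3,6), of f "diagram_comp g h"]
      stack_left stack_right traces_of_traces Un_commute[of "level 2"] ..
  then show ?thesis using inj_emb[of 0 3] by (simp add: inj_def)
qed

text \<open>Both sides count the components of the triple stack that lie on levels 1 and 2. Those on
  the level contracted first are the loops of the inner composite, the others are the loops of the
  outer one. Finiteness makes the cardinalities add.\<close>

lemma loop_count_assoc:
  assumes fin: "finite (\<Union>f)" "finite (\<Union>g)" "finite (\<Union>h)"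
  shows "loop_count f g + loop_count (diagram_comp f g) h = loop_count g h + loop_count f (diagram_comp g h)"
proof -
  define E where "E = emb 2 3 f \<union> emb 1 2 g \<union> emb 0 1 h"
  have "finite (\<Union>(emb a b D))" if "finite (\<Union>D)" for a b D
  proof -
    have "\<Union>(emb a b D) = lay a b ` \<Union>D" unfolding emb_def by blast
    then show ?thesis using that by simp
  qed
  then have "finite (\<Union>E)" unfolding E_def using fin by simp
  moreover have "comps E \<subseteq> Pow (\<Union>E)" using comps_sub by blast
  ultimately have finE: "finite (comps E)" by (meson finite_Pow_iff finite_subset)
  \<comment> \<open>Components sharing a point outside \<open>L\<close> are equal, so deleting
    \<open>L\<close> merges none of these.\<close>
  have inj: "inj_on (\<lambda>c. c - L) {c \<in> comps E. c \<subseteq> K \<union> L \<and> \<not> c \<subseteq> L}" for K L :: "(nat \<times> nat) set"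
  proof (rule inj_onI)
    fix c d
    assume c: "c \<in> {c \<in> comps E. c \<subseteq> K \<union> L \<and> \<not> c \<subseteq> L}"
      and d: "d \<in> {c \<in> comps E. c \<subseteq> K \<union> L \<and> \<not> c \<subseteq> L}" and eq: "c - L = d - L"
    obtain x where "x \<in> c - L" using c by blast
    then have "x \<in> c" "x \<in> d" using eq by blast+
    then show "c = d" using c d by (intro comps_disjoint[of c E d x]) auto
  qed
  have split: "card {c \<in> comps E. c \<subseteq> L} + card ((\<lambda>c. c - L) ` {c \<in> comps E. c \<subseteq> K \<union> L \<and> \<not> c \<subseteq> L})
      = card {c \<in> comps E. c \<subseteq> K \<union> L}" for K L :: "(nat \<times> nat) set"
  proof -
    have "{c \<in> comps E. c \<subseteq> K \<union> L} = {c \<in> comps E. c \<subseteq> L} \<union> {c \<in> comps E. c \<subseteq> K \<union> L \<and> \<not> c \<subseteq> L}" by blast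
    then show ?thesis
      using finE by (simp only: card_image[OF inj]) (subst card_Un_disjoint, auto)
  qed
  have E: "E = (emb 1 2 g \<union> emb 0 1 h) \<union> emb 2 3 f" unfolding E_def by blast
  have "loop_count f g = card {c \<in> comps E. c \<subseteq> level 2}"
    unfolding loop_count_emb[OF level_neq(4,5,6)] E_def
    by (subst comps_contract_inside) (rule emb_disjoint_level, auto)
  moreover have "loop_count (diagram_comp f g) h =
      card ((\<lambda>c. c - level 2) ` {c \<in> comps E. c \<subseteq> level 1 \<union> level 2 \<and> \<not> c \<subseteq> level 2})"
    unfolding loop_count_emb[OF level_neq(1,3,5)] stack_left E_def[symmetric]
      traces_inside[symmetric] ..
  moreover have "loop_count g h = card {c \<in> comps E. c \<subseteq> level 1}"
    unfolding loop_count_emb[OF level_neq(1,2,4)] E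
    by (subst comps_contract_inside) (rule emb_disjoint_level, auto)
  moreover have "loop_count f (diagram_comp g h) =
      card ((\<lambda>c. c - level 1) ` {c \<in> comps E. c \<subseteq> level 2 \<union> level 1 \<and> \<not> c \<subseteq> level 1})"
    unfolding loop_count_emb[OF level_neq(2,3,6)] stack_right E_def[symmetric]
      traces_inside[symmetric] ..
  ultimately show ?thesis
    using split[of "level 2" "level 1"] split[of "level 1" "level 2"] by (simp only: Un_commute)
qed

lemma emb_flip: "emb a b (flip D) = emb b a D"
proof -
  have "lay a b (flip_point x) = lay b a x" for x by (cases x) auto
  then show ?thesis unfolding emb_def flip_def image_image by simp
qed

lemma flip_diagram_comp: "flip (diagram_comp f g) = diagram_comp (flip g) (flip f)"
proof -
  have "emb 0 2 (flip (diagram_comp f g)) = emb 0 2 (diagram_comp (flip g) (flip f))"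
    unfolding emb_flip emb_diagram_comp[OF level_neq(1,2,4), of "flip g" "flip f"]
      emb_diagram_comp[OF level_neq(7,8,9), of f g]
    by (simp only: Un_commute)
  then show ?thesis using inj_emb[of 0 2] by (simp add: inj_def)
qed

lemma loop_count_flip: "loop_count (flip g) (flip f) = loop_count f g"
  unfolding loop_count_emb[OF level_neq(1,2,4), of "flip g"] loop_count_emb[OF level_neq(7,8,9), of f] emb_flip
  by (simp only: Un_commute)

section \<open>Edges of Brauer diagrams\<close>

abbreviation diagram_points :: "nat \<Rightarrow> nat \<Rightarrow> point set" where
  "diagram_points p q \<equiv> Top ` {1..p} \<union> Bot ` {1..q}"

text \<open>Adjacency is expressed by relations on indices, so that equality of all bottom pairs of
  two diagrams becomes \<open>bb E = bb D\<close>.\<close>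

definition tt :: "diagram \<Rightarrow> nat \<Rightarrow> nat \<Rightarrow> bool" where "tt D i j \<longleftrightarrow> {Top i, Top j} \<in> D"
definition tb :: "diagram \<Rightarrow> nat \<Rightarrow> nat \<Rightarrow> bool" where "tb D i j \<longleftrightarrow> {Top i, Bot j} \<in> D"
definition bb :: "diagram \<Rightarrow> nat \<Rightarrow> nat \<Rightarrow> bool" where "bb D i j \<longleftrightarrow> {Bot i, Bot j} \<in> D"

lemma tt_sym: "tt D i j \<Longrightarrow> tt D j i" and bb_sym: "bb D i j \<Longrightarrow> bb D j i"
  by (simp_all add: tt_def bb_def insert_commute)

lemma brauer_partition: "D \<in> brauer_diagrams p q \<Longrightarrow> partition_on (diagram_points p q) D"
  and brauer_card: "\<lbrakk>D \<in> brauer_diagrams p q; e \<in> D\<rbrakk> \<Longrightarrow> card e = 2"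
  by (simp_all add: brauer_diagrams_def)

lemma brauer_Union: "D \<in> brauer_diagrams p q \<Longrightarrow> \<Union>D = diagram_points p q"
  using brauer_partition unfolding partition_on_def by blast

lemma finite_brauer_Union: "D \<in> brauer_diagrams p q \<Longrightarrow> finite (\<Union>D)"
  by (simp add: brauer_Union)

lemma finite_brauer: "D \<in> brauer_diagrams p q \<Longrightarrow> finite D"
  using finite_brauer_Union by (rule finite_UnionD)

lemma finite_brauer_diagrams: "finite (brauer_diagrams p q)"
proof (rule finite_subset)
  show "brauer_diagrams p q \<subseteq> Pow (Pow (diagram_points p q))"
    using brauer_Union by blast
qed simp

lemma brauer_edge:
  assumes "D \<in> brauer_diagrams p q" "{x, y} \<in> D"
  shows "x \<noteq> y" "x \<in> diagram_points p q" "y \<in> diagram_points p q"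
  using brauer_card[OF assms] brauer_Union[OF assms(1)] assms(2) by auto

lemma brauer_block_unique:
  assumes "D \<in> brauer_diagrams p q" "d \<in> D" "e \<in> D" "x \<in> d" "x \<in> e"
  shows "d = e"
proof (rule ccontr)
  assume "d \<noteq> e"
  then have "d \<inter> e = {}"
    using disjointD[OF partition_onD2[OF brauer_partition[OF assms(1)]] assms(2,3)] by blast
  then show False using assms(4,5) by blast
qed

lemma brauer_unique:
  assumes "D \<in> brauer_diagrams p q" "{x, y} \<in> D" "{x, z} \<in> D"
  shows "y = z"
proof -
  have "{x, y} = {x, z}" by (rule brauer_block_unique[OF assms, of x]) simp_all
  then show ?thesis using brauer_edge(1)[OF assms(1,2)] by (auto simp: doubleton_eq_iff)
qed

lemma brauer_mate:
  assumes "D \<in> brauer_diagrams p q" "x \<in> diagram_points p q"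
  shows "\<exists>y. {x, y} \<in> D"
proof -
  obtain e where e: "e \<in> D" "x \<in> e" using brauer_Union[OF assms(1)] assms(2) by blast
  obtain u v where "e = {u, v}" using brauer_card[OF assms(1) e(1)] unfolding card_2_iff by blast
  then show ?thesis using e by (auto simp: insert_commute)
qed

lemma tt_bounds: "\<lbrakk>D \<in> brauer_diagrams p q; tt D i j\<rbrakk> \<Longrightarrow> i \<in> {1..p} \<and> j \<in> {1..p} \<and> i \<noteq> j"
  unfolding tt_def by (frule (1) brauer_edge(1), frule (1) brauer_edge(2), drule (1) brauer_edge(3)) auto

lemma tb_bounds: "\<lbrakk>D \<in> brauer_diagrams p q; tb D i j\<rbrakk> \<Longrightarrow> i \<in> {1..p} \<and> j \<in> {1..q}"
  unfolding tb_def by (frule (1) brauer_edge(2), drule (1) brauer_edge(3)) auto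

lemma bb_bounds: "\<lbrakk>D \<in> brauer_diagrams p q; bb D i j\<rbrakk> \<Longrightarrow> i \<in> {1..q} \<and> j \<in> {1..q} \<and> i \<noteq> j"
  unfolding bb_def by (frule (1) brauer_edge(1), frule (1) brauer_edge(2), drule (1) brauer_edge(3)) auto

lemma top_cases:
  assumes "D \<in> brauer_diagrams p q" "i \<in> {1..p}"
  shows "(\<exists>j. tt D i j) \<or> (\<exists>j. tb D i j)"
proof -
  obtain y where "{Top i, y} \<in> D" using brauer_mate[OF assms(1), of "Top i"] assms(2) by auto
  then show ?thesis by (cases y) (auto simp: tt_def tb_def)
qed

lemma bot_cases:
  assumes "D \<in> brauer_diagrams p q" "j \<in> {1..q}"
  shows "(\<exists>i. tb D i j) \<or> (\<exists>k. bb D j k)"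
proof -
  obtain y where "{Bot j, y} \<in> D" using brauer_mate[OF assms(1), of "Bot j"] assms(2) by auto
  then show ?thesis by (cases y) (auto simp: bb_def tb_def insert_commute)
qed

context
  fixes D p q assumes D: "D \<in> brauer_diagrams p q"
begin

lemma tt_unique: "\<lbrakk>tt D i j; tt D i k\<rbrakk> \<Longrightarrow> j = k"
  unfolding tt_def by (drule (1) brauer_unique[OF D]) simp

lemma bb_unique: "\<lbrakk>bb D i j; bb D i k\<rbrakk> \<Longrightarrow> j = k"
  unfolding bb_def by (drule (1) brauer_unique[OF D]) simp

lemma tb_unique_bot: "\<lbrakk>tb D i j; tb D i k\<rbrakk> \<Longrightarrow> j = k"
  unfolding tb_def by (drule (1) brauer_unique[OF D]) simp

lemma tb_unique_top: "\<lbrakk>tb D i k; tb D j k\<rbrakk> \<Longrightarrow> i = j"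
  unfolding tb_def insert_commute[of "Top _"] by (drule (1) brauer_unique[OF D]) simp

lemma tt_tb: "tt D i j \<Longrightarrow> \<not> tb D i k"
  unfolding tt_def tb_def by (auto dest: brauer_unique[OF D])

lemma bb_tb: "bb D j k \<Longrightarrow> \<not> tb D i j"
  unfolding bb_def tb_def insert_commute[of "Top _"] by (auto dest: brauer_unique[OF D])

end

text \<open>One inclusion suffices: both diagrams partition the same points, so a block of
  \<open>D'\<close> meets a block of \<open>D\<close>. The latter is also a block of
  \<open>D'\<close>, and blocks sharing a point coincide.\<close>

lemma brauer_eqI:
  assumes D: "D \<in> brauer_diagrams p q" and D': "D' \<in> brauer_diagrams p q"
    and "\<And>i j. tt D i j \<Longrightarrow> tt D' i j" "\<And>i j. tb D i j \<Longrightarrow> tb D' i j" "\<And>i j. bb D i j \<Longrightarrow> bb D' i j"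
  shows "D = D'"
proof -
  have pair: "{x, y} \<in> D'" if "{x, y} \<in> D" for x y
    using that assms(3-5) by (cases x; cases y) (auto simp: tt_def tb_def bb_def insert_commute)
  have sub: "D \<subseteq> D'"
  proof
    fix e assume e: "e \<in> D"
    obtain x y where "e = {x, y}" using brauer_card[OF D e] unfolding card_2_iff by blast
    then show "e \<in> D'" using pair e by blast
  qed
  show ?thesis
  proof (rule equalityI[OF sub], rule subsetI)
    fix e assume e: "e \<in> D'"
    then obtain x where x: "x \<in> e" using brauer_card[OF D' e] by fastforce
    have "x \<in> \<Union>D'" using e x by blast
    then have "x \<in> \<Union>D" unfolding brauer_Union[OF D] brauer_Union[OF D'] .
    then obtain d where d: "d \<in> D" "x \<in> d" by blast
    have "d \<in> D'" using d sub by blast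
    then have "d = e" using brauer_block_unique[OF D'] e x d(2) by blast
    then show "e \<in> D" using d by simp
  qed
qed

section \<open>Reflection of diagrams\<close>

lemma flip_point_flip_point [simp]: "flip_point (flip_point x) = x"
  by (cases x) auto

lemma inj_flip_point: "inj flip_point"
  by (rule inj_on_inverseI) (rule flip_point_flip_point)

lemma flip_flip [simp]: "flip (flip D) = D"
  unfolding flip_def image_image by simp

lemma mem_flip: "e \<in> flip D \<longleftrightarrow> flip_point ` e \<in> D"
proof -
  have "flip_point ` flip_point ` e = e" for e by (simp add: image_image)
  then show ?thesis unfolding flip_def by (metis image_iff)
qed

lemma tt_flip [simp]: "tt (flip D) i j \<longleftrightarrow> bb D i j"
  and bb_flip [simp]: "bb (flip D) i j \<longleftrightarrow> tt D i j"
  and tb_flip [simp]: "tb (flip D) i j \<longleftrightarrow> tb D j i"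
  by (simp_all add: tt_def bb_def tb_def mem_flip insert_commute)

lemma partition_on_inj_image':
  assumes "partition_on A P" "inj \<phi>"
  shows "partition_on (\<phi> ` A) ((`) \<phi> ` P)"
proof -
  have "(`) \<phi> ` P - {{}} = (`) \<phi> ` P" using assms(1) by (auto simp: partition_on_def)
  then show ?thesis
    using partition_on_inj_image[OF assms(1) inj_on_subset[OF assms(2) subset_UNIV]] by simp
qed

lemma flip_brauer: "D \<in> brauer_diagrams p q \<Longrightarrow> flip D \<in> brauer_diagrams q p"
proof -
  assume D: "D \<in> brauer_diagrams p q"
  have "flip_point ` diagram_points p q = diagram_points q p" by (auto simp: image_Un image_image)
  moreover have "partition_on (flip_point ` diagram_points p q) (flip D)"
    unfolding flip_def
    by (rule partition_on_inj_image'[OF brauer_partition[OF D] inj_flip_point])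
  moreover have "card e = 2" if "e \<in> flip D" for e
    using that brauer_card[OF D] unfolding flip_def by (auto simp: card_image inj_on_subset[OF inj_flip_point])
  ultimately show ?thesis by (simp add: brauer_diagrams_def)
qed

abbreviation dcomp (infixl \<open>\<diamondop>\<close> 70) where "dcomp \<equiv> diagram_comp"

lemma Union_traces: "\<Union>{x - K | x. x \<in> S \<and> \<not> x \<subseteq> K} = \<Union>S - K"
  by blast

lemma trace_memD: "d \<in> {x - K | x. x \<in> S \<and> \<not> x \<subseteq> K} \<Longrightarrow> \<exists>x\<in>S. \<not> x \<subseteq> K \<and> d = x - K"
  by blast

lemma comps_Int: "\<lbrakk>x \<in> comps E; y \<in> comps E; x \<noteq> y\<rbrakk> \<Longrightarrow> x \<inter> y = {}"
  by (rule ccontr) (auto dest: comps_disjoint)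

lemma Int_Diff_empty: "x \<inter> y = {} \<Longrightarrow> (x - K) \<inter> (y - K) = {}"
  by blast

lemma lay_points: "lay a b ` diagram_points p q = {a} \<times> {1..p} \<union> {b} \<times> {1..q}"
  by (auto simp: image_Un image_image)

lemma partition_on_emb:
  assumes "a \<noteq> b" "D \<in> brauer_diagrams p q"
  shows "partition_on (lay a b ` diagram_points p q) (emb a b D)"
  unfolding emb_def
  by (rule partition_on_inj_image'[OF brauer_partition[OF assms(2)] inj_lay[OF assms(1)]])

lemma Union_emb_brauer:
  "\<lbrakk>a \<noteq> b; D \<in> brauer_diagrams p q\<rbrakk> \<Longrightarrow> \<Union>(emb a b D) = {a} \<times> {1..p} \<union> {b} \<times> {1..q}"
  using partition_on_emb[THEN partition_onD1] lay_points by metis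

lemma emb_card: "\<lbrakk>a \<noteq> b; D \<in> brauer_diagrams p q; e \<in> emb a b D\<rbrakk> \<Longrightarrow> card e = 2"
  unfolding emb_def using brauer_card by (auto simp: card_image inj_on_subset[OF inj_lay])

context
  fixes f g p q r
  assumes f: "f \<in> brauer_diagrams q r" and g: "g \<in> brauer_diagrams p q"
begin

abbreviation (input) "stk \<equiv> emb 1 2 f \<union> emb 0 1 g"

lemma comp_ends:
  assumes x: "x \<in> comps stk" "\<not> x \<subseteq> level 1"
  shows "card (x - level 1) = 2"
proof -
  define A B where AB: "A = lay 1 2 ` diagram_points q r" "B = lay 0 1 ` diagram_points p q"
  have sub: "x \<subseteq> A \<union> B"
    using comps_sub[OF x(1)]
    unfolding Union_Un_distrib Union_emb_brauer[OF level_neq(4) f] Union_emb_brauer[OF level_neq(1) g]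
      AB lay_points .
  \<comment> \<open>Both diagrams have the same \<open>q\<close> points on level 1, so the ends of
    \<open>x\<close> are precisely its points off that level.\<close>
  have "A \<inter> B \<subseteq> level 1" "(A \<union> B) \<inter> level 1 \<subseteq> A \<inter> B" unfolding AB lay_points by auto
  then have eq: "x - level 1 = x - A \<inter> B" and ne: "\<not> x \<subseteq> A \<inter> B" using x(2) sub by auto
  have "card (x - A \<inter> B) = 2"
  proof (rule card_ends_of_comp[OF _ _ _ _ _ _ x(1) ne])
    show "finite A" "finite B" unfolding AB by auto
    show "partition_on A (emb 1 2 f)" "partition_on B (emb 0 1 g)"
      unfolding AB by (intro partition_on_emb[OF _ f] partition_on_emb[OF _ g]; simp)+
    show "card e = 2" if "e \<in> emb 1 2 f" for e using emb_card[OF _ f that] by simp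
    show "card e = 2" if "e \<in> emb 0 1 g" for e using emb_card[OF _ g that] by simp
  qed
  then show ?thesis unfolding eq .
qed

text \<open>A component has exactly two ends, so two distinct outer points on it form its block of
  the composite. Pairs of a composite are therefore found by walking along a path.\<close>

lemma comp_edgeI:
  assumes x: "x \<in> comps stk" "lay 0 2 a \<in> x" "lay 0 2 b \<in> x" "a \<noteq> b"
  shows "{a, b} \<in> f \<diamondop> g"
proof -
  have out: "lay 0 2 c \<notin> level 1" for c by (cases c) auto
  define y where "y = x - level 1"
  have ab: "lay 0 2 a \<in> y" "lay 0 2 b \<in> y"
    unfolding y_def using x(2,3) out[of a] out[of b] by simp_all
  have ne: "\<not> x \<subseteq> level 1" 
  proof
    assume "x \<subseteq> level 1"
    then have "lay 0 2 a \<in> level 1" using x(2) by (rule subsetD)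
    then show False using out[of a] by (rule notE[rotated])
  qed
  have "lay 0 2 a \<noteq> lay 0 2 b" using inj_lay[of 0 2] x(4) by (auto simp: inj_def)
  moreover have "card y = 2" unfolding y_def by (rule comp_ends[OF x(1) ne])
  ultimately have "lay 0 2 ` {a, b} = y" using ab by (auto simp: card_2_iff)
  moreover have "y \<in> emb 0 2 (f \<diamondop> g)"
    unfolding emb_diagram_comp[OF level_neq(1,2,4)] y_def using x(1) ne by blast
  ultimately have "lay 0 2 ` {a, b} \<in> (`) (lay 0 2) ` (f \<diamondop> g)" unfolding emb_def by simp
  then show ?thesis
    using inj_image_mem_iff[OF inj_image[OF inj_lay[of 0 2]], of "{a, b}"] by simp
qed

text \<open>Blocks have two elements by \<open>comp_ends\<close> and are disjoint because distinct
  components are.\<close>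

lemma diagram_comp_brauer: "f \<diamondop> g \<in> brauer_diagrams p r"
proof -
  let ?D = "f \<diamondop> g"
  have emb: "emb 0 2 ?D = {x - level 1 | x. x \<in> comps stk \<and> \<not> x \<subseteq> level 1}"
    by (rule emb_diagram_comp[OF level_neq(1,2,4)])
  have inj: "inj (lay 0 2)" by (rule inj_lay) simp
  have "lay 0 2 ` \<Union>?D = \<Union>(emb 0 2 ?D)" unfolding emb_def by blast
  also have "\<dots> = \<Union>stk - level 1"
    unfolding emb Union_traces Union_comps ..
  also have "\<dots> = lay 0 2 ` diagram_points p r"
    unfolding Union_Un_distrib Union_emb_brauer[OF level_neq(4) f] Union_emb_brauer[OF level_neq(1) g]
      lay_points by auto
  finally have U: "\<Union>?D = diagram_points p r" by (simp only: inj_image_eq_iff[OF inj])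
  have mem: "\<exists>x\<in>comps stk. \<not> x \<subseteq> level 1 \<and> lay 0 2 ` d = x - level 1" if "d \<in> ?D" for d
  proof -
    have "lay 0 2 ` d \<in> emb 0 2 ?D" unfolding emb_def using that by blast
    then show ?thesis unfolding emb by (rule trace_memD)
  qed
  have "card d = 2" if d: "d \<in> ?D" for d
  proof -
    obtain x where x: "x \<in> comps stk" "\<not> x \<subseteq> level 1" "lay 0 2 ` d = x - level 1"
      using mem[OF d] by (elim bexE conjE)
    have "card (lay 0 2 ` d) = 2" unfolding x(3) by (rule comp_ends[OF x(1,2)])
    then show ?thesis by (simp add: card_image inj_on_subset[OF inj])
  qed
  moreover have "disjoint ?D"
    unfolding disjoint_def
  proof (intro ballI impI)
    fix d e assume de: "d \<in> ?D" "e \<in> ?D" "d \<noteq> e"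
    obtain x where x: "x \<in> comps stk" "lay 0 2 ` d = x - level 1" using mem[OF de(1)] by (elim bexE conjE)
    obtain y where y: "y \<in> comps stk" "lay 0 2 ` e = y - level 1" using mem[OF de(2)] by (elim bexE conjE)
    have "x \<noteq> y" using x(2) y(2) de(3) inj_image_eq_iff[OF inj, of d e] by auto
    then have "x \<inter> y = {}" by (rule comps_Int[OF x(1) y(1)])
    then have "lay 0 2 ` d \<inter> lay 0 2 ` e = {}" unfolding x(2) y(2) by (rule Int_Diff_empty)
    then show "d \<inter> e = {}" by blast
  qed
  moreover have "{} \<notin> ?D" using calculation(1)[of "{}"] by auto
  ultimately show ?thesis
    using U by (simp add: brauer_diagrams_def partition_on_def)
qed

lemma chain_step: "\<lbrakk>x \<in> comps stk; {u, v} \<in> stk; u \<in> x\<rbrakk> \<Longrightarrow> v \<in> x"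
  using saturatedD[OF comps_sat, of x stk "{u, v}" u] by simp

lemma tt_upper: "tt g i j \<Longrightarrow> {(0, i), (0, j)} \<in> stk"
  and tb_upper: "tb g i j \<Longrightarrow> {(0, i), (1, j)} \<in> stk"
  and bb_upper: "bb g i j \<Longrightarrow> {(1, i), (1, j)} \<in> stk"
  unfolding tt_def tb_def bb_def emb_def
  by (drule imageI[of _ _ "(`) (lay 0 1)"], simp)+

lemma tt_lower: "tt f i j \<Longrightarrow> {(1, i), (1, j)} \<in> stk"
  and tb_lower: "tb f i j \<Longrightarrow> {(1, i), (2, j)} \<in> stk"
  and bb_lower: "bb f i j \<Longrightarrow> {(2, i), (2, j)} \<in> stk"
  unfolding tt_def tb_def bb_def emb_def
  by (drule imageI[of _ _ "(`) (lay 1 2)"], simp)+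

lemma stk_cover: "{u, v} \<in> stk \<Longrightarrow> \<exists>x\<in>comps stk. u \<in> x"
  by (rule comps_cover, erule UnionI) (rule insertI1)

text \<open>This lemma and the next four walk along paths of at most three pairs. Paths between
  outer points are never longer if \<open>f\<close> is upward or \<open>g\<close> is
  downward.\<close>

lemma tt_comp_tt: "tt g i j \<Longrightarrow> tt (f \<diamondop> g) i j"
proof -
  assume a: "tt g i j"
  obtain x where x: "x \<in> comps stk" "(0, i) \<in> x" using stk_cover[OF tt_upper[OF a]] by (elim bexE)
  have "(0, j) \<in> x" by (rule chain_step[OF x(1) tt_upper[OF a] x(2)])
  then show ?thesis
    unfolding tt_def using x tt_bounds[OF g a] by (intro comp_edgeI[OF x(1)]) auto
qed

lemma bb_comp_bb: "bb f i j \<Longrightarrow> bb (f \<diamondop> g) i j"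
proof -
  assume a: "bb f i j"
  obtain x where x: "x \<in> comps stk" "(2, i) \<in> x" using stk_cover[OF bb_lower[OF a]] by (elim bexE)
  have "(2, j) \<in> x" by (rule chain_step[OF x(1) bb_lower[OF a] x(2)])
  then show ?thesis
    unfolding bb_def using x bb_bounds[OF f a] by (intro comp_edgeI[OF x(1)]) auto
qed

lemma tb_comp_tb: "\<lbrakk>tb g i k; tb f k j\<rbrakk> \<Longrightarrow> tb (f \<diamondop> g) i j"
proof -
  assume a: "tb g i k" "tb f k j"
  obtain x where x: "x \<in> comps stk" "(0, i) \<in> x" using stk_cover[OF tb_upper[OF a(1)]] by (elim bexE)
  have "(1, k) \<in> x" by (rule chain_step[OF x(1) tb_upper[OF a(1)] x(2)])
  then have "(2, j) \<in> x" by (rule chain_step[OF x(1) tb_lower[OF a(2)]])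
  then show ?thesis
    unfolding tb_def using x by (intro comp_edgeI[OF x(1)]) auto
qed

lemma tt_comp_cap: "\<lbrakk>tb g i k; tt f k l; tb g j l\<rbrakk> \<Longrightarrow> tt (f \<diamondop> g) i j"
proof -
  assume a: "tb g i k" "tt f k l" "tb g j l"
  obtain x where x: "x \<in> comps stk" "(0, i) \<in> x" using stk_cover[OF tb_upper[OF a(1)]] by (elim bexE)
  have "(1, k) \<in> x" by (rule chain_step[OF x(1) tb_upper[OF a(1)] x(2)])
  then have "(1, l) \<in> x" by (rule chain_step[OF x(1) tt_lower[OF a(2)]])
  then have "(0, j) \<in> x"
    by (rule chain_step[OF x(1) tb_upper[OF a(3), unfolded insert_commute[of "(0, j)"]]])
  moreover have "i \<noteq> j" using a tt_bounds[OF f a(2)] tb_unique_bot[OF g] by blast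
  ultimately show ?thesis
    unfolding tt_def using x by (intro comp_edgeI[OF x(1)]) auto
qed

lemma bb_comp_cup: "\<lbrakk>tb f k i; bb g k l; tb f l j\<rbrakk> \<Longrightarrow> bb (f \<diamondop> g) i j"
proof -
  assume a: "tb f k i" "bb g k l" "tb f l j"
  obtain x where x: "x \<in> comps stk" "(1, k) \<in> x" using stk_cover[OF tb_lower[OF a(1)]] by (elim bexE)
  have i: "(2, i) \<in> x" by (rule chain_step[OF x(1) tb_lower[OF a(1)] x(2)])
  have "(1, l) \<in> x" by (rule chain_step[OF x(1) bb_upper[OF a(2)] x(2)])
  then have "(2, j) \<in> x" by (rule chain_step[OF x(1) tb_lower[OF a(3)]])
  moreover have "i \<noteq> j" using a bb_bounds[OF g a(2)] tb_unique_bot[OF f] tb_unique_top[OF f] by blast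
  ultimately show ?thesis
    unfolding bb_def using x i by (intro comp_edgeI[OF x(1)]) auto
qed

text \<open>If \<open>f\<close> has no top pairs, every middle point runs on to the bottom of
  \<open>f\<close>, so no component stays on the middle level.\<close>

lemma loop_count_no_caps:
  assumes "\<And>i j. \<not> tt f i j"
  shows "loop_count f g = 0"
proof -
  have "\<not> x \<subseteq> level 1" if x: "x \<in> comps stk" for x
  proof
    assume lev: "x \<subseteq> level 1"
    obtain u where "u \<in> x" using comps_ne[OF x] by (auto simp only: ex_in_conv[symmetric])
    moreover then have "u \<in> level 1" by (rule subsetD[OF lev])
    ultimately obtain i where i: "(1, i) \<in> x" by auto
    have "(1, i) \<in> \<Union>stk" by (rule subsetD[OF comps_sub[OF x] i])
    then have "i \<in> {1..q}"
      unfolding Union_Un_distrib Union_emb_brauer[OF level_neq(4) f] Union_emb_brauer[OF level_neq(1) g]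
      by auto
    then obtain j where "tb f i j" using top_cases[OF f] assms by blast
    then have "(2, j) \<in> x" by (rule chain_step[OF x tb_lower i])
    then have "(2, j) \<in> level 1" by (rule subsetD[OF lev])
    then show False by simp
  qed
  then have "{x \<in> comps stk. x \<subseteq> level 1} = {}" by (simp only: Collect_empty_eq) blast
  then show ?thesis unfolding loop_count_emb[OF level_neq(1,2,4)] by (simp only: card.empty)
qed

end

section \<open>Upward, downward and level diagrams\<close>

lemma upward_iff: "D \<in> upward_diagrams p q \<longleftrightarrow> D \<in> brauer_diagrams p q \<and> (\<forall>i j. \<not> tt D i j)"
  and downward_iff: "D \<in> downward_diagrams p q \<longleftrightarrow> D \<in> brauer_diagrams p q \<and> (\<forall>i j. \<not> bb D i j)"
  by (auto simp: upward_diagrams_def downward_diagrams_def tt_def bb_def)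

lemma upward_brauer: "D \<in> upward_diagrams p q \<Longrightarrow> D \<in> brauer_diagrams p q"
  and downward_brauer: "D \<in> downward_diagrams p q \<Longrightarrow> D \<in> brauer_diagrams p q"
  and level_upward: "D \<in> level_diagrams p q \<Longrightarrow> D \<in> upward_diagrams p q"
  and level_downward: "D \<in> level_diagrams p q \<Longrightarrow> D \<in> downward_diagrams p q"
  and level_brauer: "D \<in> level_diagrams p q \<Longrightarrow> D \<in> brauer_diagrams p q"
  by (auto simp: upward_diagrams_def downward_diagrams_def level_diagrams_def)

lemma flip_upward: "D \<in> upward_diagrams p q \<Longrightarrow> flip D \<in> downward_diagrams q p"
  and flip_downward: "D \<in> downward_diagrams p q \<Longrightarrow> flip D \<in> upward_diagrams q p"
  by (simp_all add: upward_iff downward_iff flip_brauer)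

lemma flip_level: "D \<in> level_diagrams p q \<Longrightarrow> flip D \<in> level_diagrams q p"
  by (simp add: level_diagrams_def flip_upward flip_downward)

lemma upward_top: "\<lbrakk>D \<in> upward_diagrams p q; i \<in> {1..p}\<rbrakk> \<Longrightarrow> \<exists>j. tb D i j"
  using top_cases unfolding upward_iff by blast

lemma downward_bot: "\<lbrakk>D \<in> downward_diagrams p q; j \<in> {1..q}\<rbrakk> \<Longrightarrow> \<exists>i. tb D i j"
  using bot_cases unfolding downward_iff by blast

context
  fixes E F p q r
  assumes E: "E \<in> upward_diagrams q r" and F: "F \<in> brauer_diagrams p q"
begin

lemmas E' = upward_brauer[OF E]
lemmas EF' = diagram_comp_brauer[OF E' F]

text \<open>A path that enters \<open>E\<close> from a middle point leaves at the bottom, so the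
  mate of each point can be computed outright. Uniqueness of mates then turns the implications for
  paths into equivalences.\<close>

lemma tt_upward_comp: "tt (E \<diamondop> F) i j \<longleftrightarrow> tt F i j"
proof
  assume a: "tt (E \<diamondop> F) i j"
  then have "i \<in> {1..p}" using tt_bounds[OF EF'] by blast
  then consider l where "tt F i l" | k where "tb F i k" using top_cases[OF F] by blast
  then show "tt F i j"
  proof cases
    case 1
    then show ?thesis using tt_unique[OF EF' a] tt_comp_tt[OF E' F] by blast
  next
    case 2
    then obtain m where "tb E k m" using upward_top[OF E] tb_bounds[OF F] by blast
    then show ?thesis using tt_tb[OF EF' a] tb_comp_tb[OF E' F 2] by blast
  qed
qed (rule tt_comp_tt[OF E' F])

lemma tb_upward_comp: "tb (E \<diamondop> F) i j \<longleftrightarrow> (\<exists>k. tb F i k \<and> tb E k j)"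
proof
  assume a: "tb (E \<diamondop> F) i j"
  then have "i \<in> {1..p}" using tb_bounds[OF EF'] by blast
  then consider l where "tt F i l" | k where "tb F i k" using top_cases[OF F] by blast
  then show "\<exists>k. tb F i k \<and> tb E k j"
  proof cases
    case 1
    then show ?thesis using tt_tb[OF EF' tt_comp_tt[OF E' F 1]] a by blast
  next
    case 2
    then obtain m where "tb E k m" using upward_top[OF E] tb_bounds[OF F] by blast
    then show ?thesis using tb_unique_bot[OF EF' a] tb_comp_tb[OF E' F 2] 2 by blast
  qed
qed (use tb_comp_tb[OF E' F] in blast)

lemma bb_upward_comp: "bb (E \<diamondop> F) i j \<longleftrightarrow> bb E i j \<or> (\<exists>k l. tb E k i \<and> bb F k l \<and> tb E l j)"
proof
  assume a: "bb (E \<diamondop> F) i j"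
  then have "i \<in> {1..r}" using bb_bounds[OF EF'] by blast
  then consider k where "tb E k i" | l where "bb E i l" using bot_cases[OF E'] by blast
  then show "bb E i j \<or> (\<exists>k l. tb E k i \<and> bb F k l \<and> tb E l j)"
  proof cases
    case 1
    then have "k \<in> {1..q}" using tb_bounds[OF E'] by blast
    then consider m where "tb F m k" | l where "bb F k l" using bot_cases[OF F] by blast
    then show ?thesis
    proof cases
      case (1 m)
      then show ?thesis using bb_tb[OF EF' a] tb_comp_tb[OF E' F 1 \<open>tb E k i\<close>] by blast
    next
      case (2 l)
      then obtain m where m: "tb E l m" using upward_top[OF E] bb_bounds[OF F] by blast
      have "m = j" by (rule bb_unique[OF EF' bb_comp_cup[OF E' F \<open>tb E k i\<close> 2 m] a])
      then show ?thesis using \<open>tb E k i\<close> 2 m by blast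
    qed
  next
    case 2
    then show ?thesis using bb_unique[OF EF' bb_comp_bb[OF E' F 2] a] by blast
  qed
qed (use bb_comp_bb[OF E' F] bb_comp_cup[OF E' F] in blast)

lemma loop_count_upward: "loop_count E F = 0"
  using loop_count_no_caps[OF E' F] E unfolding upward_iff by blast

end

lemma comp_flip: "E \<diamondop> F = flip (flip F \<diamondop> flip E)"
  by (simp add: flip_diagram_comp)

text \<open>Reflections of the formulas for an upward lower factor.\<close>

lemma
  assumes F: "F \<in> downward_diagrams p q" and E: "E \<in> brauer_diagrams q r"
  shows bb_comp_downward: "bb (E \<diamondop> F) i j \<longleftrightarrow> bb E i j"
    and tt_comp_downward: "tt (E \<diamondop> F) i j \<longleftrightarrow> tt F i j \<or> (\<exists>k l. tb F i k \<and> tt E k l \<and> tb F j l)"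
    and loop_count_downward: "loop_count E F = 0"
  using tt_upward_comp[OF flip_downward[OF F] flip_brauer[OF E], of i j]
    bb_upward_comp[OF flip_downward[OF F] flip_brauer[OF E], of i j]
    loop_count_upward[OF flip_downward[OF F] flip_brauer[OF E]]
  by (auto simp: comp_flip[of E F] loop_count_flip)

lemma
  shows identity_brauer: "identity_diagram p \<in> brauer_diagrams p p"
    and tt_identity: "\<not> tt (identity_diagram p) i j"
    and bb_identity: "\<not> bb (identity_diagram p) i j"
    and tb_identity: "tb (identity_diagram p) i j \<longleftrightarrow> i = j \<and> i \<in> {1..p}"
proof -
  show "identity_diagram p \<in> brauer_diagrams p p"
    unfolding brauer_diagrams_def
  proof (intro CollectI conjI partition_onI)
    show "\<Union>(identity_diagram p) = diagram_points p p" by (auto simp: identity_diagram_def)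
    show "disjnt d e" if "d \<in> identity_diagram p" "e \<in> identity_diagram p" "d \<noteq> e" for d e
      using that by (auto simp: identity_diagram_def disjnt_def)
  qed (auto simp: identity_diagram_def)
  show "\<not> tt (identity_diagram p) i j"
    unfolding tt_def identity_diagram_def image_iff by (simp add: doubleton_eq_iff)
  show "\<not> bb (identity_diagram p) i j"
    unfolding bb_def identity_diagram_def image_iff by (simp add: doubleton_eq_iff)
  show "tb (identity_diagram p) i j \<longleftrightarrow> i = j \<and> i \<in> {1..p}"
    unfolding tb_def identity_diagram_def image_iff by (auto simp: doubleton_eq_iff)
qed

lemma identity_level: "identity_diagram p \<in> level_diagrams p p"
  by (simp add: level_diagrams_def upward_iff downward_iff identity_brauer tt_identity bb_identity)

lemma flip_identity: "flip (identity_diagram p) = identity_diagram p"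
  by (rule brauer_eqI[OF flip_brauer[OF identity_brauer] identity_brauer])
     (auto simp: tt_identity bb_identity tb_identity)

lemma identity_comp: 
  assumes "D \<in> brauer_diagrams p q"
  shows "identity_diagram q \<diamondop> D = D"
  by (rule brauer_eqI[OF diagram_comp_brauer[OF identity_brauer assms] assms])
     (auto simp: tt_upward_comp[OF level_upward[OF identity_level] assms] tt_identity
       tb_upward_comp[OF level_upward[OF identity_level] assms]
       bb_upward_comp[OF level_upward[OF identity_level] assms] bb_identity tb_identity)

lemma comp_identity: "D \<in> brauer_diagrams p q \<Longrightarrow> D \<diamondop> identity_diagram p = D"
  using identity_comp[OF flip_brauer] by (simp add: comp_flip[of D] flip_identity)

lemma upward_comp:
  assumes E: "E \<in> upward_diagrams q r" and F: "F \<in> upward_diagrams p q"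
  shows "E \<diamondop> F \<in> upward_diagrams p r"
proof -
  note F' = upward_brauer[OF F]
  have "\<not> tt (E \<diamondop> F) i j" for i j
    unfolding tt_upward_comp[OF E F'] using F unfolding upward_iff by blast
  then show ?thesis
    using diagram_comp_brauer[OF upward_brauer[OF E] F'] unfolding upward_iff by blast
qed

lemma downward_comp:
  assumes "E \<in> downward_diagrams q r" "F \<in> downward_diagrams p q"
  shows "E \<diamondop> F \<in> downward_diagrams p r"
  unfolding comp_flip[of E F]
  by (intro flip_upward upward_comp[of _ q] flip_downward assms)

lemma level_comp:
  "\<lbrakk>E \<in> level_diagrams q r; F \<in> level_diagrams p q\<rbrakk> \<Longrightarrow> E \<diamondop> F \<in> level_diagrams p r"
  by (auto simp: level_diagrams_def intro: upward_comp downward_comp)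

text \<open>\<open>E\<close> joins its top points to distinct bottom points, so the pairs of
  \<open>F\<close> can be read off from those of \<open>E \<diamondop> F\<close>.\<close>

lemma upward_left_cancel:
  assumes E: "E \<in> upward_diagrams q r" and F: "F \<in> brauer_diagrams p q" and F': "F' \<in> brauer_diagrams p q"
    and eq: "E \<diamondop> F = E \<diamondop> F'"
  shows "F = F'"
proof (rule brauer_eqI[OF F F'])
  note E' = upward_brauer[OF E]
  show "tt F' i j" if "tt F i j" for i j
    using that tt_upward_comp[OF E F] tt_upward_comp[OF E F'] eq by metis
  show "tb F' i k" if a: "tb F i k" for i k
  proof -
    obtain j where j: "tb E k j" using upward_top[OF E] tb_bounds[OF F a] by blast
    then have "tb (E \<diamondop> F') i j" unfolding eq[symmetric] using tb_upward_comp[OF E F] a by blast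
    then obtain k' where "tb F' i k'" "tb E k' j" using tb_upward_comp[OF E F'] by blast
    then show ?thesis using tb_unique_top[OF E' j] by blast
  qed
  show "bb F' k l" if a: "bb F k l" for k l
  proof -
    obtain i where i: "tb E k i" using upward_top[OF E] bb_bounds[OF F a] by blast
    obtain j where j: "tb E l j" using upward_top[OF E] bb_bounds[OF F a] by blast
    have "bb (E \<diamondop> F') i j" unfolding eq[symmetric] using bb_upward_comp[OF E F] a i j by blast
    \<comment> \<open>A bottom pair of \<open>E\<close> itself is impossible, since \<open>i\<close>
      already lies on a top-bottom pair of \<open>E\<close>.\<close>
    then obtain k' l' where "tb E k' i" "bb F' k' l'" "tb E l' j"
      using bb_upward_comp[OF E F'] bb_tb[OF E'] i by blast
    then show ?thesis using tb_unique_top[OF E' i] tb_unique_top[OF E' j] by blast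
  qed
qed

text \<open>With equal bottom pairs, the top-bottom pairs of \<open>E\<close> and \<open>D\<close>
  end at the same bottom points. So \<open>flip E\<close> carries these ends bijectively to the
  points 1 to \<open>r\<close>, and \<open>E\<close> carries them back.\<close>

lemma upward_split:
  assumes E: "E \<in> upward_diagrams r q" and D: "D \<in> brauer_diagrams p q"
    and cups: "bb E = bb D"
  shows "flip E \<diamondop> D \<in> downward_diagrams p r" and "E \<diamondop> (flip E \<diamondop> D) = D"
proof -
  note E' = upward_brauer[OF E]
  let ?G = "flip E \<diamondop> D"
  note fE = flip_brauer[OF E']
  have G: "?G \<in> brauer_diagrams p r" by (rule diagram_comp_brauer[OF fE D])
  have tb_G: "tb ?G i k" if "tb D i j" "tb E k j" for i j k
    by (rule tb_comp_tb[OF fE D that(1)]) (simp add: that(2))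
  \<comment> \<open>The point \<open>k\<close> corresponds to the end \<open>j\<close> of a
    top-bottom pair of \<open>E\<close>. Then \<open>j\<close> lies on no bottom pair of
    \<open>D\<close> either, so \<open>D\<close> joins it to the top, and \<open>k\<close> lies on a
    top-bottom pair of \<open>?G\<close>.\<close>
  have "\<not> bb ?G k l" for k l
  proof
    assume a: "bb ?G k l"
    obtain j where j: "tb E k j" using upward_top[OF E] bb_bounds[OF G a] by blast
    obtain i where "tb D i j"
      using bot_cases[OF D] tb_bounds[OF E' j] bb_tb[OF E'] j unfolding cups[symmetric] by blast
    then show False using tb_G j bb_tb[OF G a] by blast
  qed
  then show "?G \<in> downward_diagrams p r" using G unfolding downward_iff by blast
  show "E \<diamondop> ?G = D"
  proof (rule brauer_eqI[symmetric, OF D diagram_comp_brauer[OF E' G]])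
    show "tt (E \<diamondop> ?G) i j" if "tt D i j" for i j
      by (rule tt_comp_tt[OF E' G tt_comp_tt[OF fE D that]])
    show "tb (E \<diamondop> ?G) i j" if a: "tb D i j" for i j
    proof -
      obtain k where k: "tb E k j"
        using bot_cases[OF E'] tb_bounds[OF D a] bb_tb[OF D] a unfolding cups by blast
      show ?thesis by (rule tb_comp_tb[OF E' G tb_G[OF a k] k])
    qed
    show "bb (E \<diamondop> ?G) i j" if "bb D i j" for i j
      using that unfolding cups[symmetric] by (rule bb_comp_bb[OF E' G])
  qed
qed

text \<open>Splitting \<open>E\<close> by itself gives
  \<open>E \<diamondop> (flip E \<diamondop> E) = E\<close>, and \<open>E\<close> cancels.\<close>

lemma flip_upward_comp_self:
  assumes E: "E \<in> upward_diagrams r q"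
  shows "flip E \<diamondop> E = identity_diagram r"
proof (rule upward_left_cancel[OF E _ identity_brauer])
  note E' = upward_brauer[OF E]
  show "flip E \<diamondop> E \<in> brauer_diagrams r r" by (rule diagram_comp_brauer[OF flip_brauer[OF E'] E'])
  show "E \<diamondop> (flip E \<diamondop> E) = E \<diamondop> identity_diagram r"
    using upward_split(2)[OF E E' refl] by (simp add: comp_identity[OF E'])
qed

lemma comp_flip_self_level: "s \<in> level_diagrams p q \<Longrightarrow> s \<diamondop> flip s = identity_diagram q"
  using flip_upward_comp_self[OF flip_downward[OF level_downward]] by simp

subsection \<open>Counting points\<close>

text \<open>There are (p + q)/2 pairs, and \<open>p\<close> of them are the top-bottom pairs
  starting at the top points; a bottom pair adds to these. This yields order and parity of the
  source, and excludes bottom pairs for \<open>p = q\<close>.\<close>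

lemma card_upward:
  assumes D: "D \<in> upward_diagrams p q"
  shows "p \<le> card D" "p + q = 2 * card D" "\<lbrakk>bb D i j\<rbrakk> \<Longrightarrow> p < card D"
proof -
  note D' = upward_brauer[OF D]
  have "card (diagram_points p q) = p + q"
    by (subst card_Un_disjoint) (auto simp: card_image inj_on_def)
  moreover have "card (\<Union>D) = (\<Sum>d\<in>D. card d)"
  proof (rule card_Union_disjoint)
    show "pairwise disjnt D"
      using partition_onD2[OF brauer_partition[OF D']]
      unfolding disjoint_def pairwise_def disjnt_def by simp
    show "finite d" if "d \<in> D" for d using brauer_card[OF D' that] card_ge_0_finite by force
  qed
  ultimately show "p + q = 2 * card D" using brauer_card[OF D'] brauer_Union[OF D'] by simp
  have "\<forall>i\<in>{1..p}. \<exists>j. tb D i j" using upward_top[OF D] by blast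
  then obtain \<phi> where \<phi>: "\<And>i. i \<in> {1..p} \<Longrightarrow> tb D i (\<phi> i)" by metis
  let ?T = "(\<lambda>i. {Top i, Bot (\<phi> i)}) ` {1..p}"
  have T: "card ?T = p" by (subst card_image) (auto simp: inj_on_def doubleton_eq_iff)
  have sub: "?T \<subseteq> D" using \<phi> unfolding tb_def by blast
  show "p \<le> card D" using card_mono[OF finite_brauer[OF D'] sub] T by simp
  assume "bb D i j"
  then have "?T \<subset> D" using sub unfolding bb_def by (auto simp: doubleton_eq_iff)
  then show "p < card D" using psubset_card_mono[OF finite_brauer[OF D']] T by metis
qed

lemma upward_brauer_le: "D \<in> upward_diagrams p q \<Longrightarrow> (p, q) \<in> brauer_le"
proof -
  assume D: "D \<in> upward_diagrams p q"
  have "q - p = 2 * (card D - p)" "p \<le> q" using card_upward(1,2)[OF D] by linarith+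
  moreover then have "even (q - p)" by simp
  ultimately show ?thesis unfolding brauer_le_def by blast
qed

lemma downward_brauer_le: "D \<in> downward_diagrams p q \<Longrightarrow> (q, p) \<in> brauer_le"
  by (rule upward_brauer_le[OF flip_downward])

lemma level_eq: "D \<in> level_diagrams p q \<Longrightarrow> p = q"
  using upward_brauer_le[OF level_upward] downward_brauer_le[OF level_downward]
  unfolding brauer_le_def by fastforce

lemma level_diagrams_empty: "p \<noteq> q \<Longrightarrow> level_diagrams p q = {}"
  using level_eq by blast

lemma upward_diag: "upward_diagrams p p = level_diagrams p p"
proof
  show "upward_diagrams p p \<subseteq> level_diagrams p p"
  proof
    fix D assume D: "D \<in> upward_diagrams p p"
    then have "\<not> bb D i j" for i j using card_upward(2,3)[OF D] by fastforce
    then show "D \<in> level_diagrams p p" using D by (simp add: level_diagrams_def downward_iff upward_iff)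
  qed
qed (auto intro: level_upward)

lemma downward_diag: "downward_diagrams p p = level_diagrams p p"
proof
  show "downward_diagrams p p \<subseteq> level_diagrams p p"
    using flip_level flip_downward unfolding upward_diag[symmetric]
    by (metis flip_flip flip_level subsetI upward_diag)
qed (auto intro: level_downward)

text \<open>The source is the number of bottom points on no bottom pair, since the top-bottom pairs
  match these points with the top points.\<close>

lemma upward_same_cups_same_source:
  assumes "E \<in> upward_diagrams r q" "E' \<in> upward_diagrams r' q" "bb E = bb E'"
  shows "r = r'"
proof -
  have source: "card {j \<in> {1..q}. \<forall>k. \<not> bb D j k} = s" if D: "D \<in> upward_diagrams s q" for D s
  proof -
    note D' = upward_brauer[OF D]
    obtain \<phi> where \<phi>: "\<And>i. i \<in> {1..s} \<Longrightarrow> tb D i (\<phi> i)" using upward_top[OF D] by metis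
    have "bij_betw \<phi> {1..s} {j \<in> {1..q}. \<forall>k. \<not> bb D j k}"
    proof (rule bij_betwI')
      show "\<phi> i = \<phi> j \<longleftrightarrow> i = j" if "i \<in> {1..s}" "j \<in> {1..s}" for i j
        using tb_unique_top[OF D' \<phi>[OF that(1)]] \<phi>[OF that(2)] by auto
      show "\<phi> i \<in> {j \<in> {1..q}. \<forall>k. \<not> bb D j k}" if "i \<in> {1..s}" for i
        using tb_bounds[OF D' \<phi>[OF that]] bb_tb[OF D'] \<phi>[OF that] by blast
      show "\<exists>i\<in>{1..s}. j = \<phi> i" if "j \<in> {j \<in> {1..q}. \<forall>k. \<not> bb D j k}" for j
        using bot_cases[OF D', of j] that tb_bounds[OF D'] tb_unique_bot[OF D'] \<phi> by blast
    qed
    then show ?thesis using bij_betw_same_card by fastforce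
  qed
  show ?thesis using source[OF assms(1)] source[OF assms(2)] assms(3) by simp
qed

subsection \<open>Monotone diagrams\<close>

text \<open>The product is positive exactly if both differences have the same sign. Distinct
  top-bottom pairs have distinct top points because mates are unique.\<close>

lemma monotone_iff:
  assumes D: "D \<in> brauer_diagrams p q"
  shows "monotone_diagram D \<longleftrightarrow> (\<forall>i j k l. tb D i j \<longrightarrow> tb D k l \<longrightarrow> i < k \<longrightarrow> j < l)"
proof -
  have sign: "(int i - int k) * (int j - int l) > 0 \<longleftrightarrow> (i < k \<and> j < l) \<or> (k < i \<and> l < j)" for i j k l
    by (auto simp: zero_less_mult_iff)
  have pair: "{Top i, Bot j} = {Top k, Bot l} \<longleftrightarrow> i = k \<and> j = l" for i j k l
    by (auto simp: doubleton_eq_iff)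
  show ?thesis
    unfolding monotone_diagram_def tb_def[symmetric] sign pair
  proof (intro iffI allI impI)
    fix i j k l
    assume "\<forall>i j k l. tb D i j \<and> tb D k l \<and> \<not> (i = k \<and> j = l) \<longrightarrow> i < k \<and> j < l \<or> k < i \<and> l < j"
      and "tb D i j" "tb D k l" "i < k"
    then have "i < k \<and> j < l \<or> k < i \<and> l < j" by blast
    then show "j < l" using \<open>i < k\<close> by auto
  next
    fix i j k l
    assume mono: "\<forall>i j k l. tb D i j \<longrightarrow> tb D k l \<longrightarrow> i < k \<longrightarrow> j < l"
      and "tb D i j \<and> tb D k l \<and> \<not> (i = k \<and> j = l)"
    then have tb: "tb D i j" "tb D k l" and "i \<noteq> k" using tb_unique_bot[OF D] by blast+
    then consider "i < k" | "k < i" by linarith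
    then show "i < k \<and> j < l \<or> k < i \<and> l < j"
      by cases (use mono tb in blast)+
  qed
qed

text \<open>The top-bottom pairs of a monotone upward diagram list the bottom points on no bottom
  pair in increasing order, and a strictly sorted list is determined by its set.\<close>

lemma monotone_upward_unique:
  assumes E: "E \<in> upward_diagrams r q" "monotone_diagram E"
    and E': "E' \<in> upward_diagrams r q" "monotone_diagram E'" and cups: "bb E = bb E'"
  shows "E = E'"
proof -
  let ?U = "{j \<in> {1..q}. \<forall>k. \<not> bb E j k}"
  \<comment> \<open>Stated for any diagram with these bottom pairs, so that \<open>E\<close> and
    \<open>E'\<close> are compared with the same sorted list.\<close>
  have enum: "map \<phi> [1..<Suc r] = sorted_list_of_set ?U"
    if D: "D \<in> upward_diagrams r q" "monotone_diagram D" "bb D = bb E"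
      and \<phi>: "\<And>i. i \<in> {1..r} \<Longrightarrow> tb D i (\<phi> i)" for D \<phi>
  proof (rule strict_sorted_equal)
    note D' = upward_brauer[OF D(1)]
    have mono: "\<phi> i < \<phi> k" if "i \<in> {1..r}" "k \<in> {1..r}" "i < k" for i k
      using D(2) \<phi>[OF that(1)] \<phi>[OF that(2)] that(3) unfolding monotone_iff[OF D'] by blast
    show "sorted_wrt (<) (map \<phi> [1..<Suc r])"
      unfolding sorted_wrt_map
      by (rule sorted_wrt_mono_rel[OF _ sorted_wrt_upt]) (rule mono, auto simp del: upt_Suc)
    have U: "\<phi> ` {1..r} = ?U"
    proof
      show "\<phi> ` {1..r} \<subseteq> ?U"
        using tb_bounds[OF D' \<phi>] bb_tb[OF D'] \<phi> unfolding D(3)[symmetric] by blast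
      show "?U \<subseteq> \<phi> ` {1..r}"
        using bot_cases[OF D'] tb_bounds[OF D'] tb_unique_bot[OF D'] \<phi> unfolding D(3)[symmetric] by blast
    qed
    have "set (map \<phi> [1..<Suc r]) = set (sorted_list_of_set ?U)"
      unfolding set_map set_upt atLeastLessThanSuc_atLeastAtMost U by simp
    then show "set (map \<phi> [1..<Suc r]) = set (sorted_list_of_set ?U)" .
  qed simp
  obtain \<phi> where \<phi>: "\<And>i. i \<in> {1..r} \<Longrightarrow> tb E i (\<phi> i)" using upward_top[OF E(1)] by metis
  obtain \<phi>' where \<phi>': "\<And>i. i \<in> {1..r} \<Longrightarrow> tb E' i (\<phi>' i)" using upward_top[OF E'(1)] by metis
  have "map \<phi> [1..<Suc r] = map \<phi>' [1..<Suc r]"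
    using enum[OF E refl \<phi>] enum[OF E' cups[symmetric] \<phi>'] by simp
  then have eq: "\<phi> i = \<phi>' i" if "i \<in> {1..r}" for i using that by (auto simp del: upt_Suc)
  show ?thesis
  proof (rule brauer_eqI[OF upward_brauer[OF E(1)] upward_brauer[OF E'(1)]])
    show "tt E' i j" if "tt E i j" for i j using that E(1) unfolding upward_iff by blast
    show "bb E' i j" if "bb E i j" for i j using that cups by simp
    show "tb E' i j" if a: "tb E i j" for i j
    proof -
      have "i \<in> {1..r}" using tb_bounds[OF upward_brauer[OF E(1)] a] by blast
      then show ?thesis
        using eq \<phi>' tb_unique_bot[OF upward_brauer[OF E(1)] a \<phi>] by metis
    qed
  qed
qed

text \<open>The bottom pairs of \<open>D\<close> are kept, and top point \<open>i\<close> is joined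
  to the \<open>i\<close>-th smallest of the remaining bottom points.\<close>

lemma monotone_upward_exists:
  assumes D: "D \<in> brauer_diagrams p q"
  shows "\<exists>r E. E \<in> upward_diagrams r q \<and> monotone_diagram E \<and> bb E = bb D"
proof -
  define U where "U = {j \<in> {1..q}. \<forall>k. \<not> bb D j k}"
  define r where "r = card U"
  \<comment> \<open>Points are numbered from 1 and list positions from 0.\<close>
  define \<phi> where "\<phi> i = sorted_list_of_set U ! (i - 1)" for i
  have finU: "finite U" unfolding U_def by simp
  have mono: "\<phi> i < \<phi> k" if "1 \<le> i" "i < k" "k \<le> r" for i k
    unfolding \<phi>_def using that finU
    by (intro sorted_wrt_nth_less[OF strict_sorted_list_of_set]) (auto simp: r_def)
  have surj: "\<phi> ` {1..r} = U"
  proof -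
    have "{..<r} = (\<lambda>i. i - 1) ` {1..r}" by (force simp: image_iff Bex_def)
    then have "\<phi> ` {1..r} = (!) (sorted_list_of_set U) ` {..<r}"
      unfolding \<phi>_def by (simp add: image_image)
    also have "\<dots> = set (sorted_list_of_set U)"
      using finU by (auto simp: r_def set_conv_nth image_def)
    finally show ?thesis using finU by simp
  qed
  have inj: "i = k" if "\<phi> i = \<phi> k" "i \<in> {1..r}" "k \<in> {1..r}" for i k
    using that mono[of i k] mono[of k i] by (metis atLeastAtMost_iff less_irrefl linorder_neqE_nat)
  let ?B = "{e \<in> D. e \<subseteq> range Bot}" and ?T = "(\<lambda>i. {Top i, Bot (\<phi> i)}) ` {1..r}"
  define E where "E = ?B \<union> ?T"
  have B_Union: "\<Union>?B = Bot ` ({1..q} - U)"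
  proof (intro equalityI subsetI)
    fix x assume "x \<in> \<Union>?B"
    then obtain e where e: "e \<in> D" "e \<subseteq> range Bot" "x \<in> e" by blast
    obtain u v where "e = {u, v}" using brauer_card[OF D e(1)] unfolding card_2_iff by blast
    then obtain k where "{x, Bot k} = e" "x \<in> range Bot" using e by (auto simp: insert_commute)
    then obtain j where j: "x = Bot j" "bb D j k" using e unfolding bb_def by auto
    then show "x \<in> Bot ` ({1..q} - U)" using bb_bounds[OF D j(2)] unfolding U_def by auto
  next
    fix x assume "x \<in> Bot ` ({1..q} - U)"
    then obtain j k where "x = Bot j" "bb D j k" unfolding U_def by blast
    then show "x \<in> \<Union>?B" unfolding bb_def by (intro UnionI[of "{Bot j, Bot k}"]) auto
  qed
  have E: "E \<in> brauer_diagrams r q"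
    unfolding brauer_diagrams_def
  proof (intro CollectI conjI partition_onI)
    have "\<Union>?T = Top ` {1..r} \<union> Bot ` U" unfolding surj[symmetric] by auto
    moreover have "U \<subseteq> {1..q}" unfolding U_def by blast
    ultimately show "\<Union>E = diagram_points r q" unfolding E_def Union_Un_distrib B_Union by auto
    show two: "\<forall>e\<in>E. card e = 2" using brauer_card[OF D] unfolding E_def by auto
    then show "{} \<notin> E" by auto
    fix d e assume de: "d \<in> E" "e \<in> E" "d \<noteq> e"
    have BT: "disjnt d e" if d: "d \<in> ?B" and e: "e \<in> ?T" for d e
    proof -
      obtain i where "e = {Top i, Bot (\<phi> i)}" "\<phi> i \<in> U" using e surj by blast
      moreover have "d \<subseteq> Bot ` ({1..q} - U)" unfolding B_Union[symmetric] using d by (rule Union_upper)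
      ultimately show ?thesis unfolding disjnt_def by auto
    qed
    have BB: "disjnt d e" if "d \<in> ?B" "e \<in> ?B" "d \<noteq> e" for d e
      using that brauer_block_unique[OF D, of d e] unfolding disjnt_def by blast
    have TT: "disjnt d e" if "d \<in> ?T" "e \<in> ?T" "d \<noteq> e" for d e
      using that inj unfolding disjnt_def by auto
    have "d \<in> ?B \<or> d \<in> ?T" "e \<in> ?B \<or> e \<in> ?T" using de(1,2) unfolding E_def by (simp_all only: Un_iff)
    then show "disjnt d e"
      using BT[of d e] BT[of e d, THEN disjnt_sym] BB[OF _ _ de(3)] TT[OF _ _ de(3)] by argo
  qed
  have tb: "tb E i j \<longleftrightarrow> i \<in> {1..r} \<and> j = \<phi> i" for i j
    unfolding tb_def E_def by (auto simp: doubleton_eq_iff)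
  have "\<not> tt E i j" for i j
    unfolding tt_def E_def by (auto simp: doubleton_eq_iff)
  moreover have "bb E = bb D"
    unfolding bb_def E_def by (auto simp: doubleton_eq_iff fun_eq_iff)
  moreover have "monotone_diagram E"
    unfolding monotone_iff[OF E] tb using mono by auto
  ultimately show ?thesis using E unfolding upward_iff by blast
qed

subsection \<open>The twist on diagrams\<close>

text \<open>The bounds and the other two inequalities are automatic, because pairs of a Brauer
  diagram have distinct ends among its points.\<close>

lemma twist_conflict_iff:
  assumes f: "f \<in> brauer_diagrams q r" and g: "g \<in> brauer_diagrams p q"
  shows "twist_conflict q f g \<longleftrightarrow> (\<exists>i j k. i \<noteq> k \<and> tt f i j \<and> bb g j k)"
  unfolding twist_conflict_def tt_def[symmetric] bb_def[symmetric]
  using tt_bounds[OF f] bb_bounds[OF g] by metis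

lemma twist_conflict_flip:
  assumes f: "f \<in> brauer_diagrams q r" and g: "g \<in> brauer_diagrams p q"
  shows "twist_conflict q (flip g) (flip f) \<longleftrightarrow> twist_conflict q f g"
  unfolding twist_conflict_iff[OF f g] twist_conflict_iff[OF flip_brauer[OF g] flip_brauer[OF f]]
    tt_flip bb_flip
proof
  assume "\<exists>i j k. i \<noteq> k \<and> bb g i j \<and> tt f j k"
  then obtain i j k where "i \<noteq> k" "bb g i j" "tt f j k" by blast
  then have "k \<noteq> i \<and> tt f k j \<and> bb g j i" by (simp add: tt_sym bb_sym)
  then show "\<exists>i j k. i \<noteq> k \<and> tt f i j \<and> bb g j k" by blast
next
  assume "\<exists>i j k. i \<noteq> k \<and> tt f i j \<and> bb g j k"
  then obtain i j k where "i \<noteq> k" "tt f i j" "bb g j k" by blast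
  then have "k \<noteq> i \<and> bb g k j \<and> tt f j i" by (simp add: tt_sym bb_sym)
  then show "\<exists>i j k. i \<noteq> k \<and> bb g i j \<and> tt f j k" by blast
qed

text \<open>This makes the twist well defined on a tensor product over the level diagrams. Since
  \<open>s\<close> is a permutation, a conflict above \<open>s\<close> is carried along
  \<open>s\<close> to one below it, and back.\<close>

lemma twist_conflict_balance:
  assumes f: "f \<in> brauer_diagrams q r" and g: "g \<in> brauer_diagrams p q" and s: "s \<in> level_diagrams q q"
  shows "twist_conflict q (f \<diamondop> s) g \<longleftrightarrow> twist_conflict q f (s \<diamondop> g)"
proof -
  note s' = level_brauer[OF s]
  have no_arcs: "\<not> tt s i j" "\<not> bb s i j" for i j
    using level_upward[OF s] level_downward[OF s] unfolding upward_iff downward_iff by auto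
  have "twist_conflict q (f \<diamondop> s) g \<longleftrightarrow>
      (\<exists>i j k a b. i \<noteq> k \<and> tb s i a \<and> tt f a b \<and> tb s j b \<and> bb g j k)"
    unfolding twist_conflict_iff[OF diagram_comp_brauer[OF f s'] g]
      tt_comp_downward[OF level_downward[OF s] f] by (simp only: no_arcs simp_thms) blast
  also have "\<dots> \<longleftrightarrow> (\<exists>a b c j k. a \<noteq> c \<and> tt f a b \<and> tb s j b \<and> bb g j k \<and> tb s k c)"
  proof
    assume "\<exists>i j k a b. i \<noteq> k \<and> tb s i a \<and> tt f a b \<and> tb s j b \<and> bb g j k"
    then obtain i j k a b where *: "i \<noteq> k" "tb s i a" "tt f a b" "tb s j b" "bb g j k" by blast
    obtain c where c: "tb s k c" using upward_top[OF level_upward[OF s]] bb_bounds[OF g *(5)] by blast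
    then have "a \<noteq> c" using *(1,2) tb_unique_top[OF s'] by blast
    then show "\<exists>a b c j k. a \<noteq> c \<and> tt f a b \<and> tb s j b \<and> bb g j k \<and> tb s k c" using * c by blast
  next
    assume "\<exists>a b c j k. a \<noteq> c \<and> tt f a b \<and> tb s j b \<and> bb g j k \<and> tb s k c"
    then obtain a b c j k where *: "a \<noteq> c" "tt f a b" "tb s j b" "bb g j k" "tb s k c" by blast
    obtain i where i: "tb s i a" using downward_bot[OF level_downward[OF s]] tt_bounds[OF f *(2)] by blast
    then have "i \<noteq> k" using *(1,5) tb_unique_bot[OF s'] by blast
    then show "\<exists>i j k a b. i \<noteq> k \<and> tb s i a \<and> tt f a b \<and> tb s j b \<and> bb g j k" using * i by blast
  qed
  also have "\<dots> \<longleftrightarrow> twist_conflict q f (s \<diamondop> g)"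
    unfolding twist_conflict_iff[OF f diagram_comp_brauer[OF s' g]]
      bb_upward_comp[OF level_upward[OF s] g] by (simp only: no_arcs simp_thms) blast
  finally show ?thesis .
qed

lemma twist_conflict_upward_left:
  assumes "f \<in> brauer_diagrams q r" "g \<in> brauer_diagrams p q" "s \<in> upward_diagrams r r'"
  shows "twist_conflict q (s \<diamondop> f) g \<longleftrightarrow> twist_conflict q f g"
  unfolding twist_conflict_iff[OF assms(1,2)]
    twist_conflict_iff[OF diagram_comp_brauer[OF upward_brauer[OF assms(3)] assms(1)] assms(2)]
    tt_upward_comp[OF assms(3,1)] ..

lemma twist_conflict_downward_right:
  assumes "f \<in> brauer_diagrams q r" "g \<in> brauer_diagrams p q" "s \<in> downward_diagrams p' p"
  shows "twist_conflict q f (g \<diamondop> s) \<longleftrightarrow> twist_conflict q f g"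
  unfolding twist_conflict_iff[OF assms(1,2)]
    twist_conflict_iff[OF assms(1) diagram_comp_brauer[OF assms(2) downward_brauer[OF assms(3)]]]
    bb_comp_downward[OF assms(3,2)] ..

text \<open>Composing with \<open>flip s\<close> undoes the permutation \<open>s\<close>.\<close>

lemma level_left_iff:
  assumes "s \<in> level_diagrams q r" "D \<in> brauer_diagrams p q"
  shows "s \<diamondop> D \<in> level_diagrams p r \<longleftrightarrow> D \<in> level_diagrams p q"
proof
  assume "s \<diamondop> D \<in> level_diagrams p r"
  then have "flip s \<diamondop> (s \<diamondop> D) \<in> level_diagrams p q" by (rule level_comp[OF flip_level[OF assms(1)]])
  then show "D \<in> level_diagrams p q"
    by (simp add: diagram_comp_assoc[symmetric] flip_upward_comp_self[OF level_upward[OF assms(1)]]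
        identity_comp[OF assms(2)])
qed (rule level_comp[OF assms(1)])

lemma level_right_iff:
  assumes "s \<in> level_diagrams p q" "D \<in> brauer_diagrams q r"
  shows "D \<diamondop> s \<in> level_diagrams p r \<longleftrightarrow> D \<in> level_diagrams q r"
  using level_left_iff[OF flip_level[OF assms(1)] flip_brauer[OF assms(2)]] flip_level
  by (metis flip_diagram_comp flip_flip)

text \<open>The pairing of \<open>f\<close> and \<open>g\<close> is non-zero only if the arcs of \<open>f\<close> and \<open>g\<close> coincide.\<close>

lemma no_conflict_level:
  assumes f: "f \<in> brauer_diagrams q r" and g: "g \<in> brauer_diagrams p q"
    and nc: "\<not> twist_conflict q f g" and lev: "f \<diamondop> g \<in> level_diagrams p r"
  shows "bb g = tt f"
proof (intro ext iffI)
  fix i j assume a: "bb g i j"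
  have no: "\<not> (i \<noteq> k \<and> tt f i j \<and> bb g j k)" for i j k
    using nc unfolding twist_conflict_iff[OF f g] by blast
  have ij: "i \<in> {1..q}" "j \<in> {1..q}" using bb_bounds[OF g a] by auto
  have nobb: "\<not> bb (f \<diamondop> g) u v" for u v using level_downward[OF lev] unfolding downward_iff by blast
  show "tt f i j"
  \<comment> \<open>If an end of this pair of \<open>g\<close> lies on a top pair of
    \<open>f\<close>, the absence of conflicts makes the two pairs coincide. Otherwise both ends run
    on to the bottom of \<open>f\<close> and produce a bottom pair of the composite, which is then
    not level.\<close>
  proof (cases "\<exists>k. tt f i k")
    case True
    then obtain k where "tt f i k" by blast
    then show ?thesis using no[of k j i] a tt_sym by metis
  next
    case False
    then obtain u where u: "tb f i u" using top_cases[OF f ij(1)] by blast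
    show ?thesis
    proof (cases "\<exists>k. tt f j k")
      case True
      then obtain k where "tt f j k" by blast
      then show ?thesis using no[of k i j] a tt_sym bb_sym by metis
    next
      case False
      then obtain v where "tb f j v" using top_cases[OF f ij(2)] by blast
      then show ?thesis using bb_comp_cup[OF f g u a] nobb by blast
    qed
  qed
next
  fix i j assume a: "tt f i j"
  have no: "\<not> (i \<noteq> k \<and> tt f i j \<and> bb g j k)" for i j k
    using nc unfolding twist_conflict_iff[OF f g] by blast
  have ij: "i \<in> {1..q}" "j \<in> {1..q}" using tt_bounds[OF f a] by auto
  have nott: "\<not> tt (f \<diamondop> g) u v" for u v using level_upward[OF lev] unfolding upward_iff by blast
  show "bb g i j"
  proof (cases "\<exists>k. bb g i k")
    case True
    then obtain k where "bb g i k" by blast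
    then show ?thesis using no[of j k i] a tt_sym by metis
  next
    case False
    then obtain u where u: "tb g u i" using bot_cases[OF g ij(1)] by blast
    show ?thesis
    proof (cases "\<exists>k. bb g j k")
      case True
      then obtain k where "bb g j k" by blast
      then show ?thesis using no[of i k j] a bb_sym by metis
    next
      case False
      then obtain v where "tb g v j" using bot_cases[OF g ij(2)] by blast
      then show ?thesis using tt_comp_cap[OF f g u a] nott by blast
    qed
  qed
qed

text \<open>\<open>g\<close> and \<open>flip f\<close> are upward with the same bottom pairs, so
  \<open>upward_split\<close> applies with either one as the upward factor. The two instances give
  the two halves of levelness, and the first also gives the last equation after reflection.\<close>

lemma matching_arcs:
  assumes f: "f \<in> downward_diagrams q r" and g: "g \<in> upward_diagrams p q" and eq: "bb g = tt f"
  shows "\<not> twist_conflict q f g" "f \<diamondop> g \<in> level_diagrams p r" "(f \<diamondop> g) \<diamondop> flip g = f"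
proof -
  note f' = downward_brauer[OF f] and g' = upward_brauer[OF g]
  show "\<not> twist_conflict q f g"
    unfolding twist_conflict_iff[OF f' g'] eq using tt_unique[OF f'] tt_sym by blast
  have cups: "bb g = bb (flip f)" using eq by (simp add: fun_eq_iff)
  note split = upward_split[OF g flip_brauer[OF f'] cups]
  have "f \<diamondop> g = flip (flip g \<diamondop> flip f)" by (rule comp_flip)
  then have "f \<diamondop> g \<in> upward_diagrams p r" using flip_downward[OF split(1)] by simp
  moreover have "f \<diamondop> g \<in> downward_diagrams p r"
    using upward_split(1)[OF flip_downward[OF f] g' cups[symmetric]] by simp
  ultimately show "f \<diamondop> g \<in> level_diagrams p r" by (simp add: level_diagrams_def)
  show "(f \<diamondop> g) \<diamondop> flip g = f"
    using split(2) by (simp add: comp_flip[of "f \<diamondop> g" "flip g"] flip_diagram_comp[symmetric])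
qed

section \<open>Multilinear maps on free modules\<close>

text \<open>Free modules on \<open>X\<close> and on \<open>Y\<close> have the same operations, so
  only membership in the carrier is at stake.\<close>

lemma linear_maps_free_upcast:
  assumes "cring R" "h \<in> linear_maps R M (free_module R X)" "X \<subseteq> Y"
  shows "h \<in> linear_maps R M (free_module R Y)"
  using assms(2) cring.free_module_mono[OF assms(1,3)] by (auto simp: linear_maps_def)

lemma linear_maps_free_restrict:
  assumes "cring R" "h \<in> linear_maps R (free_module R Y) M" "X \<subseteq> Y"
  shows "h \<in> linear_maps R (free_module R X) M"
  using cring.free_module_mono[OF assms(1,3)] assms(2)
  by (auto simp: linear_maps_def Pi_iff subset_iff)

text \<open>Serves to check associativity, balance and compatibility with the actions on triples of
  diagrams.\<close>

definition trilinear_map ::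
    "('k, 'r) ring_scheme \<Rightarrow> ('k, 'm) module \<Rightarrow> ('k, 'n) module \<Rightarrow> ('k, 'l) module \<Rightarrow> ('k, 'p) module
      \<Rightarrow> ('m \<Rightarrow> 'n \<Rightarrow> 'l \<Rightarrow> 'p) \<Rightarrow> bool" where
  "trilinear_map R M N L P h \<longleftrightarrow>
     (\<forall>m\<in>carrier M. bilinear_map R N L P (h m)) \<and>
     (\<forall>n\<in>carrier N. \<forall>l\<in>carrier L. (\<lambda>m. h m n l) \<in> linear_maps R M P)"

lemma trilinear_map_nest_right:
  assumes "bilinear_map R M Q P \<beta>" "bilinear_map R N L Q \<gamma>"
  shows "trilinear_map R M N L P (\<lambda>m n l. \<beta> m (\<gamma> n l))"
  unfolding trilinear_map_def
proof (intro conjI ballI)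
  show "bilinear_map R N L P (\<lambda>n l. \<beta> m (\<gamma> n l))" if "m \<in> carrier M" for m
    by (rule bilinear_map_compose[OF assms(2) bilinear_map_right[OF assms(1) that]])
  show "(\<lambda>m. \<beta> m (\<gamma> n l)) \<in> linear_maps R M P" if "n \<in> carrier N" "l \<in> carrier L" for n l
    by (rule bilinear_map_left[OF assms(1) bilinear_map_closed[OF assms(2) that]])
qed

lemma trilinear_map_nest_left:
  assumes "bilinear_map R Q L P \<beta>" "bilinear_map R M N Q \<gamma>"
  shows "trilinear_map R M N L P (\<lambda>m n l. \<beta> (\<gamma> m n) l)"
  unfolding trilinear_map_def
proof (intro conjI ballI)
  show "bilinear_map R N L P (\<lambda>n l. \<beta> (\<gamma> m n) l)" if m: "m \<in> carrier M" for m
    by (rule bilinear_map_precompose[OF assms(1) bilinear_map_right[OF assms(2) m] linear_maps_id])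
  show "(\<lambda>m. \<beta> (\<gamma> m n) l) \<in> linear_maps R M P" if nl: "n \<in> carrier N" "l \<in> carrier L" for n l
    by (rule linear_maps_compose[OF bilinear_map_left[OF assms(2) nl(1)] bilinear_map_left[OF assms(1) nl(2)]])
qed

lemma (in cring) trilinear_map_free_ext:
  assumes P: "module R P"
    and h: "trilinear_map R (free_module R X) (free_module R Y) (free_module R Z) P h"
    and k: "trilinear_map R (free_module R X) (free_module R Y) (free_module R Z) P k"
    and eq: "\<And>x y z. \<lbrakk>x \<in> X; y \<in> Y; z \<in> Z\<rbrakk>
      \<Longrightarrow> h (basis_vec R x) (basis_vec R y) (basis_vec R z) = k (basis_vec R x) (basis_vec R y) (basis_vec R z)"
    and uvw: "u \<in> carrier (free_module R X)" "v \<in> carrier (free_module R Y)" "w \<in> carrier (free_module R Z)"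
  shows "h u v w = k u v w"
proof -
  have "h (basis_vec R x) v w = k (basis_vec R x) v w" if x: "x \<in> X" for x
  proof (rule bilinear_map_free_ext[where \<beta> = "h (basis_vec R x)" and \<gamma> = "k (basis_vec R x)", OF P])
    show "bilinear_map R (free_module R Y) (free_module R Z) P (h (basis_vec R x))"
      "bilinear_map R (free_module R Y) (free_module R Z) P (k (basis_vec R x))"
      using h k basis_vec_closed[OF x] unfolding trilinear_map_def by blast+
  qed (use x eq uvw in blast)+
  moreover have "(\<lambda>u. h u v w) \<in> linear_maps R (free_module R X) P"
    "(\<lambda>u. k u v w) \<in> linear_maps R (free_module R X) P"
    using h k uvw unfolding trilinear_map_def by blast+
  ultimately show ?thesis by (rule linear_maps_free_ext[OF P _ _ _ uvw(1), rotated 2])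
qed

lemma (in abelian_monoid) finsum_single:
  assumes "finite I" "i \<in> I" "f i \<in> carrier G" "\<And>j. \<lbrakk>j \<in> I; j \<noteq> i\<rbrakk> \<Longrightarrow> f j = \<zero>"
  shows "(\<Oplus>j\<in>I. f j) = f i"
proof -
  have "f j \<in> carrier G" if "j \<in> I" for j using assms(3,4) that by (cases "j = i") auto
  then have "(\<Oplus>j\<in>I. f j) = (\<Oplus>j\<in>{i}. f j)"
    using assms by (intro add.finprod_mono_neutral_cong_right) auto
  then show ?thesis using assms by simp
qed

section \<open>Wide subcategories\<close>

lemma bilinear_map_restrict:
  assumes "bilinear_map R M N P \<beta>" "HM \<subseteq> carrier M" "HN \<subseteq> carrier N"
    and "\<And>m n. \<lbrakk>m \<in> HM; n \<in> HN\<rbrakk> \<Longrightarrow> \<beta> m n \<in> HP"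
  shows "bilinear_map R (M\<lparr>carrier := HM\<rparr>) (N\<lparr>carrier := HN\<rparr>) (P\<lparr>carrier := HP\<rparr>) \<beta>"
proof (rule bilinear_mapI)
  fix m assume "m \<in> carrier (M\<lparr>carrier := HM\<rparr>)"
  then have m: "m \<in> HM" "m \<in> carrier M" using assms(2) by auto
  show "\<beta> m \<in> linear_maps R (N\<lparr>carrier := HN\<rparr>) (P\<lparr>carrier := HP\<rparr>)"
    using m assms(3,4) linear_map_add[OF bilinear_map_right[OF assms(1) m(2)]]
      linear_map_smult[OF bilinear_map_right[OF assms(1) m(2)]]
    by (intro linear_mapsI) (simp_all add: subset_iff)
next
  fix n assume "n \<in> carrier (N\<lparr>carrier := HN\<rparr>)"
  then have n: "n \<in> HN" "n \<in> carrier N" using assms(3) by auto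
  show "(\<lambda>m. \<beta> m n) \<in> linear_maps R (M\<lparr>carrier := HM\<rparr>) (P\<lparr>carrier := HP\<rparr>)"
    using n assms(2,4) linear_map_add[OF bilinear_map_left[OF assms(1) n(2)]]
      linear_map_smult[OF bilinear_map_left[OF assms(1) n(2)]]
    by (intro linear_mapsI) (simp_all add: subset_iff)
qed

lemma wide_subcat_sel [simp]:
  "Obj (wide_subcat C H) = Obj C"
  "Mor (wide_subcat C H) x y = (Mor C x y)\<lparr>carrier := H x y\<rparr>"
  "Ident (wide_subcat C H) = Ident C"
  "Cmp (wide_subcat C H) = Cmp C"
  by (simp_all add: wide_subcat_def)

context linear_category
begin

context
  fixes H assumes H: "wide_linear_subcategory R C H"
begin

lemma wide_sub: "\<lbrakk>x \<in> Obj C; y \<in> Obj C\<rbrakk> \<Longrightarrow> H x y \<subseteq> carrier (Mor C x y)"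
  using module.submoduleE(1)[OF Mor_module] H unfolding wide_linear_subcategory_def by blast

lemma wide_module: "\<lbrakk>x \<in> Obj C; y \<in> Obj C\<rbrakk> \<Longrightarrow> module R ((Mor C x y)\<lparr>carrier := H x y\<rparr>)"
  using submodule.submodule_is_module[OF _ Mor_module] H unfolding wide_linear_subcategory_def by blast

lemma wide_Cmp: "\<lbrakk>x \<in> Obj C; y \<in> Obj C; z \<in> Obj C; f \<in> H y z; g \<in> H x y\<rbrakk> \<Longrightarrow> Cmp C x y z f g \<in> H x z"
  using H unfolding wide_linear_subcategory_def by blast

lemma wide_Ident: "x \<in> Obj C \<Longrightarrow> Ident C x \<in> H x x"
  using H unfolding wide_linear_subcategory_def by blast

lemma wide_subcat_linear_category: "linear_category R (wide_subcat C H)"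
proof (intro linear_category.intro linear_category_axioms.intro)
  show "cring R" by (rule is_cring)
  show "bilinear_map R (Mor (wide_subcat C H) y z) (Mor (wide_subcat C H) x y)
      (Mor (wide_subcat C H) x z) (Cmp (wide_subcat C H) x y z)"
    if "x \<in> Obj (wide_subcat C H)" "y \<in> Obj (wide_subcat C H)" "z \<in> Obj (wide_subcat C H)" for x y z
    using that by (simp add: bilinear_map_restrict[OF Cmp_bilinear] wide_sub wide_Cmp)
qed (simp_all add: wide_module wide_Ident subsetD[OF wide_sub] Cmp_assoc Cmp_Ident_left Cmp_Ident_right)

end

lemma subcat_bimod_sel [simp]:
  "BMod (subcat_bimod C i H) = (\<lambda>x y. (Mor C x y)\<lparr>carrier := H x y\<rparr>)"
  "LAct (subcat_bimod C i H) x y z a m = Cmp C x y z (i y z a) m"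
  "RAct (subcat_bimod C i H) x y z m a = Cmp C x y z m (i x y a)"
  by (simp_all add: subcat_bimod_def fun_eq_iff)

text \<open>The embedding \<open>i\<close> acts as the identity on elements, so both actions are
  composition and the axioms are inherited from \<open>C\<close>.\<close>

lemma subcat_bimodule:
  assumes H0: "wide_linear_subcategory R C H0" and H: "wide_linear_subcategory R C H"
    and sub: "\<And>x y. H0 x y \<subseteq> H x y" and i: "\<And>x y v. i x y v = v"
  shows "bimodule R (wide_subcat C H0) (subcat_bimod C i H)"
proof -
  note closed = wide_Cmp[OF H] subsetD[OF sub] subsetD[OF wide_sub[OF H]]
    subsetD[OF wide_sub[OF H], OF _ _ subsetD[OF sub]]
  have "bilinear_map R ((Mor C y z)\<lparr>carrier := H0 y z\<rparr>) ((Mor C x y)\<lparr>carrier := H x y\<rparr>)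
      ((Mor C x z)\<lparr>carrier := H x z\<rparr>) (Cmp C x y z)"
    if "x \<in> Obj C" "y \<in> Obj C" "z \<in> Obj C" for x y z
    using that by (intro bilinear_map_restrict[OF Cmp_bilinear] wide_sub[OF H] wide_sub[OF H0])
      (auto intro: closed)
  moreover have "bilinear_map R ((Mor C y z)\<lparr>carrier := H y z\<rparr>) ((Mor C x y)\<lparr>carrier := H0 x y\<rparr>)
      ((Mor C x z)\<lparr>carrier := H x z\<rparr>) (Cmp C x y z)"
    if "x \<in> Obj C" "y \<in> Obj C" "z \<in> Obj C" for x y z
    using that by (intro bilinear_map_restrict[OF Cmp_bilinear] wide_sub[OF H] wide_sub[OF H0])
      (auto intro: closed)
  moreover have "LAct (subcat_bimod C i H) x y z = Cmp C x y z" "RAct (subcat_bimod C i H) x y z = Cmp C x y z" for x y z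
    by (simp_all add: fun_eq_iff i)
  ultimately show ?thesis
    by (intro bimodule.intro bimodule_axioms.intro wide_subcat_linear_category[OF H0])
       (simp_all add: wide_module[OF H] closed Cmp_assoc Cmp_Ident_left Cmp_Ident_right)
qed

end

section \<open>The Brauer category\<close>

locale brauer = cring R for R :: "('k, 'r) ring_scheme" (structure) +
  fixes \<delta> :: 'k
  assumes delta_closed: "\<delta> \<in> carrier R"
begin

abbreviation "B \<equiv> brauer_cat R \<delta>"
abbreviation "S \<equiv> level_cat R \<delta>"
abbreviation "F \<equiv> free_module R"
abbreviation "e \<equiv> basis_vec R"
abbreviation "cmp \<equiv> Cmp B"

lemma brauer_cat_sel [simp]:
  "Obj B = UNIV" "Mor B p q = F (brauer_diagrams p q)" "Ident B p = e (identity_diagram p)"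
  by (simp_all add: brauer_cat_def)

lemma cmp_def:
  "cmp p q r f g = lin_ext R (F (brauer_diagrams p r)) (\<lambda>D. lin_ext R (F (brauer_diagrams p r))
     (\<lambda>E. (\<delta> [^] loop_count D E) \<odot>\<^bsub>F (brauer_diagrams p r)\<^esub> e (D \<diamondop> E)) g) f"
  unfolding brauer_cat_def Let_def by simp

lemma F_module: "module R (F X)"
  by (rule free_module_is_module)

lemma scaled_basis_closed: "D \<in> X \<Longrightarrow> (\<delta> [^] (n::nat)) \<odot>\<^bsub>F X\<^esub> e D \<in> carrier (F X)"
  by (intro module.smult_closed[OF F_module] basis_vec_closed nat_pow_closed delta_closed)

lemma cmp_basis:
  assumes "D \<in> brauer_diagrams q r" "E \<in> brauer_diagrams p q"
  shows "cmp p q r (e D) (e E) = (\<delta> [^] loop_count D E) \<odot>\<^bsub>F (brauer_diagrams p r)\<^esub> e (D \<diamondop> E)"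
  unfolding cmp_def
  by (rule lin_ext_lin_ext_basis_vec[OF F_module]) (rule scaled_basis_closed[OF diagram_comp_brauer[OF assms]])

lemma basis_scale_one: "\<one> \<odot>\<^bsub>F X\<^esub> e D = e D"
  by (auto simp: basis_vec_def)

text \<open>No closed loop can form with an upward lower factor, so the power of
  \<open>\<delta>\<close> is 1.\<close>

lemma cmp_basis_upward:
  "\<lbrakk>D \<in> upward_diagrams q r; E \<in> brauer_diagrams p q\<rbrakk> \<Longrightarrow> cmp p q r (e D) (e E) = e (D \<diamondop> E)"
  by (simp only: cmp_basis[OF upward_brauer] loop_count_upward nat_pow_0 basis_scale_one)

lemma cmp_basis_downward:
  "\<lbrakk>D \<in> brauer_diagrams q r; E \<in> downward_diagrams p q\<rbrakk> \<Longrightarrow> cmp p q r (e D) (e E) = e (D \<diamondop> E)"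
  by (simp only: cmp_basis[OF _ downward_brauer] loop_count_downward nat_pow_0 basis_scale_one)

lemma cmp_bilinear:
  "bilinear_map R (F (brauer_diagrams q r)) (F (brauer_diagrams p q)) (F (brauer_diagrams p r)) (cmp p q r)"
proof -
  have "cmp p q r = (\<lambda>f g. lin_ext R (F (brauer_diagrams p r)) (\<lambda>D. lin_ext R (F (brauer_diagrams p r))
     (\<lambda>E. (\<delta> [^] loop_count D E) \<odot>\<^bsub>F (brauer_diagrams p r)\<^esub> e (D \<diamondop> E)) g) f)"
    by (rule ext, rule ext, rule cmp_def)
  then show ?thesis
    by (simp only:) (rule lin_ext_lin_ext_bilinear[OF F_module], rule scaled_basis_closed, rule diagram_comp_brauer)
qed

lemma F_inclusion: "X \<subseteq> Y \<Longrightarrow> (\<lambda>v. v) \<in> linear_maps R (F X) (F Y)"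
  by (rule linear_maps_free_upcast[OF is_cring linear_maps_id])

lemma bilinear_map_upcast: "\<lbrakk>bilinear_map R M N (F X) \<beta>; X \<subseteq> Y\<rbrakk> \<Longrightarrow> bilinear_map R M N (F Y) \<beta>"
  using bilinear_map_compose[OF _ F_inclusion] .

text \<open>\<open>cmp\<close> takes its sums in the module of all diagrams. The same formula over
  \<open>Z\<close> agrees with it on diagrams, hence everywhere, which places the values in the
  smaller module.\<close>

lemma cmp_bilinear_sub:
  assumes X: "X \<subseteq> brauer_diagrams q r" and Y: "Y \<subseteq> brauer_diagrams p q" and Z: "Z \<subseteq> brauer_diagrams p r"
    and closed: "\<And>D E. \<lbrakk>D \<in> X; E \<in> Y\<rbrakk> \<Longrightarrow> D \<diamondop> E \<in> Z"
  shows "bilinear_map R (F X) (F Y) (F Z) (cmp p q r)"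
proof -
  let ?\<beta> = "\<lambda>f g. lin_ext R (F Z) (\<lambda>D. lin_ext R (F Z) (\<lambda>E. (\<delta> [^] loop_count D E) \<odot>\<^bsub>F Z\<^esub> e (D \<diamondop> E)) g) f"
  have 1: "bilinear_map R (F X) (F Y) (F Z) ?\<beta>"
    by (rule lin_ext_lin_ext_bilinear[OF F_module], rule scaled_basis_closed, rule closed)
  have 2: "bilinear_map R (F X) (F Y) (F (brauer_diagrams p r)) (cmp p q r)"
    by (rule bilinear_map_precompose[OF cmp_bilinear F_inclusion[OF X] F_inclusion[OF Y]])
  have b: "?\<beta> (e D) (e E) = (\<delta> [^] loop_count D E) \<odot>\<^bsub>F Z\<^esub> e (D \<diamondop> E)" if "D \<in> X" "E \<in> Y" for D E
    by (rule lin_ext_lin_ext_basis_vec[OF F_module]) (rule scaled_basis_closed[OF closed[OF that]])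
  have eq: "?\<beta> v w = cmp p q r v w" if v: "v \<in> carrier (F X)" and w: "w \<in> carrier (F Y)" for v w
    by (rule bilinear_map_free_ext[OF F_module bilinear_map_upcast[OF 1 Z] 2 _ v w])
       (simp only: b cmp_basis[OF subsetD[OF X] subsetD[OF Y]], simp only: free_module_sel)
  show ?thesis
  proof (rule bilinear_mapI)
    show "cmp p q r v \<in> linear_maps R (F Y) (F Z)" if v: "v \<in> carrier (F X)" for v
      by (rule linear_maps_cong[OF bilinear_map_right[OF 1 v] _ F_module]) (rule eq[OF v, symmetric])
    show "(\<lambda>v. cmp p q r v w) \<in> linear_maps R (F X) (F Z)" if w: "w \<in> carrier (F Y)" for w
      by (rule linear_maps_cong[OF bilinear_map_left[OF 1 w] _ F_module]) (rule eq[OF _ w, symmetric])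
  qed
qed

lemma cmp_scale:
  "\<lbrakk>a \<in> carrier R; v \<in> carrier (F (brauer_diagrams q r)); w \<in> carrier (F (brauer_diagrams p q))\<rbrakk>
    \<Longrightarrow> cmp p q r (a \<odot>\<^bsub>F (brauer_diagrams q r)\<^esub> v) w = a \<odot>\<^bsub>F (brauer_diagrams p r)\<^esub> cmp p q r v w"
  "\<lbrakk>a \<in> carrier R; v \<in> carrier (F (brauer_diagrams q r)); w \<in> carrier (F (brauer_diagrams p q))\<rbrakk>
    \<Longrightarrow> cmp p q r v (a \<odot>\<^bsub>F (brauer_diagrams p q)\<^esub> w) = a \<odot>\<^bsub>F (brauer_diagrams p r)\<^esub> cmp p q r v w"
  using linear_map_smult[OF bilinear_map_left[OF cmp_bilinear]]
    linear_map_smult[OF bilinear_map_right[OF cmp_bilinear]] by blast+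

lemma cmp_assoc:
  assumes "f \<in> carrier (F (brauer_diagrams q r))" "g \<in> carrier (F (brauer_diagrams p q))"
    "h \<in> carrier (F (brauer_diagrams n p))"
  shows "cmp n p r (cmp p q r f g) h = cmp n q r f (cmp n p q g h)"
proof (rule trilinear_map_free_ext[OF F_module trilinear_map_nest_left[OF cmp_bilinear cmp_bilinear]
      trilinear_map_nest_right[OF cmp_bilinear cmp_bilinear] _ assms])
  fix D E G
  assume d: "D \<in> brauer_diagrams q r" "E \<in> brauer_diagrams p q" "G \<in> brauer_diagrams n p"
  note pow = nat_pow_closed[OF delta_closed]
  note DE = diagram_comp_brauer[OF d(1,2)] and EG = diagram_comp_brauer[OF d(2,3)]
  have "cmp n p r (cmp p q r (e D) (e E)) (e G) =
      (\<delta> [^] loop_count D E) \<odot>\<^bsub>F (brauer_diagrams n r)\<^esub>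
        ((\<delta> [^] loop_count (D \<diamondop> E) G) \<odot>\<^bsub>F (brauer_diagrams n r)\<^esub> e (D \<diamondop> E \<diamondop> G))"
    by (simp only: cmp_basis d DE cmp_scale(1)[OF pow basis_vec_closed basis_vec_closed])
  also have "\<dots> = (\<delta> [^] (loop_count D E + loop_count (D \<diamondop> E) G)) \<odot>\<^bsub>F (brauer_diagrams n r)\<^esub> e (D \<diamondop> E \<diamondop> G)"
    unfolding nat_pow_mult[OF delta_closed, symmetric]
    by (rule module.smult_assoc1[OF F_module pow pow basis_vec_closed[OF diagram_comp_brauer[OF DE d(3)]], symmetric])
  \<comment> \<open>The two bracketings meet here: the resulting diagrams agree, and so do the total
    numbers of loops.\<close>
  also have "\<dots> = (\<delta> [^] (loop_count E G + loop_count D (E \<diamondop> G))) \<odot>\<^bsub>F (brauer_diagrams n r)\<^esub> e (D \<diamondop> (E \<diamondop> G))"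
    unfolding diagram_comp_assoc using loop_count_assoc[OF d[THEN finite_brauer_Union]] by simp
  also have "\<dots> = (\<delta> [^] loop_count E G) \<odot>\<^bsub>F (brauer_diagrams n r)\<^esub>
        ((\<delta> [^] loop_count D (E \<diamondop> G)) \<odot>\<^bsub>F (brauer_diagrams n r)\<^esub> e (D \<diamondop> (E \<diamondop> G)))"
    unfolding nat_pow_mult[OF delta_closed, symmetric]
    by (rule module.smult_assoc1[OF F_module pow pow basis_vec_closed[OF diagram_comp_brauer[OF d(1) EG]]])
  also have "\<dots> = cmp n q r (e D) (cmp n p q (e E) (e G))"
    by (simp only: cmp_basis d EG cmp_scale(2)[OF pow basis_vec_closed basis_vec_closed])
  finally show "cmp n p r (cmp p q r (e D) (e E)) (e G) = cmp n q r (e D) (cmp n p q (e E) (e G))" .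
qed

lemma brauer_linear_category: "linear_category R B"
proof (intro linear_category.intro linear_category_axioms.intro is_cring)
  show "module R (Mor B p q)" for p q by (simp add: F_module)
  show "Ident B p \<in> carrier (Mor B p p)" for p using basis_vec_closed[OF identity_brauer] by simp
  show "bilinear_map R (Mor B q r) (Mor B p q) (Mor B p r) (cmp p q r)" for p q r
    by (simp add: cmp_bilinear)
  show "cmp n p r (cmp p q r f g) h = cmp n q r f (cmp n p q g h)"
    if "f \<in> carrier (Mor B q r)" "g \<in> carrier (Mor B p q)" "h \<in> carrier (Mor B n p)" for n p q r f g h
    using that by (simp only: brauer_cat_sel cmp_assoc)
  fix p q f assume "f \<in> carrier (Mor B p q)"
  then have f: "f \<in> carrier (F (brauer_diagrams p q))" by simp
  have id: "e (identity_diagram p) \<in> carrier (F (brauer_diagrams p p))" for p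
    by (rule basis_vec_closed[OF identity_brauer])
  show "cmp p q q (Ident B q) f = f"
    unfolding brauer_cat_sel
    by (rule linear_maps_free_ext[OF F_module bilinear_map_right[OF cmp_bilinear id] linear_maps_id _ f])
       (simp only: cmp_basis_upward[OF level_upward[OF identity_level]] identity_comp)
  show "cmp p p q f (Ident B p) = f"
    unfolding brauer_cat_sel
    by (rule linear_maps_free_ext[OF F_module bilinear_map_left[OF cmp_bilinear id] linear_maps_id _ f])
       (simp only: cmp_basis_downward[OF _ level_downward[OF identity_level]] comp_identity)
qed

sublocale B: linear_category R B
  by (rule brauer_linear_category)

text \<open>The generating set enters the record of a free module through its carrier only. The
  morphism modules of the subcategories are therefore literally free modules.\<close>

lemma F_carrier_update [simp]: "F X\<lparr>carrier := carrier (F Y)\<rparr> = F Y"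
  by (simp add: free_module_def)

lemma F_submodule: "X \<subseteq> Y \<Longrightarrow> submodule (carrier (F X)) R (F Y)"
  by (rule module.module_incl_imp_submodule[OF F_module free_module_mono]) (simp_all add: F_module)

lemma spanned_wide:
  assumes "\<And>p q. X p q \<subseteq> brauer_diagrams p q" "\<And>p. identity_diagram p \<in> X p p"
    and "\<And>p q r D E. \<lbrakk>D \<in> X q r; E \<in> X p q\<rbrakk> \<Longrightarrow> D \<diamondop> E \<in> X p r"
  shows "wide_linear_subcategory R B (spanned R X)"
  unfolding wide_linear_subcategory_def spanned_def
proof (intro conjI ballI)
  show "submodule (carrier (F (X p q))) R (Mor B p q)" for p q
    using F_submodule[OF assms(1)] by simp
  show "Ident B p \<in> carrier (F (X p p))" for p using basis_vec_closed[OF assms(2)] by simp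
  show "cmp p q r f g \<in> carrier (F (X p r))" if "f \<in> carrier (F (X q r))" "g \<in> carrier (F (X p q))" for p q r f g
    by (rule bilinear_map_closed[OF cmp_bilinear_sub that]) (rule assms(1) assms(3); assumption?)+
qed

lemma wide_level: "wide_linear_subcategory R B (spanned R level_diagrams)"
  by (rule spanned_wide) (auto intro: level_brauer identity_level level_comp)

lemma wide_upward: "wide_linear_subcategory R B (spanned R upward_diagrams)"
  by (rule spanned_wide) (auto intro: upward_brauer level_upward[OF identity_level] upward_comp)

lemma wide_downward: "wide_linear_subcategory R B (spanned R downward_diagrams)"
  by (rule spanned_wide) (auto intro: downward_brauer level_downward[OF identity_level] downward_comp)

lemma level_cat_sel [simp]:
  "Obj S = UNIV" "Mor S p q = F (level_diagrams p q)" "Ident S p = e (identity_diagram p)" "Cmp S = cmp"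
  unfolding level_cat_def by (simp_all add: spanned_def)

sublocale S: linear_category R S
  unfolding level_cat_def by (rule B.wide_subcat_linear_category[OF wide_level])

abbreviation "P \<equiv> brauer_plus R \<delta>"
abbreviation "M \<equiv> brauer_minus R \<delta>"
abbreviation "I \<equiv> regular_bimod S"

lemma bimod_sel [simp]:
  "BMod P p q = F (upward_diagrams p q)" "LAct P p q r = cmp p q r" "RAct P p q r = cmp p q r"
  "BMod M p q = F (downward_diagrams p q)" "LAct M p q r = cmp p q r" "RAct M p q r = cmp p q r"
  "BMod I p q = F (level_diagrams p q)" "LAct I p q r = cmp p q r" "RAct I p q r = cmp p q r"
  by (simp_all add: brauer_plus_def brauer_minus_def spanned_def level_inclusion_def regular_bimod_def fun_eq_iff)

sublocale P: bimodule R S P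
  unfolding level_cat_def brauer_plus_def
proof (rule B.subcat_bimodule[OF wide_level wide_upward])
  show "spanned R level_diagrams p q \<subseteq> spanned R upward_diagrams p q" for p q
    unfolding spanned_def by (rule free_module_mono) (auto intro: level_upward)
qed (simp add: level_inclusion_def)

sublocale M: bimodule R S M
  unfolding level_cat_def brauer_minus_def
proof (rule B.subcat_bimodule[OF wide_level wide_downward])
  show "spanned R level_diagrams p q \<subseteq> spanned R downward_diagrams p q" for p q
    unfolding spanned_def by (rule free_module_mono) (auto intro: level_downward)
qed (simp add: level_inclusion_def)

sublocale I: bimodule R S I
  by (rule S.regular_bimodule)

end

text \<open>The source of the upward factor depends on \<open>D\<close>, hence a pair is
  chosen.\<close>

definition upper_factor :: "nat \<Rightarrow> diagram \<Rightarrow> nat \<times> diagram" where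
  "upper_factor q D = (SOME (s, E). E \<in> upward_diagrams s q \<and> monotone_diagram E \<and> bb E = bb D)"

lemma upper_factor:
  assumes "D \<in> brauer_diagrams p q"
  obtains s E where "upper_factor q D = (s, E)" "E \<in> upward_diagrams s q" "monotone_diagram E" "bb E = bb D"
proof -
  have "case upper_factor q D of (s, E) \<Rightarrow> E \<in> upward_diagrams s q \<and> monotone_diagram E \<and> bb E = bb D"
    unfolding upper_factor_def
    by (rule someI_ex) (use monotone_upward_exists[OF assms] in auto)
  then show ?thesis using that by (cases "upper_factor q D") auto
qed

text \<open>Bilinearity of pure tensors carries agreement from basis vectors to all pure
  tensors.\<close>

lemma tensor_free_ext:
  fixes M :: "('o, 'k, 'a, 'x \<Rightarrow> 'k) bimod" and N :: "('o, 'k, 'a, 'y \<Rightarrow> 'k) bimod"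
  assumes pair: "bimodule_pair R A M N" and P: "module R P"
    and h: "h \<in> linear_maps R (tensor_mod R A M N x z) P" and k: "k \<in> linear_maps R (tensor_mod R A M N x z) P"
    and X: "\<And>y. y \<in> Obj A \<Longrightarrow> BMod M y z = free_module R (X y)"
    and Y: "\<And>y. y \<in> Obj A \<Longrightarrow> BMod N x y = free_module R (Y y)"
    and eq: "\<And>y f g. \<lbrakk>y \<in> Obj A; f \<in> X y; g \<in> Y y\<rbrakk>
      \<Longrightarrow> h (pure_tensor R A M N x z y (basis_vec R f) (basis_vec R g))
        = k (pure_tensor R A M N x z y (basis_vec R f) (basis_vec R g))"
    and xz: "x \<in> Obj A" "z \<in> Obj A" and t: "t \<in> carrier (tensor_mod R A M N x z)"
  shows "h t = k t"
proof -
  interpret bimodule_pair R A M N by (rule pair)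
  show ?thesis
  proof (rule tensor_ext[OF xz P h k _ t])
    fix y m n assume y: "y \<in> Obj A" and m: "m \<in> carrier (BMod M y z)" and n: "n \<in> carrier (BMod N x y)"
    note bil = bilinear_map_compose[OF balanced_bilinear[OF pure_balanced[OF xz] y], unfolded X[OF y] Y[OF y]]
    show "h (pure x z y m n) = k (pure x z y m n)"
      by (rule M.bilinear_map_free_ext[OF P bil[OF h] bil[OF k] eq[OF y] m[unfolded X[OF y]] n[unfolded Y[OF y]]])
  qed
qed

context brauer
begin

sublocale PM: bimodule_pair R S P M ..
sublocale MP: bimodule_pair R S M P ..
sublocale II: bimodule_pair R S I I ..

lemma Obj_S: "p \<in> Obj S"
  by simp

lemma F_upward: "v \<in> carrier (F (upward_diagrams p q)) \<Longrightarrow> v \<in> carrier (F (brauer_diagrams p q))"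
  by (erule subsetD[OF free_module_mono, rotated]) (auto intro: upward_brauer)

lemma F_downward: "v \<in> carrier (F (downward_diagrams p q)) \<Longrightarrow> v \<in> carrier (F (brauer_diagrams p q))"
  by (erule subsetD[OF free_module_mono, rotated]) (auto intro: downward_brauer)

lemma F_level: "v \<in> carrier (F (level_diagrams p q)) \<Longrightarrow> v \<in> carrier (F (brauer_diagrams p q))"
  by (erule subsetD[OF free_module_mono, rotated]) (auto intro: level_brauer)

lemma up_sub: "upward_diagrams p q \<subseteq> brauer_diagrams p q"
  and down_sub: "downward_diagrams p q \<subseteq> brauer_diagrams p q"
  and level_sub: "level_diagrams p q \<subseteq> brauer_diagrams p q"
  using upward_brauer downward_brauer level_brauer by auto

lemma level_up_closed: "\<lbrakk>D \<in> level_diagrams q r; E \<in> upward_diagrams p q\<rbrakk> \<Longrightarrow> D \<diamondop> E \<in> upward_diagrams p r"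
  and up_level_closed: "\<lbrakk>E \<in> upward_diagrams q r; D \<in> level_diagrams p q\<rbrakk> \<Longrightarrow> E \<diamondop> D \<in> upward_diagrams p r"
  and level_down_closed: "\<lbrakk>D \<in> level_diagrams q r; E' \<in> downward_diagrams p q\<rbrakk> \<Longrightarrow> D \<diamondop> E' \<in> downward_diagrams p r"
  and down_level_closed: "\<lbrakk>E' \<in> downward_diagrams q r; D \<in> level_diagrams p q\<rbrakk> \<Longrightarrow> E' \<diamondop> D \<in> downward_diagrams p r"
  by (auto intro: upward_comp downward_comp level_upward level_downward)

subsection \<open>Composition of upward after downward diagrams\<close>

abbreviation "cmap \<equiv> composition_map R B"

lemma comp_balanced: "balanced R S P M p r (F (brauer_diagrams p r)) (\<lambda>q f g. cmp p q r f g)"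
proof (rule balancedI)
  show "bilinear_map R (BMod P q r) (BMod M p q) (F (brauer_diagrams p r)) (cmp p q r)" for q
    unfolding bimod_sel
    by (rule cmp_bilinear_sub[OF up_sub down_sub subset_refl diagram_comp_brauer[OF upward_brauer downward_brauer]])
  fix q a m n
  assume "a \<in> carrier (Mor S q q)" "m \<in> carrier (BMod P q r)" "n \<in> carrier (BMod M p q)"
  then show "cmp p q r (RAct P q q r m a) n = cmp p q r m (LAct M p q q a n)"
    by (simp add: cmp_assoc F_upward F_downward F_level)
qed

lemma comp_linear: "cmap p r \<in> linear_maps R (PM.T p r) (F (brauer_diagrams p r))"
  unfolding composition_map_def brauer_cat_sel
  by (rule PM.tensor_lift_linear[OF Obj_S Obj_S F_module comp_balanced])

lemma comp_pure:
  "\<lbrakk>f \<in> carrier (F (upward_diagrams q r)); g \<in> carrier (F (downward_diagrams p q))\<rbrakk>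
    \<Longrightarrow> cmap p r (PM.pure p r q f g) = cmp p q r f g"
  unfolding composition_map_def brauer_cat_sel
  by (rule PM.tensor_lift_pure[OF Obj_S Obj_S F_module comp_balanced Obj_S]) simp_all

lemma PM_pure_closed:
  "\<lbrakk>f \<in> upward_diagrams q r; g \<in> downward_diagrams p q\<rbrakk> \<Longrightarrow> PM.pure p r q (e f) (e g) \<in> carrier (PM.T p r)"
  by (rule PM.pure_closed) simp_all

definition decompose where
  "decompose p r = lin_ext R (PM.T p r) (\<lambda>D. case upper_factor r D of (s, E) \<Rightarrow>
     PM.pure p r s (e E) (e (flip E \<diamondop> D)))"

lemma decompose_term_closed:
  assumes D: "D \<in> brauer_diagrams p r"
  shows "(case upper_factor r D of (s, E) \<Rightarrow> PM.pure p r s (e E) (e (flip E \<diamondop> D))) \<in> carrier (PM.T p r)"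
  by (rule upper_factor[OF D]) (simp add: PM_pure_closed upward_split(1)[OF _ D])

lemma decompose_linear: "decompose p r \<in> linear_maps R (F (brauer_diagrams p r)) (PM.T p r)"
  unfolding decompose_def
  by (rule lin_ext_linear[OF PM.tensor_module[OF Obj_S Obj_S] decompose_term_closed])

lemma decompose_basis:
  "D \<in> brauer_diagrams p r \<Longrightarrow>
    decompose p r (e D) = (case upper_factor r D of (s, E) \<Rightarrow> PM.pure p r s (e E) (e (flip E \<diamondop> D)))"
  unfolding decompose_def
  by (rule lin_ext_basis_vec[OF PM.tensor_module[OF Obj_S Obj_S]]) (rule decompose_term_closed)

lemma comp_decompose:
  assumes v: "v \<in> carrier (F (brauer_diagrams p r))"
  shows "cmap p r (decompose p r v) = v"
proof (rule linear_maps_free_ext[OF F_module linear_maps_compose[OF decompose_linear comp_linear] linear_maps_id _ v])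
  fix D assume D: "D \<in> brauer_diagrams p r"
  obtain s E where E: "upper_factor r D = (s, E)" "E \<in> upward_diagrams s r" "bb E = bb D"
    by (rule upper_factor[OF D])
  note split = upward_split[OF E(2) D E(3)]
  have "cmap p r (decompose p r (e D)) = cmp p s r (e E) (e (flip E \<diamondop> D))"
    unfolding decompose_basis[OF D] E(1) using E(2) split(1) by (simp add: comp_pure)
  also have "\<dots> = e D"
    unfolding cmp_basis_upward[OF E(2) downward_brauer[OF split(1)]] split(2) ..
  finally show "cmap p r (decompose p r (e D)) = e D" .
qed

text \<open>Factorisations of a diagram into an upward and a downward one differ by a permutation.\<close>

lemma pure_eq_of_comp_eq:
  assumes E: "E \<in> upward_diagrams s r" and G: "G \<in> downward_diagrams p s"
    and E': "E' \<in> upward_diagrams s' r" and G': "G' \<in> downward_diagrams p s'"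
    and eq: "E \<diamondop> G = E' \<diamondop> G'"
  shows "PM.pure p r s (e E) (e G) = PM.pure p r s' (e E') (e G')"
proof -
  have "bb E = bb E'"
    using bb_comp_downward[OF G upward_brauer[OF E]] bb_comp_downward[OF G' upward_brauer[OF E']] eq
    by (simp add: fun_eq_iff)
  moreover from this have "s' = s" using upward_same_cups_same_source[OF E E'] by simp
  ultimately have E': "E' \<in> upward_diagrams s r" and G': "G' \<in> downward_diagrams p s"
    and cups: "bb E = bb E'" using E' G' by simp_all
  \<comment> \<open>The connecting permutation. \<open>E\<close> and \<open>E'\<close> have the same
    bottom pairs, so splitting \<open>E'\<close> by \<open>E\<close> leaves a downward diagram
    between equal numbers of points, which is level.\<close>
  define t where "t = flip E \<diamondop> E'"
  have t: "t \<in> level_diagrams s s" "E \<diamondop> t = E'"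
    using upward_split[OF E upward_brauer[OF E'] cups] by (simp_all add: t_def downward_diag)
  have G_eq: "G = t \<diamondop> G'"
    by (rule upward_left_cancel[OF E downward_brauer[OF G]
          diagram_comp_brauer[OF level_brauer[OF t(1)] downward_brauer[OF G']]])
       (simp only: eq diagram_comp_assoc[symmetric] t(2))
  have "PM.pure p r s (RAct P s s r (e E) (e t)) (e G') = PM.pure p r s (e E) (LAct M p s s (e t) (e G'))"
    by (rule PM.pure_balance) (simp_all add: E G' t)
  then show ?thesis
    unfolding bimod_sel cmp_basis_upward[OF E level_brauer[OF t(1)]] t(2)
      cmp_basis_upward[OF level_upward[OF t(1)] downward_brauer[OF G']] G_eq[symmetric] \<open>s' = s\<close> by simp
qed

text \<open>The factorisation chosen by \<open>upper_factor\<close> may differ from the given one,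
  but both compose to the same diagram, so their pure tensors agree.\<close>

lemma decompose_comp_pure:
  assumes E: "E \<in> upward_diagrams s r" and G: "G \<in> downward_diagrams p s"
  shows "decompose p r (e (E \<diamondop> G)) = PM.pure p r s (e E) (e G)"
proof -
  have D: "E \<diamondop> G \<in> brauer_diagrams p r" by (rule diagram_comp_brauer[OF upward_brauer[OF E] downward_brauer[OF G]])
  obtain s' E' where E': "upper_factor r (E \<diamondop> G) = (s', E')" "E' \<in> upward_diagrams s' r" "bb E' = bb (E \<diamondop> G)"
    by (rule upper_factor[OF D])
  note split = upward_split[OF E'(2) D E'(3)]
  show ?thesis
    unfolding decompose_basis[OF D] E'(1) prod.case
    by (rule pure_eq_of_comp_eq[OF E'(2) split(1) E G split(2)])
qed

lemma decompose_comp: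
  assumes t: "t \<in> carrier (PM.T p r)"
  shows "decompose p r (cmap p r t) = t"
proof (rule tensor_free_ext[OF PM.bimodule_pair_axioms PM.tensor_module[OF Obj_S Obj_S]
      linear_maps_compose[OF comp_linear decompose_linear] linear_maps_id _ _ _ Obj_S Obj_S t])
  fix q f g assume f: "f \<in> upward_diagrams q r" and g: "g \<in> downward_diagrams p q"
  show "decompose p r (cmap p r (PM.pure p r q (e f) (e g))) = PM.pure p r q (e f) (e g)"
    by (simp only: comp_pure basis_vec_closed[OF f] basis_vec_closed[OF g]
        cmp_basis_upward[OF f downward_brauer[OF g]] decompose_comp_pure[OF f g])
qed simp_all

lemma comp_bij: "bij_betw (cmap p r) (carrier (PM.T p r)) (carrier (F (brauer_diagrams p r)))"
  by (rule bij_betw_byWitness[where f' = "decompose p r"])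
     (auto simp: decompose_comp comp_decompose linear_map_closed[OF comp_linear] linear_map_closed[OF decompose_linear])

subsection \<open>The twist and the pairing\<close>

lemma F_zero_closed: "(\<lambda>_. \<zero>) \<in> carrier (F X)"
  by (simp add: free_module_carrier_iff)

lemma twist_diagrams_closed:
  assumes "f \<in> downward_diagrams q r" "g \<in> upward_diagrams p q"
  shows "twist_diagrams R q f g \<in> carrier (F (brauer_diagrams p r))"
  using basis_vec_closed[OF diagram_comp_brauer[OF downward_brauer[OF assms(1)] upward_brauer[OF assms(2)]]]
  by (simp add: twist_diagrams_def F_zero_closed)

abbreviation "bilinear_twist p q r f g \<equiv> lin_ext R (F (brauer_diagrams p r))
  (\<lambda>D. lin_ext R (F (brauer_diagrams p r)) (\<lambda>E. twist_diagrams R q D E) g) f"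

lemma bilinear_twist:
  "bilinear_map R (F (downward_diagrams q r)) (F (upward_diagrams p q)) (F (brauer_diagrams p r)) (bilinear_twist p q r)"
  by (rule lin_ext_lin_ext_bilinear[OF F_module twist_diagrams_closed])

lemma bilinear_twist_basis:
  "\<lbrakk>f \<in> downward_diagrams q r; g \<in> upward_diagrams p q\<rbrakk> \<Longrightarrow> bilinear_twist p q r (e f) (e g) = twist_diagrams R q f g"
  by (rule lin_ext_lin_ext_basis_vec[OF F_module]) (rule twist_diagrams_closed)

text \<open>On diagrams this is \<open>twist_conflict_balance\<close> together with
  associativity.\<close>

lemma twist_balanced: "balanced R S M P p r (F (brauer_diagrams p r)) (\<lambda>q. bilinear_twist p q r)"
proof (rule balancedI)
  show "bilinear_map R (BMod M q r) (BMod P p q) (F (brauer_diagrams p r)) (bilinear_twist p q r)" for q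
    unfolding bimod_sel by (rule bilinear_twist)
  fix q a m n
  assume "a \<in> carrier (Mor S q q)" "m \<in> carrier (BMod M q r)" "n \<in> carrier (BMod P p q)"
  then have amn: "m \<in> carrier (F (downward_diagrams q r))" "a \<in> carrier (F (level_diagrams q q))"
    "n \<in> carrier (F (upward_diagrams p q))" by simp_all
  show "bilinear_twist p q r (RAct M q q r m a) n = bilinear_twist p q r m (LAct P p q q a n)"
    unfolding bimod_sel
  proof (rule trilinear_map_free_ext[OF F_module
        trilinear_map_nest_left[OF bilinear_twist cmp_bilinear_sub[OF down_sub level_sub down_sub down_level_closed]]
        trilinear_map_nest_right[OF bilinear_twist cmp_bilinear_sub[OF level_sub up_sub up_sub level_up_closed]] _ amn])
    fix f s g assume f: "f \<in> downward_diagrams q r" and s: "s \<in> level_diagrams q q" and g: "g \<in> upward_diagrams p q"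
    show "bilinear_twist p q r (cmp q q r (e f) (e s)) (e g) = bilinear_twist p q r (e f) (cmp p q q (e s) (e g))"
      unfolding cmp_basis_downward[OF downward_brauer[OF f] level_downward[OF s]]
        cmp_basis_upward[OF level_upward[OF s] upward_brauer[OF g]]
        bilinear_twist_basis[OF down_level_closed[OF f s] g] bilinear_twist_basis[OF f level_up_closed[OF s g]]
      unfolding twist_diagrams_def twist_conflict_balance[OF downward_brauer[OF f] upward_brauer[OF g] s]
        diagram_comp_assoc ..
  qed
qed

lemma twist_to_brauer_linear: "twist_to_brauer R \<delta> p r \<in> linear_maps R (MP.T p r) (F (brauer_diagrams p r))"
  unfolding twist_to_brauer_def Let_def brauer_cat_sel
  by (rule MP.tensor_lift_linear[OF Obj_S Obj_S F_module twist_balanced])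

lemma twist_to_brauer_basis:
  assumes "f \<in> downward_diagrams q r" "g \<in> upward_diagrams p q"
  shows "twist_to_brauer R \<delta> p r (MP.pure p r q (e f) (e g)) = twist_diagrams R q f g"
  unfolding twist_to_brauer_def Let_def brauer_cat_sel bilinear_twist_basis[OF assms, symmetric]
  by (rule MP.tensor_lift_pure[OF Obj_S Obj_S F_module twist_balanced Obj_S]) (simp_all add: assms)

text \<open>\<open>decompose\<close> is a two-sided inverse of the composition map, so it can take
  the place of \<open>inv_into\<close>.\<close>

lemma twist_decompose: "t \<in> carrier (MP.T p r) \<Longrightarrow> twist R \<delta> p r t = decompose p r (twist_to_brauer R \<delta> p r t)"
  unfolding twist_def
  by (rule inv_into_f_eq[OF bij_betw_imp_inj_on[OF comp_bij]
        linear_map_closed[OF decompose_linear] comp_decompose]) (erule linear_map_closed[OF twist_to_brauer_linear])+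

lemma cmp_zero:
  "v \<in> carrier (F (brauer_diagrams p q)) \<Longrightarrow> cmp p q r (\<lambda>_. \<zero>) v = (\<lambda>_. \<zero>)"
  "w \<in> carrier (F (brauer_diagrams q r)) \<Longrightarrow> cmp p q r w (\<lambda>_. \<zero>) = (\<lambda>_. \<zero>)"
  using linear_map_zero[OF F_module F_module bilinear_map_left[OF cmp_bilinear]]
    linear_map_zero[OF F_module F_module bilinear_map_right[OF cmp_bilinear]]
  by (simp_all add: free_module_sel(1))

lemma F_level_off_diagonal: "\<lbrakk>p \<noteq> q; a \<in> carrier (F (level_diagrams p q))\<rbrakk> \<Longrightarrow> a = (\<lambda>_. \<zero>)"
  by (simp add: level_diagrams_empty free_module_empty[OF ring_axioms])

abbreviation "aug \<equiv> brauer_augmentation R"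

lemma aug_diag: "aug p p = (\<lambda>v. v)"
  and aug_off_diag: "p \<noteq> q \<Longrightarrow> aug p q = (\<lambda>v _. \<zero>)"
  by (simp_all add: brauer_augmentation_def fun_eq_iff)

lemma aug_linear:
  assumes "\<And>p. X p p = level_diagrams p p"
  shows "aug p q \<in> linear_maps R (F (X p q)) (F (level_diagrams p q))"
proof (cases "p = q")
  case True
  then show ?thesis using assms by (simp add: aug_diag linear_maps_id)
next
  case False
  then show ?thesis using linear_maps_zero[OF F_module] by (simp add: aug_off_diag)
qed

text \<open>Both sides vanish unless \<open>x = y = z\<close>: otherwise either \<open>a\<close> is
  zero or the augmentation is.\<close>

lemma aug_cmp_left:
  assumes a: "a \<in> carrier (F (level_diagrams y z))" and m: "m \<in> carrier (F (brauer_diagrams x y))"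
  shows "aug x z (cmp x y z a m) = cmp x y z a (aug x y m)"
proof (cases "y = z")
  case True
  then show ?thesis using a m by (cases "x = y") (simp_all add: aug_diag aug_off_diag cmp_zero F_level)
next
  case False
  then have "a = (\<lambda>_. \<zero>)" using a by (rule F_level_off_diagonal)
  then show ?thesis
    using m by (cases "x = y") (simp_all add: cmp_zero brauer_augmentation_def F_zero_closed)
qed

lemma aug_cmp_right:
  assumes b: "b \<in> carrier (F (level_diagrams w x))" and m: "m \<in> carrier (F (brauer_diagrams x y))"
  shows "aug w y (cmp w x y m b) = cmp w x y (aug x y m) b"
proof (cases "w = x")
  case True
  then show ?thesis using b m by (cases "x = y") (simp_all add: aug_diag aug_off_diag cmp_zero F_level)
next
  case False
  then have "b = (\<lambda>_. \<zero>)" using b by (rule F_level_off_diagonal)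
  then show ?thesis
    using m by (cases "x = y") (simp_all add: cmp_zero brauer_augmentation_def F_zero_closed)
qed

lemma aug_P: "bimod_map R S P I aug"
  by (rule bimod_mapI) (simp_all add: aug_linear upward_diag aug_cmp_left aug_cmp_right F_upward)

lemma aug_M: "bimod_map R S M I aug"
  by (rule bimod_mapI) (simp_all add: aug_linear downward_diag aug_cmp_left aug_cmp_right F_downward)

text \<open>The part of \<open>brauer_pairing\<close> that follows the twist, separated so that it
  can be evaluated on factorisations.\<close>

definition double_aug where
  "double_aug p r t = left_unitor R I p r (tensor_map R S I I aug aug p r t)"

lemma double_aug_linear: "double_aug p r \<in> linear_maps R (PM.T p r) (F (level_diagrams p r))"
  using linear_maps_compose[OF tensor_map_linear[OF II.bimodule_pair_axioms PM.bimodule_pair_axioms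
        aug_P aug_M Obj_S Obj_S] I.left_unitor_linear[OF Obj_S Obj_S]]
  unfolding double_aug_def bimod_sel .

lemma double_aug_pure:
  assumes f: "f \<in> carrier (F (upward_diagrams q r))" and g: "g \<in> carrier (F (downward_diagrams p q))"
  shows "double_aug p r (PM.pure p r q f g) = cmp p q r (aug q r f) (aug p q g)"
proof -
  have "tensor_map R S I I aug aug p r (PM.pure p r q f g) = II.pure p r q (aug q r f) (aug p q g)"
    using f g by (intro tensor_map_pure[OF II.bimodule_pair_axioms PM.bimodule_pair_axioms aug_P aug_M]) simp_all
  then show ?thesis
    unfolding double_aug_def
    using linear_map_closed[OF aug_linear[where X = upward_diagrams, OF upward_diag] f]
      linear_map_closed[OF aug_linear[where X = downward_diagrams, OF downward_diag] g]
    by (simp add: I.left_unitor_pure)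
qed

text \<open>Both augmentations let the factors pass only for \<open>p = s = r\<close>. Since the
  bottom pairs of \<open>D\<close> determine \<open>s\<close>, this happens exactly for level
  \<open>D\<close>.\<close>

lemma double_aug_decompose:
  assumes D: "D \<in> brauer_diagrams p r"
  shows "double_aug p r (decompose p r (e D)) = (if D \<in> level_diagrams p r then e D else (\<lambda>_. \<zero>))"
proof -
  obtain s E where E: "upper_factor r D = (s, E)" "E \<in> upward_diagrams s r" "bb E = bb D"
    by (rule upper_factor[OF D])
  note split = upward_split[OF E(2) D E(3)]
  have eq: "double_aug p r (decompose p r (e D)) = cmp p s r (aug s r (e E)) (aug p s (e (flip E \<diamondop> D)))"
    unfolding decompose_basis[OF D] E(1) prod.case
    by (rule double_aug_pure[OF basis_vec_closed[OF E(2)] basis_vec_closed[OF split(1)]])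
  show ?thesis
  proof (cases "s = r \<and> p = s")
    case True
    then have eqs: "s = r" "p = r" by auto
    then have "D \<in> level_diagrams p r"
      using level_comp[of E r r "flip E \<diamondop> D" r] E(2) split by (simp add: upward_diag downward_diag)
    then show ?thesis
      unfolding eq using E(2) split eqs
      by (simp add: aug_diag cmp_basis_upward[OF _ downward_brauer])
  next
    case False
    have "D \<notin> level_diagrams p r"
    proof
      assume D: "D \<in> level_diagrams p r"
      then have "p = r" by (rule level_eq)
      then show False using False upward_same_cups_same_source[OF E(2) level_upward[OF D] E(3)] by simp
    qed
    moreover have "cmp p s r (aug s r (e E)) (aug p s (e (flip E \<diamondop> D))) = (\<lambda>_. \<zero>)"
    proof (cases "s = r")
      case True
      then show ?thesis
        using False E(2) by (simp add: aug_diag aug_off_diag cmp_zero F_upward)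
    next
      case False
      have "aug p s (e (flip E \<diamondop> D)) \<in> carrier (F (level_diagrams p s))"
        by (rule linear_map_closed[OF aug_linear[where X = downward_diagrams, OF downward_diag]
              basis_vec_closed[OF split(1)]])
      then show ?thesis using False by (simp add: aug_off_diag cmp_zero F_level)
    qed
    ultimately show ?thesis unfolding eq by simp
  qed
qed

abbreviation "b' \<equiv> brauer_pairing R \<delta>"

lemma pairing_decompose:
  "t \<in> carrier (MP.T p r) \<Longrightarrow> b' p r t = double_aug p r (decompose p r (twist_to_brauer R \<delta> p r t))"
  unfolding brauer_pairing_def double_aug_def by (simp add: twist_decompose)

lemma pairing_linear: "b' p r \<in> linear_maps R (MP.T p r) (F (level_diagrams p r))"
  by (rule linear_maps_cong[OF linear_maps_compose[OF linear_maps_compose[OF twist_to_brauer_linear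
            decompose_linear] double_aug_linear] pairing_decompose MP.tensor_module[OF Obj_S Obj_S]])

lemma pairing_bilinear:
  "bilinear_map R (F (downward_diagrams q r)) (F (upward_diagrams p q)) (F (level_diagrams p r))
     (\<lambda>f g. b' p r (MP.pure p r q f g))"
  using bilinear_map_compose[OF balanced_bilinear[OF MP.pure_balanced[OF Obj_S Obj_S] Obj_S] pairing_linear]
  by simp

text \<open>The pairing on diagrams: zero or a single permutation, by the same formula for every
  \<open>\<delta>\<close>.\<close>

definition pairing_value where
  "pairing_value p q r f g =
     (if twist_conflict q f g \<or> f \<diamondop> g \<notin> level_diagrams p r then (\<lambda>_. \<zero>) else e (f \<diamondop> g))"

lemma pairing_basis:
  assumes f: "f \<in> downward_diagrams q r" and g: "g \<in> upward_diagrams p q"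
  shows "b' p r (MP.pure p r q (e f) (e g)) = pairing_value p q r f g"
proof -
  have "MP.pure p r q (e f) (e g) \<in> carrier (MP.T p r)" by (rule MP.pure_closed) (simp_all add: f g)
  then have "b' p r (MP.pure p r q (e f) (e g)) = double_aug p r (decompose p r (twist_diagrams R q f g))"
    by (simp only: pairing_decompose twist_to_brauer_basis[OF f g])
  moreover have "double_aug p r (decompose p r (\<lambda>_. \<zero>)) = (\<lambda>_. \<zero>)"
    using linear_map_zero[OF F_module F_module linear_maps_compose[OF decompose_linear double_aug_linear]]
    by (simp add: free_module_sel(1))
  ultimately show ?thesis
    using double_aug_decompose[OF diagram_comp_brauer[OF downward_brauer[OF f] upward_brauer[OF g]]]
    by (simp add: twist_diagrams_def pairing_value_def)
qed

lemma cmp_level_closed_bilinear: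
  "bilinear_map R (F (level_diagrams q r)) (F (level_diagrams p q)) (F (level_diagrams p r)) (cmp p q r)"
  by (rule cmp_bilinear_sub[OF level_sub level_sub level_sub level_comp])

text \<open>Multiplying \<open>f\<close> on the left or \<open>g\<close> on the right by a
  permutation changes neither the conflicts nor whether the composite is level.\<close>

lemma pairing_bimod_map: "bimod_map R S (tensor_bimod R S M P) I b'"
proof (rule bimod_mapI)
  show "b' x y \<in> linear_maps R (BMod MP.MN x y) (BMod I x y)" for x y
    by (simp add: pairing_linear)
next
  fix x y z a t
  assume "a \<in> carrier (Mor S y z)" "t \<in> carrier (BMod MP.MN x y)"
  then have a: "a \<in> carrier (F (level_diagrams y z))" and t: "t \<in> carrier (MP.T x y)" by simp_all
  have aS: "a \<in> carrier (Mor S y z)" using a by simp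
  show "b' x z (LAct MP.MN x y z a t) = LAct I x y z a (b' x y t)"
    unfolding bimod_sel
  proof (rule MP.tensor_ext[OF Obj_S Obj_S F_module
        linear_maps_compose[OF MP.tensor_LAct_linear[OF Obj_S Obj_S Obj_S aS] pairing_linear]
        linear_maps_compose[OF pairing_linear bilinear_map_right[OF cmp_level_closed_bilinear a]] _ t])
    fix w m n assume "m \<in> carrier (BMod M w y)" "n \<in> carrier (BMod P x w)"
    then have m: "m \<in> carrier (F (downward_diagrams w y))" and n: "n \<in> carrier (F (upward_diagrams x w))" by simp_all
    have "b' x z (MP.pure x z w (cmp w y z a m) n) = cmp x y z a (b' x y (MP.pure x y w m n))"
    proof (rule trilinear_map_free_ext[OF F_module
          trilinear_map_nest_left[OF pairing_bilinear cmp_bilinear_sub[OF level_sub down_sub down_sub level_down_closed]]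
          trilinear_map_nest_right[OF cmp_level_closed_bilinear pairing_bilinear] _ a m n])
      fix s f g assume s: "s \<in> level_diagrams y z" and f: "f \<in> downward_diagrams w y" and g: "g \<in> upward_diagrams x w"
      note f' = downward_brauer[OF f] and g' = upward_brauer[OF g]
      note fg = diagram_comp_brauer[OF f' g']
      show "b' x z (MP.pure x z w (cmp w y z (e s) (e f)) (e g)) = cmp x y z (e s) (b' x y (MP.pure x y w (e f) (e g)))"
        unfolding cmp_basis_upward[OF level_upward[OF s] f'] pairing_basis[OF level_down_closed[OF s f] g]
          pairing_basis[OF f g] pairing_value_def twist_conflict_upward_left[OF f' g' level_upward[OF s]]
          diagram_comp_assoc level_left_iff[OF s fg]
        using s by (simp add: cmp_zero cmp_basis_upward[OF level_upward[OF s] fg] level_brauer)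
    qed
    then show "b' x z (LAct MP.MN x y z a (MP.pure x y w m n)) = cmp x y z a (b' x y (MP.pure x y w m n))"
      using a m n by (simp add: MP.tensor_LAct_pure)
  qed
next
  fix x y z t a
  assume "t \<in> carrier (BMod MP.MN y z)" "a \<in> carrier (Mor S x y)"
  then have a: "a \<in> carrier (F (level_diagrams x y))" and t: "t \<in> carrier (MP.T y z)" by simp_all
  have aS: "a \<in> carrier (Mor S x y)" using a by simp
  show "b' x z (RAct MP.MN x y z t a) = RAct I x y z (b' y z t) a"
    unfolding bimod_sel
  proof (rule MP.tensor_ext[OF Obj_S Obj_S F_module
        linear_maps_compose[OF MP.tensor_RAct_linear[OF Obj_S Obj_S Obj_S aS] pairing_linear]
        linear_maps_compose[OF pairing_linear bilinear_map_left[OF cmp_level_closed_bilinear a]] _ t])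
    fix w m n assume "m \<in> carrier (BMod M w z)" "n \<in> carrier (BMod P y w)"
    then have m: "m \<in> carrier (F (downward_diagrams w z))" and n: "n \<in> carrier (F (upward_diagrams y w))" by simp_all
    have "b' x z (MP.pure x z w m (cmp x y w n a)) = cmp x y z (b' y z (MP.pure y z w m n)) a"
    proof (rule trilinear_map_free_ext[OF F_module
          trilinear_map_nest_right[OF pairing_bilinear cmp_bilinear_sub[OF up_sub level_sub up_sub up_level_closed]]
          trilinear_map_nest_left[OF cmp_level_closed_bilinear pairing_bilinear] _ m n a])
      fix f g s assume f: "f \<in> downward_diagrams w z" and g: "g \<in> upward_diagrams y w" and s: "s \<in> level_diagrams x y"
      note f' = downward_brauer[OF f] and g' = upward_brauer[OF g]
      note fg = diagram_comp_brauer[OF f' g']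
      show "b' x z (MP.pure x z w (e f) (cmp x y w (e g) (e s))) = cmp x y z (b' y z (MP.pure y z w (e f) (e g))) (e s)"
        unfolding cmp_basis_downward[OF g' level_downward[OF s]] pairing_basis[OF f up_level_closed[OF g s]]
          pairing_basis[OF f g] pairing_value_def twist_conflict_downward_right[OF f' g' level_downward[OF s]]
          diagram_comp_assoc[symmetric] level_right_iff[OF s fg]
        using s by (simp add: cmp_zero cmp_basis_downward[OF fg level_downward[OF s]] level_brauer)
    qed
    then show "b' x z (RAct MP.MN x y z (MP.pure y z w m n) a) = cmp x y z (b' y z (MP.pure y z w m n)) a"
      using a m n by (simp add: MP.tensor_RAct_pure)
  qed
qed

end

section \<open>Preparations for the copairing: sums with one term, and permutations acting on bottom
  pairs\<close>

lemma (in abelian_monoid) finsum_finsum_single: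
  assumes I: "finite I" "i \<in> I" and J: "\<And>k. k \<in> I \<Longrightarrow> finite (J k)" "j \<in> J i"
    and f: "f i j \<in> carrier G"
      "\<And>k l. \<lbrakk>k \<in> I; l \<in> J k; k \<noteq> i \<or> l \<noteq> j\<rbrakk> \<Longrightarrow> f k l = \<zero>"
  shows "(\<Oplus>k\<in>I. \<Oplus>l\<in>J k. f k l) = f i j"
proof -
  have inner: "(\<Oplus>l\<in>J i. f i l) = f i j"
    using I J f by (intro finsum_single[where f = "f i"]) auto
  have "(\<Oplus>l\<in>J k. f k l) = \<zero>" if "k \<in> I" "k \<noteq> i" for k
    using f(2) that by (intro add.finprod_one_eqI) auto
  then have "(\<Oplus>k\<in>I. \<Oplus>l\<in>J k. f k l) = (\<Oplus>l\<in>J i. f i l)"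
    using I f(1) inner by (intro finsum_single[where f = "\<lambda>k. \<Oplus>l\<in>J k. f k l"]) auto
  then show ?thesis using inner by simp
qed

lemma bilinear_map_swap: "bilinear_map R M N P \<beta> \<Longrightarrow> bilinear_map R N M P (\<lambda>n m. \<beta> m n)"
  by (rule bilinear_mapI) (erule (1) bilinear_map_left, erule (1) bilinear_map_right)

text \<open>The bottom pairs after multiplication by a permutation depend only on those before it,
  so multiplication by \<open>flip s\<close> can be applied to the equation and undoes
  \<open>s\<close>.\<close>

lemma bb_level_comp_inject:
  assumes s: "s \<in> level_diagrams q r" and f: "f \<in> brauer_diagrams p q" and g: "g \<in> brauer_diagrams p' q"
    and eq: "bb (s \<diamondop> f) = bb (s \<diamondop> g)"
  shows "bb f = bb g"
proof -
  note fs = level_upward[OF flip_level[OF s]]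
  have "bb (flip s \<diamondop> (s \<diamondop> f)) = bb (flip s \<diamondop> (s \<diamondop> g))"
    using eq by (simp add: fun_eq_iff bb_upward_comp[OF fs diagram_comp_brauer[OF level_brauer[OF s] f]]
        bb_upward_comp[OF fs diagram_comp_brauer[OF level_brauer[OF s] g]])
  then show ?thesis
    by (simp add: diagram_comp_assoc[symmetric] flip_upward_comp_self[OF level_upward[OF s]]
        identity_comp[OF f] identity_comp[OF g])
qed

text \<open>Moves a permutation across the copairing: \<open>s f \<otimes> flip f = f' t \<otimes>
  flip f = f' \<otimes> t (flip f) = f' \<otimes> (flip f') s\<close>. The second equation for
  \<open>t\<close> is the reflection of the first with the permutations brought to the other
  sides.\<close>

lemma level_slide:
  assumes s: "s \<in> level_diagrams p p" and f: "f \<in> upward_diagrams r p" and f': "f' \<in> upward_diagrams r p"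
    and cups: "bb f' = bb (s \<diamondop> f)"
  obtains t where "t \<in> level_diagrams r r" "f' \<diamondop> t = s \<diamondop> f" "t \<diamondop> flip f = flip f' \<diamondop> s"
proof
  let ?t = "flip f' \<diamondop> (s \<diamondop> f)"
  have sf: "s \<diamondop> f \<in> upward_diagrams r p" by (rule upward_comp[OF level_upward[OF s] f])
  note split = upward_split[OF f' upward_brauer[OF sf] cups]
  show t: "?t \<in> level_diagrams r r" using split(1) by (simp add: downward_diag)
  show "f' \<diamondop> ?t = s \<diamondop> f" by (rule split(2))
  have "flip ?t \<diamondop> flip f' = flip f \<diamondop> flip s"
    unfolding flip_diagram_comp[of f' ?t, symmetric] split(2) by (rule flip_diagram_comp)
  then have "?t \<diamondop> (flip ?t \<diamondop> flip f') \<diamondop> s = ?t \<diamondop> (flip f \<diamondop> flip s) \<diamondop> s" by simp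
  then have "(?t \<diamondop> flip ?t) \<diamondop> flip f' \<diamondop> s = ?t \<diamondop> (flip f \<diamondop> (flip s \<diamondop> s))"
    by (simp only: diagram_comp_assoc)
  then show "?t \<diamondop> flip f = flip f' \<diamondop> s"
    by (simp only: comp_flip_self_level[OF t] flip_upward_comp_self[OF level_upward[OF s]]
        identity_comp[OF flip_brauer[OF upward_brauer[OF f']]] comp_identity[OF flip_brauer[OF upward_brauer[OF f]]])
qed

context brauer
begin

sublocale MPM: bimodule_triple R S M P M ..
sublocale PMP: bimodule_triple R S P M P ..

subsection \<open>The copairing\<close>

abbreviation "sources p \<equiv> {r. (r, p) \<in> brauer_le}"
abbreviation "monotone_upward r p \<equiv> {f \<in> upward_diagrams r p. monotone_diagram f}"
abbreviation "copair \<equiv> copairing_element R \<delta>"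

lemma finite_sources: "finite (sources p)"
  by (rule finite_subset[of _ "{..p}"]) (auto simp: brauer_le_def)

lemma finite_monotone_upward: "finite (monotone_upward r p)"
  by (rule finite_subset[OF _ finite_brauer_diagrams[of r p]]) (auto intro: upward_brauer)

lemma copair_eq:
  "copair p = (\<Oplus>\<^bsub>PM.T p p\<^esub>r\<in>sources p. \<Oplus>\<^bsub>PM.T p p\<^esub>f\<in>monotone_upward r p.
     PM.pure p p r (e f) (e (flip f)))"
  by (simp add: copairing_element_def Let_def)

lemma copair_term_closed: "f \<in> upward_diagrams r p \<Longrightarrow> PM.pure p p r (e f) (e (flip f)) \<in> carrier (PM.T p p)"
  by (rule PM_pure_closed) (auto intro: flip_upward)

lemma copair_closed: "copair p \<in> carrier (PM.T p p)"
proof -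
  interpret T: module R "PM.T p p" by (rule PM.tensor_module[OF Obj_S Obj_S])
  show ?thesis unfolding copair_eq by (intro T.finsum_closed Pi_I copair_term_closed) simp
qed

lemma linear_map_copair:
  assumes Q: "module R Q" and L: "L \<in> linear_maps R (PM.T p p) Q"
  shows "L (copair p) = (\<Oplus>\<^bsub>Q\<^esub>r\<in>sources p. \<Oplus>\<^bsub>Q\<^esub>f\<in>monotone_upward r p. L (PM.pure p p r (e f) (e (flip f))))"
proof -
  interpret T: module R "PM.T p p" by (rule PM.tensor_module[OF Obj_S Obj_S])
  interpret Q: module R Q by (rule Q)
  have inner: "L (\<Oplus>\<^bsub>PM.T p p\<^esub>f\<in>monotone_upward r p. PM.pure p p r (e f) (e (flip f))) =
      (\<Oplus>\<^bsub>Q\<^esub>f\<in>monotone_upward r p. L (PM.pure p p r (e f) (e (flip f))))" for r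
    by (rule linear_map_finsum[OF T.module_axioms Q L finite_monotone_upward copair_term_closed]) simp
  show ?thesis
    unfolding copair_eq inner[symmetric]
    by (rule linear_map_finsum[OF T.module_axioms Q L finite_sources])
       (intro T.finsum_closed Pi_I copair_term_closed, simp)
qed

text \<open>\<open>s\<close> permutes the sets of bottom pairs and hence the monotone diagrams
  representing them. \<open>level_slide\<close> matches the terms, and reindexing the sum along this
  bijection \<open>h\<close> gives the other side.\<close>

lemma copair_level_basis:
  assumes s: "s \<in> level_diagrams p p"
  shows "LAct PM.MN p p p (e s) (copair p) = RAct PM.MN p p p (copair p) (e s)"
proof -
  interpret T: module R "PM.T p p" by (rule PM.tensor_module[OF Obj_S Obj_S])
  have sS: "e s \<in> carrier (Mor S p p)" using s by simp
  have lin: "LAct PM.MN p p p (e s) \<in> linear_maps R (PM.T p p) (PM.T p p)"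
    "(\<lambda>t. RAct PM.MN p p p t (e s)) \<in> linear_maps R (PM.T p p) (PM.T p p)"
    by (intro PM.tensor_LAct_linear PM.tensor_RAct_linear Obj_S sS)+
  have left: "LAct PM.MN p p p (e s) (PM.pure p p r (e f) (e (flip f))) = PM.pure p p r (e (s \<diamondop> f)) (e (flip f))"
    if f: "f \<in> upward_diagrams r p" for r f
    using f flip_upward[OF f] s
    by (simp add: PM.tensor_LAct_pure cmp_basis_upward[OF level_upward[OF s] upward_brauer[OF f]])
  have right: "RAct PM.MN p p p (PM.pure p p r (e f) (e (flip f))) (e s) = PM.pure p p r (e f) (e (flip f \<diamondop> s))"
    if f: "f \<in> upward_diagrams r p" for r f
    using f flip_upward[OF f] s
    by (simp add: PM.tensor_RAct_pure cmp_basis_downward[OF flip_brauer[OF upward_brauer[OF f]] level_downward[OF s]])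
  have inner: "(\<Oplus>\<^bsub>PM.T p p\<^esub>f\<in>monotone_upward r p. LAct PM.MN p p p (e s) (PM.pure p p r (e f) (e (flip f)))) =
      (\<Oplus>\<^bsub>PM.T p p\<^esub>f\<in>monotone_upward r p. RAct PM.MN p p p (PM.pure p p r (e f) (e (flip f))) (e s))" for r
  proof -
    let ?A = "monotone_upward r p"
    have "\<exists>f'. f' \<in> ?A \<and> bb f' = bb (s \<diamondop> f)" if f: "f \<in> ?A" for f
    proof -
      have sf: "s \<diamondop> f \<in> upward_diagrams r p" using upward_comp[OF level_upward[OF s]] f by blast
      obtain r' f' where f': "f' \<in> upward_diagrams r' p" "monotone_diagram f'" "bb f' = bb (s \<diamondop> f)"
        using monotone_upward_exists[OF upward_brauer[OF sf]] by blast
      then show ?thesis using upward_same_cups_same_source[OF f'(1) sf f'(3)] by blast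
    qed
    then obtain h where h: "\<And>f. f \<in> ?A \<Longrightarrow> h f \<in> ?A \<and> bb (h f) = bb (s \<diamondop> f)" by metis
    have inj: "inj_on h ?A"
    proof (rule inj_onI)
      fix f g assume fg: "f \<in> ?A" "g \<in> ?A" "h f = h g"
      then have "bb (s \<diamondop> f) = bb (s \<diamondop> g)" using h by metis
      then have "bb f = bb g"
        using bb_level_comp_inject[OF s upward_brauer upward_brauer] fg(1,2) by blast
      then show "f = g" using monotone_upward_unique fg(1,2) by blast
    qed
    have surj: "h ` ?A = ?A"
      by (rule endo_inj_surj[OF finite_monotone_upward _ inj]) (use h in blast)
    have slide: "PM.pure p p r (e (s \<diamondop> f)) (e (flip f)) = PM.pure p p r (e (h f)) (e (flip (h f) \<diamondop> s))"
      if "f \<in> ?A" for f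
    proof -
      have f: "f \<in> upward_diagrams r p" and hf: "h f \<in> upward_diagrams r p" "bb (h f) = bb (s \<diamondop> f)"
        using h[OF that] that by auto
      obtain t where t: "t \<in> level_diagrams r r" "h f \<diamondop> t = s \<diamondop> f" "t \<diamondop> flip f = flip (h f) \<diamondop> s"
        by (rule level_slide[OF s f hf])
      have "PM.pure p p r (RAct P r r p (e (h f)) (e t)) (e (flip f)) = PM.pure p p r (e (h f)) (LAct M p r r (e t) (e (flip f)))"
        by (rule PM.pure_balance) (simp_all add: t hf flip_upward[OF f])
      then show ?thesis
        unfolding bimod_sel cmp_basis_upward[OF hf(1) level_brauer[OF t(1)]] t(2,3)
          cmp_basis_upward[OF level_upward[OF t(1)] flip_brauer[OF upward_brauer[OF f]]] .
    qed
    have closed: "PM.pure p p r (e f) (e (flip f \<diamondop> s)) \<in> carrier (PM.T p p)" if "f \<in> ?A" for f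
      using that down_level_closed[OF flip_upward s] by (intro PM_pure_closed) auto
    have "(\<Oplus>\<^bsub>PM.T p p\<^esub>f\<in>?A. LAct PM.MN p p p (e s) (PM.pure p p r (e f) (e (flip f)))) =
        (\<Oplus>\<^bsub>PM.T p p\<^esub>f\<in>?A. PM.pure p p r (e (h f)) (e (flip (h f) \<diamondop> s)))"
      using closed h by (intro T.finsum_cong') (auto simp: left slide)
    also have "\<dots> = (\<Oplus>\<^bsub>PM.T p p\<^esub>f\<in>h ` ?A. PM.pure p p r (e f) (e (flip f \<diamondop> s)))"
      by (rule T.add.finprod_reindex[OF _ inj, symmetric]) (use closed surj in auto)
    also have "\<dots> = (\<Oplus>\<^bsub>PM.T p p\<^esub>f\<in>?A. RAct PM.MN p p p (PM.pure p p r (e f) (e (flip f))) (e s))"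
      unfolding surj using closed by (intro T.finsum_cong') (auto simp: right)
    finally show ?thesis .
  qed
  show ?thesis
    unfolding linear_map_copair[OF T.module_axioms lin(1)] linear_map_copair[OF T.module_axioms lin(2)] inner ..
qed

lemma LAct_copair_linear: "(\<lambda>a. LAct PM.MN p p q a (copair p)) \<in> linear_maps R (F (level_diagrams p q)) (PM.T p q)"
  using bilinear_map_left[OF bimodule.LAct_bilinear[OF PM.tensor_bimodule Obj_S Obj_S Obj_S], of "copair p"] copair_closed by simp

lemma RAct_copair_linear: "RAct PM.MN p q q (copair q) \<in> linear_maps R (F (level_diagrams p q)) (PM.T p q)"
  using bilinear_map_right[OF bimodule.RAct_bilinear[OF PM.tensor_bimodule Obj_S Obj_S Obj_S], of "copair q"] copair_closed by simp

text \<open>Turns the left-linear extension \<open>d'\<close> into a map that respects the right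
  action as well.\<close>

lemma copair_commute:
  assumes a: "a \<in> carrier (F (level_diagrams p q))"
  shows "LAct PM.MN p p q a (copair p) = RAct PM.MN p q q (copair q) a"
proof (rule linear_maps_free_ext[OF PM.tensor_module[OF Obj_S Obj_S] LAct_copair_linear RAct_copair_linear _ a])
  fix s assume "s \<in> level_diagrams p q"
  moreover from this have "p = q" by (rule level_eq)
  ultimately show "LAct PM.MN p p q (e s) (copair p) = RAct PM.MN p q q (copair q) (e s)"
    using copair_level_basis by simp
qed

abbreviation "d' \<equiv> brauer_copairing R \<delta>"

lemma copairing_LAct: "d' p q a = LAct PM.MN p p q a (copair p)"
  by (simp add: brauer_copairing_def)

lemma copairing_Ident: "d' p p (Ident S p) = copair p"
  unfolding copairing_LAct by (rule bimodule.LAct_Ident[OF PM.tensor_bimodule]) (simp_all add: copair_closed)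

lemma copairing_bimod_map: "bimod_map R S I PM.MN d'"
proof (rule bimod_mapI)
  show "d' x y \<in> linear_maps R (BMod I x y) (BMod PM.MN x y)" for x y
    unfolding copairing_LAct[abs_def] by (simp add: LAct_copair_linear)
  show "d' x z (LAct I x y z a m) = LAct PM.MN x y z a (d' x y m)"
    if "a \<in> carrier (Mor S y z)" "m \<in> carrier (BMod I x y)" for x y z a m
    unfolding copairing_LAct
    using bimodule.LAct_assoc[OF PM.tensor_bimodule Obj_S Obj_S Obj_S Obj_S that(1), where b = m and m = "copair x"] that(2) copair_closed by simp
  fix x y z m a assume m: "m \<in> carrier (BMod I y z)" and a: "a \<in> carrier (Mor S x y)"
  have "d' x z (RAct I x y z m a) = LAct PM.MN x y z m (LAct PM.MN x x y a (copair x))"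
    unfolding copairing_LAct
    using bimodule.LAct_assoc[OF PM.tensor_bimodule Obj_S Obj_S Obj_S Obj_S _ a, where a = m and z = z and m = "copair x"] m copair_closed by simp
  also have "\<dots> = LAct PM.MN x y z m (RAct PM.MN x y y (copair y) a)"
    using a by (simp add: copair_commute)
  also have "\<dots> = RAct PM.MN x y z (LAct PM.MN y y z m (copair y)) a"
    using bimodule.LAct_RAct[OF PM.tensor_bimodule Obj_S Obj_S Obj_S Obj_S _ _ a, where a = m and z = z and m = "copair y"] m copair_closed by simp
  finally show "d' x z (RAct I x y z m a) = RAct PM.MN x y z (d' y z m) a" unfolding copairing_LAct .
qed

subsection \<open>The zigzag identities\<close>

lemma zigzag_minus_term:
  assumes G: "G \<in> downward_diagrams x y" and f: "f \<in> upward_diagrams r x"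
  shows "cmp x r y (pairing_value r x y G f) (e (flip f)) = (if bb f = tt G then e G else (\<lambda>_. \<zero>))"
proof (cases "bb f = tt G")
  case True
  note match = matching_arcs[OF G f True]
  have "cmp x r y (e (G \<diamondop> f)) (e (flip f)) = e G"
    unfolding cmp_basis_upward[OF level_upward[OF match(2)] flip_brauer[OF upward_brauer[OF f]]] match(3) ..
  then show ?thesis using True match(1,2) by (simp add: pairing_value_def)
next
  case False
  then have "pairing_value r x y G f = (\<lambda>_. \<zero>)"
    using no_conflict_level[OF downward_brauer[OF G] upward_brauer[OF f]] by (auto simp: pairing_value_def)
  then show ?thesis
    using False by (simp add: cmp_zero(1)[OF basis_vec_closed[OF flip_brauer[OF upward_brauer[OF f]]]])
qed

lemma zigzag_plus_term:
  assumes h: "h \<in> upward_diagrams r y" and E: "E \<in> upward_diagrams x y"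
  shows "cmp x r y (e h) (pairing_value x y r (flip h) E) = (if bb h = bb E then e E else (\<lambda>_. \<zero>))"
proof -
  have tt: "tt (flip h) = bb h" by (simp add: fun_eq_iff)
  show ?thesis
  proof (cases "bb h = bb E")
    case True
    note match = matching_arcs[OF flip_upward[OF h] E True[symmetric, folded tt]]
    have "cmp x r y (e h) (e (flip h \<diamondop> E)) = e E"
      unfolding cmp_basis_upward[OF h level_brauer[OF match(2)]] upward_split(2)[OF h upward_brauer[OF E] True] ..
    then show ?thesis using True match(1,2) by (simp add: pairing_value_def)
  next
    case False
    then have "pairing_value x y r (flip h) E = (\<lambda>_. \<zero>)"
      using no_conflict_level[OF flip_brauer[OF upward_brauer[OF h]] upward_brauer[OF E]] tt
      by (auto simp: pairing_value_def)
    then show ?thesis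
      using False by (simp add: cmp_zero(2)[OF basis_vec_closed[OF upward_brauer[OF h]]])
  qed
qed

text \<open>The bottom pairs determine the source and then the monotone diagram, so exactly one term
  of the double sum is selected.\<close>

lemma monotone_sum_single:
  assumes D: "D \<in> brauer_diagrams p q" and v: "v \<in> carrier (F X)"
  shows "(\<Oplus>\<^bsub>F X\<^esub>r\<in>sources q. \<Oplus>\<^bsub>F X\<^esub>f\<in>monotone_upward r q. if bb f = bb D then v else (\<lambda>_. \<zero>)) = v"
proof -
  interpret FX: module R "F X" by (rule F_module)
  obtain s E where E: "E \<in> upward_diagrams s q" "monotone_diagram E" "bb E = bb D"
    using monotone_upward_exists[OF D] by blast
  have "(\<Oplus>\<^bsub>F X\<^esub>r\<in>sources q. \<Oplus>\<^bsub>F X\<^esub>f\<in>monotone_upward r q. if bb f = bb D then v else (\<lambda>_. \<zero>)) =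
      (if bb E = bb D then v else (\<lambda>_. \<zero>))"
  proof (rule FX.finsum_finsum_single[where f = "\<lambda>r f. if bb f = bb D then v else (\<lambda>_. \<zero>)"])
    show "s \<in> sources q" using upward_brauer_le[OF E(1)] by simp
    show "E \<in> monotone_upward s q" using E by simp
    show "(if bb f = bb D then v else (\<lambda>_. \<zero>)) = \<zero>\<^bsub>F X\<^esub>"
      if "f \<in> monotone_upward r q" "r \<noteq> s \<or> f \<noteq> E" for r f
    proof -
      have "bb f \<noteq> bb D"
      proof
        assume eq: "bb f = bb D"
        have f: "f \<in> upward_diagrams r q" using that(1) by simp
        have "r = s" by (rule upward_same_cups_same_source[OF f E(1)]) (simp add: eq E(3))
        then show False using monotone_upward_unique[OF _ _ E(1,2)] that eq E(3) by auto
      qed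
      then show ?thesis by simp
    qed
  qed (simp_all add: finite_sources finite_monotone_upward v E(3))
  then show ?thesis using E(3) by simp
qed

text \<open>The left side is linear in \<open>g\<close> and in the tensor inserted by
  \<open>d'\<close>. Hence \<open>g\<close> may be a diagram, and a single term of the copairing is
  followed through associator, pairing and unitor.\<close>

lemma zigzag_minus:
  assumes g: "g \<in> carrier (F (downward_diagrams x y))"
  shows "left_unitor R M x y (tensor_map R S I M b' (\<lambda>_ _ n. n) x y
    (assoc_left R S M P M x y (tensor_map R S M PM.MN (\<lambda>_ _ m. m) d' x y
      (pure_tensor R S M I x y x g (Ident S x))))) = g"
proof -
  define L where "L g s = left_unitor R M x y (tensor_map R S I M b' (\<lambda>_ _ n. n) x y
    (assoc_left R S M P M x y (MPM.M_NP.pure x y x g s)))" for g s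
  have start: "tensor_map R S M PM.MN (\<lambda>_ _ m. m) d' x y (pure_tensor R S M I x y x g (Ident S x)) =
      MPM.M_NP.pure x y x g (copair x)"
    unfolding copairing_Ident[symmetric]
    by (rule tensor_map_pure[OF MPM.M_NP.bimodule_pair_axioms M.regular_pair_right bimod_map_id copairing_bimod_map])
       (simp_all add: g identity_level)
  \<comment> \<open>Everything after the insertion of the copairing, as one linear map; it yields
    linearity of \<open>L\<close> in both arguments.\<close>
  note tail = linear_maps_compose[OF linear_maps_compose[OF MPM.assoc_left_linear[OF Obj_S Obj_S]
        tensor_map_linear[OF M.regular_pair_left MPM.MN_P.bimodule_pair_axioms pairing_bimod_map bimod_map_id Obj_S Obj_S]]
      M.left_unitor_linear[OF Obj_S Obj_S], unfolded bimod_sel]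
  have cop: "copair x \<in> carrier (BMod PM.MN x x)" by (simp add: copair_closed)
  have lin_g: "(\<lambda>g. L g (copair x)) \<in> linear_maps R (F (downward_diagrams x y)) (F (downward_diagrams x y))"
    using linear_maps_compose[OF MPM.M_NP.pure_linear_left[OF Obj_S Obj_S Obj_S cop] tail]
    unfolding L_def bimod_sel .
  have "L g (copair x) = g"
  proof (rule linear_maps_free_ext[OF F_module lin_g linear_maps_id _ g])
    fix G assume G: "G \<in> downward_diagrams x y"
    then have eG: "e G \<in> carrier (BMod M x y)" by simp
    have lin: "L (e G) \<in> linear_maps R (PM.T x x) (F (downward_diagrams x y))"
      using linear_maps_compose[OF MPM.M_NP.pure_linear_right[OF Obj_S Obj_S Obj_S eG] tail]
      unfolding L_def PM.BMod_tensor .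
    have val: "L (e G) (PM.pure x x r (e f) (e (flip f))) = (if bb f = bb (flip G) then e G else (\<lambda>_. \<zero>))"
      if f: "f \<in> upward_diagrams r x" for r f
    proof -
      have "assoc_left R S M P M x y (MPM.M_NP.pure x y x (e G) (PM.pure x x r (e f) (e (flip f)))) =
          MPM.MN_P.pure x y r (MP.pure r y x (e G) (e f)) (e (flip f))"
        by (rule MPM.assoc_left_pure) (simp_all add: G f flip_upward[OF f])
      moreover have "tensor_map R S I M b' (\<lambda>_ _ n. n) x y (MPM.MN_P.pure x y r (MP.pure r y x (e G) (e f)) (e (flip f))) =
          pure_tensor R S I M x y r (b' r y (MP.pure r y x (e G) (e f))) (e (flip f))"
        by (rule tensor_map_pure[OF M.regular_pair_left MPM.MN_P.bimodule_pair_axioms pairing_bimod_map bimod_map_id])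
           (simp_all add: MP.pure_closed G f flip_upward[OF f])
      moreover have "b' r y (MP.pure r y x (e G) (e f)) \<in> carrier (F (level_diagrams r y))"
        by (rule bilinear_map_closed[OF pairing_bilinear]) (simp_all add: G f)
      ultimately have "L (e G) (PM.pure x x r (e f) (e (flip f))) =
          cmp x r y (b' r y (MP.pure r y x (e G) (e f))) (e (flip f))"
        unfolding L_def by (simp add: M.left_unitor_pure flip_upward[OF f])
      \<comment> \<open>\<open>monotone_sum_single\<close> compares bottom pairs, and the top pairs
        of \<open>G\<close> are the bottom pairs of its reflection.\<close>
      moreover have "tt G = bb (flip G)" by (simp add: fun_eq_iff)
      ultimately show ?thesis
        unfolding pairing_basis[OF G f] zigzag_minus_term[OF G f] by simp
    qed
    interpret Q: module R "F (downward_diagrams x y)" by (rule F_module)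
    have "L (e G) (copair x) = (\<Oplus>\<^bsub>F (downward_diagrams x y)\<^esub>r\<in>sources x.
        \<Oplus>\<^bsub>F (downward_diagrams x y)\<^esub>f\<in>monotone_upward r x. if bb f = bb (flip G) then e G else (\<lambda>_. \<zero>))"
      unfolding linear_map_copair[OF F_module lin]
      using G by (intro Q.finsum_cong' Q.finsum_closed Pi_I) (auto simp: val F_zero_closed)
    also have "\<dots> = e G"
      using monotone_sum_single[OF flip_brauer[OF downward_brauer[OF G]] basis_vec_closed[OF G]] .
    finally show "L (e G) (copair x) = e G" .
  qed
  then show ?thesis unfolding start L_def .
qed

text \<open>The mirror argument: the surviving term is the monotone diagram with the bottom pairs of
  \<open>G\<close> itself.\<close>

lemma zigzag_plus:
  assumes g: "g \<in> carrier (F (upward_diagrams x y))"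
  shows "right_unitor R P x y (tensor_map R S P I (\<lambda>_ _ m. m) b' x y
    (assoc_right R S P M P x y (tensor_map R S PM.MN P d' (\<lambda>_ _ n. n) x y
      (pure_tensor R S I P x y y (Ident S y) g)))) = g"
proof -
  define L where "L g s = right_unitor R P x y (tensor_map R S P I (\<lambda>_ _ m. m) b' x y
    (assoc_right R S P M P x y (PMP.MN_P.pure x y y s g)))" for g s
  have start: "tensor_map R S PM.MN P d' (\<lambda>_ _ n. n) x y (pure_tensor R S I P x y y (Ident S y) g) =
      PMP.MN_P.pure x y y (copair y) g"
    unfolding copairing_Ident[symmetric]
    by (rule tensor_map_pure[OF PMP.MN_P.bimodule_pair_axioms P.regular_pair_left copairing_bimod_map bimod_map_id])
       (simp_all add: g identity_level)
  note tail = linear_maps_compose[OF linear_maps_compose[OF PMP.assoc_right_linear[OF Obj_S Obj_S]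
        tensor_map_linear[OF P.regular_pair_right PMP.M_NP.bimodule_pair_axioms bimod_map_id pairing_bimod_map Obj_S Obj_S]]
      P.right_unitor_linear[OF Obj_S Obj_S], unfolded bimod_sel]
  have cop: "copair y \<in> carrier (BMod PM.MN y y)" by (simp add: copair_closed)
  have lin_g: "(\<lambda>g. L g (copair y)) \<in> linear_maps R (F (upward_diagrams x y)) (F (upward_diagrams x y))"
    using linear_maps_compose[OF PMP.MN_P.pure_linear_right[OF Obj_S Obj_S Obj_S cop] tail]
    unfolding L_def bimod_sel .
  have "L g (copair y) = g"
  proof (rule linear_maps_free_ext[OF F_module lin_g linear_maps_id _ g])
    fix G assume G: "G \<in> upward_diagrams x y"
    then have eG: "e G \<in> carrier (BMod P x y)" by simp
    have lin: "L (e G) \<in> linear_maps R (PM.T y y) (F (upward_diagrams x y))"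
      using linear_maps_compose[OF PMP.MN_P.pure_linear_left[OF Obj_S Obj_S Obj_S eG] tail]
      unfolding L_def PM.BMod_tensor .
    have val: "L (e G) (PM.pure y y r (e f) (e (flip f))) = (if bb f = bb G then e G else (\<lambda>_. \<zero>))"
      if f: "f \<in> upward_diagrams r y" for r f
    proof -
      have "assoc_right R S P M P x y (PMP.MN_P.pure x y y (PM.pure y y r (e f) (e (flip f))) (e G)) =
          PMP.M_NP.pure x y r (e f) (MP.pure x r y (e (flip f)) (e G))"
        by (rule PMP.assoc_right_pure) (simp_all add: G f flip_upward[OF f])
      moreover have "tensor_map R S P I (\<lambda>_ _ m. m) b' x y (PMP.M_NP.pure x y r (e f) (MP.pure x r y (e (flip f)) (e G))) =
          pure_tensor R S P I x y r (e f) (b' x r (MP.pure x r y (e (flip f)) (e G)))"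
        by (rule tensor_map_pure[OF P.regular_pair_right PMP.M_NP.bimodule_pair_axioms bimod_map_id pairing_bimod_map])
           (simp_all add: MP.pure_closed G f flip_upward[OF f])
      moreover have "b' x r (MP.pure x r y (e (flip f)) (e G)) \<in> carrier (F (level_diagrams x r))"
        by (rule bilinear_map_closed[OF pairing_bilinear]) (simp_all add: G flip_upward[OF f])
      ultimately have "L (e G) (PM.pure y y r (e f) (e (flip f))) =
          cmp x r y (e f) (b' x r (MP.pure x r y (e (flip f)) (e G)))"
        unfolding L_def by (simp add: P.right_unitor_pure f)
      then show ?thesis
        unfolding pairing_basis[OF flip_upward[OF f] G] zigzag_plus_term[OF f G] by simp
    qed
    interpret Q: module R "F (upward_diagrams x y)" by (rule F_module)
    have "L (e G) (copair y) = (\<Oplus>\<^bsub>F (upward_diagrams x y)\<^esub>r\<in>sources y.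
        \<Oplus>\<^bsub>F (upward_diagrams x y)\<^esub>f\<in>monotone_upward r y. if bb f = bb G then e G else (\<lambda>_. \<zero>))"
      unfolding linear_map_copair[OF F_module lin]
      using G by (intro Q.finsum_cong' Q.finsum_closed Pi_I) (auto simp: val F_zero_closed)
    also have "\<dots> = e G"
      using monotone_sum_single[OF upward_brauer[OF G] basis_vec_closed[OF G]] .
    finally show "L (e G) (copair y) = e G" .
  qed
  then show ?thesis unfolding start L_def .
qed

end

context brauer
begin

subsection \<open>The anti-involution\<close>

abbreviation "bar \<equiv> brauer_bar R \<delta>"

lemma bar_linear: "bar p q \<in> linear_maps R (F (brauer_diagrams q p)) (F (brauer_diagrams p q))"
  unfolding brauer_bar_def[abs_def] brauer_cat_sel
  by (rule lin_ext_linear[OF F_module]) (rule basis_vec_closed[OF flip_brauer])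

lemma bar_basis: "D \<in> brauer_diagrams q p \<Longrightarrow> bar p q (e D) = e (flip D)"
  unfolding brauer_bar_def brauer_cat_sel
  by (rule lin_ext_basis_vec[OF F_module]) (rule basis_vec_closed[OF flip_brauer])

text \<open>As in \<open>cmp_bilinear_sub\<close>, the sum in the large module is compared with the
  same sum taken in the small one.\<close>

lemma bar_linear_sub:
  assumes X: "X \<subseteq> brauer_diagrams q p" and Y: "Y \<subseteq> brauer_diagrams p q"
    and flip: "\<And>D. D \<in> X \<Longrightarrow> flip D \<in> Y"
  shows "bar p q \<in> linear_maps R (F X) (F Y)"
proof -
  let ?h = "lin_ext R (F Y) (\<lambda>D. e (flip D))"
  have h: "?h \<in> linear_maps R (F X) (F Y)"
    by (rule lin_ext_linear[OF F_module]) (rule basis_vec_closed[OF flip])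
  have "bar p q v = ?h v" if v: "v \<in> carrier (F X)" for v
  proof (rule linear_maps_free_ext[OF F_module linear_maps_free_restrict[OF is_cring bar_linear X]
        linear_maps_free_upcast[OF is_cring h Y] _ v])
    fix D assume D: "D \<in> X"
    have "?h (e D) = e (flip D)"
      by (rule lin_ext_basis_vec[OF F_module]) (rule basis_vec_closed[OF flip[OF D]])
    then show "bar p q (e D) = ?h (e D)" using bar_basis[OF subsetD[OF X D]] by simp
  qed
  then show ?thesis by (rule linear_maps_cong[OF h _ F_module])
qed

lemma bar_upward: "bar q p \<in> linear_maps R (F (upward_diagrams p q)) (F (downward_diagrams q p))"
  by (rule bar_linear_sub[OF up_sub down_sub flip_upward])

lemma bar_downward: "bar q p \<in> linear_maps R (F (downward_diagrams p q)) (F (upward_diagrams q p))"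
  by (rule bar_linear_sub[OF down_sub up_sub flip_downward])

lemma bar_level: "bar q p \<in> linear_maps R (F (level_diagrams p q)) (F (level_diagrams q p))"
  by (rule bar_linear_sub[OF level_sub level_sub flip_level])

lemma bar_bar:
  assumes v: "v \<in> carrier (F (brauer_diagrams q p))"
  shows "bar q p (bar p q v) = v"
  by (rule linear_maps_free_ext[OF F_module linear_maps_compose[OF bar_linear bar_linear] linear_maps_id _ v])
     (simp only: bar_basis flip_brauer flip_flip)

text \<open>Reflection reverses composites and preserves the number of loops, so the powers of
  \<open>\<delta>\<close> agree.\<close>

lemma bar_cmp:
  assumes g: "g \<in> carrier (F (brauer_diagrams y x))" and f: "f \<in> carrier (F (brauer_diagrams z y))"
  shows "bar x z (cmp z y x g f) = cmp x y z (bar y z f) (bar x y g)"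
proof (rule bilinear_map_free_ext[OF F_module bilinear_map_compose[OF cmp_bilinear bar_linear]
      bilinear_map_precompose[OF bilinear_map_swap[OF cmp_bilinear] bar_linear bar_linear] _ g f])
  fix D E assume D: "D \<in> brauer_diagrams y x" and E: "E \<in> brauer_diagrams z y"
  have "bar x z (cmp z y x (e D) (e E)) =
      (\<delta> [^] loop_count D E) \<odot>\<^bsub>F (brauer_diagrams x z)\<^esub> bar x z (e (D \<diamondop> E))"
    unfolding cmp_basis[OF D E]
    by (rule linear_map_smult[OF bar_linear nat_pow_closed[OF delta_closed] basis_vec_closed[OF diagram_comp_brauer[OF D E]]])
  then show "bar x z (cmp z y x (e D) (e E)) = cmp x y z (bar y z (e E)) (bar x y (e D))"
    by (simp only: bar_basis D E diagram_comp_brauer[OF D E] cmp_basis[OF flip_brauer[OF E] flip_brauer[OF D]]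
        flip_diagram_comp loop_count_flip)
qed

lemma bar_anti_functor: "linear_functor R (op_cat B) B (\<lambda>p. p) bar"
  unfolding linear_functor_def op_cat_def
proof (intro conjI ballI, simp_all only: lin_cat.simps brauer_cat_sel)
  show "(\<lambda>p. p) \<in> UNIV \<rightarrow> UNIV" by simp
  show "bar x y \<in> linear_maps R (F (brauer_diagrams y x)) (F (brauer_diagrams x y))" for x y
    by (rule bar_linear)
  show "bar x x (e (identity_diagram x)) = e (identity_diagram x)" for x
    by (simp only: bar_basis[OF identity_brauer] flip_identity)
  show "bar x z (cmp z y x g f) = cmp x y z (bar y z f) (bar x y g)"
    if "f \<in> carrier (F (brauer_diagrams z y))" "g \<in> carrier (F (brauer_diagrams y x))" for x y z f g
    by (rule bar_cmp[OF that(2,1)])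
qed

lemma bar_image_upward: "bar q p ` carrier (F (upward_diagrams p q)) = carrier (F (downward_diagrams q p))"
proof
  show "bar q p ` carrier (F (upward_diagrams p q)) \<subseteq> carrier (F (downward_diagrams q p))"
    using linear_map_closed[OF bar_upward] by blast
  show "carrier (F (downward_diagrams q p)) \<subseteq> bar q p ` carrier (F (upward_diagrams p q))"
    using bar_bar[OF F_downward] linear_map_closed[OF bar_downward] by (metis image_eqI subsetI)
qed

lemma bar_image_downward: "bar q p ` carrier (F (downward_diagrams p q)) = carrier (F (upward_diagrams q p))"
proof
  show "bar q p ` carrier (F (downward_diagrams p q)) \<subseteq> carrier (F (upward_diagrams q p))"
    using linear_map_closed[OF bar_downward] by blast
  show "carrier (F (upward_diagrams q p)) \<subseteq> bar q p ` carrier (F (downward_diagrams p q))"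
    using bar_bar[OF F_upward] linear_map_closed[OF bar_upward] by (metis image_eqI subsetI)
qed

text \<open>Conflicts and levelness are both invariant under reflection.\<close>

lemma pairing_value_bar:
  assumes G: "G \<in> downward_diagrams y x" and E: "E \<in> upward_diagrams x y"
  shows "bar x x (pairing_value x y x G E) = pairing_value x y x (flip E) (flip G)"
proof -
  note G' = downward_brauer[OF G] and E' = upward_brauer[OF E]
  have level: "flip E \<diamondop> flip G \<in> level_diagrams x x \<longleftrightarrow> G \<diamondop> E \<in> level_diagrams x x"
    unfolding flip_diagram_comp[symmetric] using flip_level flip_flip by metis
  have zero: "bar x x (\<lambda>_. \<zero>) = (\<lambda>_. \<zero>)"
    using linear_map_zero[OF F_module F_module bar_linear] by (simp only: free_module_sel(1))
  show ?thesis
    unfolding pairing_value_def level twist_conflict_flip[OF G' E']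
    by (simp add: zero bar_basis[OF diagram_comp_brauer[OF G' E']] flip_diagram_comp)
qed

lemma pairing_bar:
  assumes g: "g \<in> carrier (F (downward_diagrams y x))" and f: "f \<in> carrier (F (upward_diagrams x y))"
  shows "bar x x (b' x x (MP.pure x x y g f)) = b' x x (MP.pure x x y (bar y x f) (bar x y g))"
proof (rule bilinear_map_free_ext[OF F_module bilinear_map_compose[OF pairing_bilinear bar_level]
      bilinear_map_precompose[OF bilinear_map_swap[OF pairing_bilinear] bar_downward bar_upward] _ g f])
  fix G E assume G: "G \<in> downward_diagrams y x" and E: "E \<in> upward_diagrams x y"
  show "bar x x (b' x x (MP.pure x x y (e G) (e E))) =
      b' x x (MP.pure x x y (bar y x (e E)) (bar x y (e G)))"
    unfolding bar_basis[OF upward_brauer[OF E]] bar_basis[OF downward_brauer[OF G]]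
      pairing_basis[OF G E] pairing_basis[OF flip_upward[OF E] flip_downward[OF G]]
    by (rule pairing_value_bar[OF G E])
qed

subsection \<open>The Brauer category is quasi-cellular\<close>

text \<open>\<open>level_inclusion\<close> leaves elements unchanged, so its \<open>inv_into\<close>
  is the identity on the carrier. Membership in the carrier is therefore required on the
  diagonal.\<close>

lemma augmentation_eq:
  "(x = z \<Longrightarrow> f \<in> carrier (F (level_diagrams z z))) \<Longrightarrow> augmentation S level_inclusion z x f = aug z x f"
proof -
  assume f: "x = z \<Longrightarrow> f \<in> carrier (F (level_diagrams z z))"
  have "inv_into (carrier (F (level_diagrams z z))) (level_inclusion z z) f = f" if "x = z"
    by (rule inv_into_f_eq) (use f that in \<open>auto simp: level_inclusion_def inj_on_def\<close>)
  then show ?thesis by (auto simp: augmentation_def brauer_augmentation_def)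
qed

text \<open>The identity has no top pairs, so no conflict arises, and an upward \<open>E\<close> is
  level exactly on the diagonal.\<close>

lemma pairing_Ident_left:
  assumes f: "f \<in> carrier (F (upward_diagrams z x))"
  shows "b' z x (MP.pure z x x (e (identity_diagram x)) f) = aug z x f"
proof (rule linear_maps_free_ext[OF F_module bilinear_map_right[OF pairing_bilinear]
      aug_linear[where X = upward_diagrams, OF upward_diag] _ f])
  show id: "e (identity_diagram x) \<in> carrier (F (downward_diagrams x x))"
    by (rule basis_vec_closed[OF level_downward[OF identity_level]])
  fix E assume E: "E \<in> upward_diagrams z x"
  have "\<not> twist_conflict x (identity_diagram x) E"
    unfolding twist_conflict_iff[OF identity_brauer upward_brauer[OF E]] by (simp add: tt_identity)
  moreover have "E \<in> level_diagrams z x \<longleftrightarrow> z = x"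
    using E level_eq upward_diag by blast
  ultimately show "b' z x (MP.pure z x x (e (identity_diagram x)) (e E)) = aug z x (e E)"
    unfolding pairing_basis[OF level_downward[OF identity_level] E]
    by (simp add: pairing_value_def identity_comp[OF upward_brauer[OF E]] brauer_augmentation_def)
qed

lemma pairing_Ident_right:
  assumes g: "g \<in> carrier (F (downward_diagrams x z))"
  shows "b' x z (MP.pure x z x g (e (identity_diagram x))) = aug x z g"
proof (rule linear_maps_free_ext[OF F_module bilinear_map_left[OF pairing_bilinear]
      aug_linear[where X = downward_diagrams, OF downward_diag] _ g])
  show id: "e (identity_diagram x) \<in> carrier (F (upward_diagrams x x))"
    by (rule basis_vec_closed[OF level_upward[OF identity_level]])
  fix E assume E: "E \<in> downward_diagrams x z"
  have "\<not> twist_conflict x E (identity_diagram x)"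
    unfolding twist_conflict_iff[OF downward_brauer[OF E] identity_brauer] by (simp add: bb_identity)
  moreover have "E \<in> level_diagrams x z \<longleftrightarrow> x = z"
    using E level_eq downward_diag by blast
  ultimately show "b' x z (MP.pure x z x (e E) (e (identity_diagram x))) = aug x z (e E)"
    unfolding pairing_basis[OF E level_upward[OF identity_level]] pairing_value_def
      comp_identity[OF downward_brauer[OF E]]
    by (simp add: brauer_augmentation_def)
qed

lemma partial_order_brauer_le: "partial_order_on UNIV brauer_le"
  unfolding partial_order_on_def preorder_on_def
proof (intro conjI)
  show "refl_on UNIV brauer_le" by (simp add: brauer_le_def refl_on_def)
  show "antisym brauer_le" by (auto simp: brauer_le_def antisym_def)
  show "trans brauer_le"
  proof (rule transI)
    fix p q r assume "(p, q) \<in> brauer_le" "(q, r) \<in> brauer_le"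
    then have "p \<le> q" "q \<le> r" "even (q - p)" "even (r - q)"
      by (simp_all add: brauer_le_def del: even_diff_nat)
    moreover from this have "even (r - p)" by presburger
    ultimately show "(p, r) \<in> brauer_le" by (simp add: brauer_le_def)
  qed
qed simp

lemma brauer_base_category: "base_category R S brauer_le"
proof (intro base_category.intro base_category_axioms.intro S.linear_category_axioms)
  show "partial_order_on (Obj S) brauer_le" using partial_order_brauer_le by simp
  show "\<not> (\<exists>s. \<forall>n. s n \<in> Obj S \<and> (s (Suc n), s n) \<in> brauer_le \<and> s (Suc n) \<noteq> s n)"
  proof
    assume "\<exists>s. \<forall>n. s n \<in> Obj S \<and> (s (Suc n), s n) \<in> brauer_le \<and> s (Suc n) \<noteq> s n"
    then obtain s where "\<And>n. (s (Suc n), s n) \<in> brauer_le \<and> s (Suc n) \<noteq> s n" by blast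
    \<comment> \<open>A proper step down in \<open>brauer_le\<close> is a proper step down in the
      natural numbers.\<close>
    then have "(s (Suc n), s n) \<in> less_than" for n by (simp add: brauer_le_def less_le)
    then show False using wf_less_than unfolding wf_iff_no_infinite_down_chain by blast
  qed
  show "carrier (Mor S x y) = {\<zero>\<^bsub>Mor S x y\<^esub>}" if "x \<noteq> y" for x y
    using that by (simp add: level_diagrams_empty free_module_empty[OF ring_axioms])
qed

lemma brauer_bimods:
  "subcat_bimod B level_inclusion (spanned R upward_diagrams) = P"
  "subcat_bimod B level_inclusion (spanned R downward_diagrams) = M"
  by (simp_all add: brauer_plus_def brauer_minus_def)

lemma spanned_empty: "X p q = {} \<Longrightarrow> spanned R X p q = {\<zero>\<^bsub>Mor B p q\<^esub>}"
  by (simp add: spanned_def free_module_empty[OF ring_axioms])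

lemma brauer_stratified:
  "stratified_linear_category R S brauer_le B level_inclusion (spanned R upward_diagrams) (spanned R downward_diagrams)"
proof (intro stratified_linear_category.intro stratified_linear_category_axioms.intro
    brauer_base_category B.linear_category_axioms wide_upward wide_downward)
  show "Obj B = Obj S" by simp
  have incl: "level_inclusion p q = (\<lambda>v. v)" for p q by (simp add: level_inclusion_def fun_eq_iff)
  show "linear_functor R S B (\<lambda>x. x) level_inclusion"
    unfolding linear_functor_def by (simp add: incl F_inclusion[OF level_sub])
  show "spanned R upward_diagrams x y = {\<zero>\<^bsub>Mor B x y\<^esub>}" if "(x, y) \<notin> brauer_le" for x y
    by (rule spanned_empty) (use that upward_brauer_le in blast)
  show "spanned R downward_diagrams x y = {\<zero>\<^bsub>Mor B x y\<^esub>}" if "(y, x) \<notin> brauer_le" for x y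
    by (rule spanned_empty) (use that downward_brauer_le in blast)
  show "spanned R upward_diagrams x x = spanned R downward_diagrams x x" for x
    by (simp add: spanned_def upward_diag downward_diag)
  show "bij_betw (level_inclusion x x) (carrier (Mor S x x)) (spanned R upward_diagrams x x)" for x
    by (simp add: incl spanned_def upward_diag bij_betw_def)
  show "cmap x z \<in> linear_maps R
      (tensor_mod R S (subcat_bimod B level_inclusion (spanned R upward_diagrams))
        (subcat_bimod B level_inclusion (spanned R downward_diagrams)) x z) (Mor B x z)" for x z
    unfolding brauer_bimods brauer_cat_sel by (rule comp_linear)
  show "bij_betw (cmap x z)
      (carrier (tensor_mod R S (subcat_bimod B level_inclusion (spanned R upward_diagrams))
        (subcat_bimod B level_inclusion (spanned R downward_diagrams)) x z)) (carrier (Mor B x z))" for x z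
    unfolding brauer_bimods brauer_cat_sel by (rule comp_bij)
qed

lemma brauer_quasi_cellular:
  "quasi_cellular_category R S brauer_le B level_inclusion
     (spanned R upward_diagrams) (spanned R downward_diagrams) b' d'"
proof (intro quasi_cellular_category.intro quasi_cellular_category_axioms.intro brauer_stratified,
    unfold brauer_bimods Let_def spanned_def)
  show "bimod_map R S (tensor_bimod R S M P) I b'" by (rule pairing_bimod_map)
  show "bimod_map R S I (tensor_bimod R S P M) d'" by (rule copairing_bimod_map)
  show "left_unitor R M x y (tensor_map R S I M b' (\<lambda>_ _ n. n) x y
      (assoc_left R S M P M x y (tensor_map R S M (tensor_bimod R S P M) (\<lambda>_ _ m. m) d' x y
        (pure_tensor R S M I x y x g (Ident S x))))) = g"
    if "g \<in> carrier (F (downward_diagrams x y))" for x y g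
    by (rule zigzag_minus[OF that])
  show "right_unitor R P x y (tensor_map R S P I (\<lambda>_ _ m. m) b' x y
      (assoc_right R S P M P x y (tensor_map R S (tensor_bimod R S P M) P d' (\<lambda>_ _ n. n) x y
        (pure_tensor R S I P x y y (Ident S y) f)))) = f"
    if "f \<in> carrier (F (upward_diagrams x y))" for x y f
    by (rule zigzag_plus[OF that])
  show "b' z x (pure_tensor R S M P z x x (Ident B x) f) = augmentation S level_inclusion z x f"
    if f: "f \<in> carrier (F (upward_diagrams z x))" for x z f
  proof -
    have "augmentation S level_inclusion z x f = aug z x f"
      by (rule augmentation_eq) (use f in \<open>simp add: upward_diag\<close>)
    then show ?thesis using pairing_Ident_left[OF f] by simp
  qed
  show "b' x z (pure_tensor R S M P x z x g (Ident B x)) = augmentation S level_inclusion x z g"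
    if g: "g \<in> carrier (F (downward_diagrams x z))" for x z g
  proof -
    have "augmentation S level_inclusion x z g = aug x z g"
      by (rule augmentation_eq) (use g in \<open>simp add: downward_diag\<close>)
    then show ?thesis using pairing_Ident_right[OF g] by simp
  qed
qed

lemma brauer_involutive:
  "involutive_quasi_cellular_category R S brauer_le B level_inclusion
     (spanned R upward_diagrams) (spanned R downward_diagrams) b' d' (\<lambda>p. p) bar"
proof (intro involutive_quasi_cellular_category.intro involutive_quasi_cellular_category_axioms.intro
    brauer_quasi_cellular bar_anti_functor, unfold brauer_bimods Let_def spanned_def)
  show "bar x y (bar y x f) = f" if "f \<in> carrier (Mor B x y)" for x y f
    using that by (simp add: bar_bar)
  show "bar y x ` carrier (F (upward_diagrams x y)) = carrier (F (downward_diagrams y x))" for x y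
    by (rule bar_image_upward)
  show "bar y x ` carrier (F (downward_diagrams x y)) = carrier (F (upward_diagrams y x))" for x y
    by (rule bar_image_downward)
  show "bar x x (level_inclusion x x (b' x x (pure_tensor R S M P x x y g f))) =
      level_inclusion x x (b' x x (pure_tensor R S M P x x y (bar y x f) (bar x y g)))"
    if "f \<in> carrier (F (upward_diagrams x y))" "g \<in> carrier (F (downward_diagrams y x))" for x y f g
    unfolding level_inclusion_def by (rule pairing_bar[OF that(2,1)])
qed simp

end


theorem proposition6p5:
  fixes R :: "('k, 'r) ring_scheme" and \<delta> :: 'k
  assumes "cring R" and "\<delta> \<in> carrier R"
  shows "quasi_cellular_category R (level_cat R \<delta>) brauer_le (brauer_cat R \<delta>) level_inclusion
           (spanned R upward_diagrams) (spanned R downward_diagrams)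
           (brauer_pairing R \<delta>) (brauer_copairing R \<delta>)
       \<and> (\<forall>p. brauer_copairing R \<delta> p p (Ident (level_cat R \<delta>) p) = copairing_element R \<delta> p)
       \<and> involutive_quasi_cellular_category R (level_cat R \<delta>) brauer_le (brauer_cat R \<delta>)
           level_inclusion (spanned R upward_diagrams) (spanned R downward_diagrams)
           (brauer_pairing R \<delta>) (brauer_copairing R \<delta>) (\<lambda>p. p) (brauer_bar R \<delta>)"
proof -
  interpret brauer R \<delta>
    by (intro brauer.intro brauer_axioms.intro assms)
  show ?thesis
    using brauer_quasi_cellular copairing_Ident brauer_involutive by blast
qed

end
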